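(* For a fixed number of branch points, the liftable mapping class group of a balanced superelliptic cover is independent of the degree of the cover. That is, for any integers $g_1,g_2\ge 2$ and $k_1,k_2>2$ such that $k_i-1$ divides $g_i$ for $i=1,2$ and $g_1/(k_1-1)=g_2/(k_2-1)$, $$\mathrm{LMod}_{g_1,k_1}(\Sigma_0,\mathcal{B})=\mathrm{LMod}_{g_2,k_2}(\Sigma_0,\mathcal{B}).$$
   Context: Balanced superelliptic cover: let $g,k\ge 2$ be integers with $k-1\mid g$ and $n=g/(k-1)$. Embed the closed orientable surface $\Sigma_g$ of genus $g$ in $\mathbb{R}^3$, invariant under rotation by $2\pi/k$ about the $z$-axis, so that its intersection with the plane $z=a$ is: empty for $a<0$ and $a>2n+1$; the point on the $z$-axis for $a=0$ and $a=2n+1$; homeomorphic to a circle for $2m<a<2m+1$, $m\in\{0,\dots,n\}$; a rose with $k$ petals for $a\in\{1,\dots,2n\}$ (with its vertex on the $z$-axis); $k$ disjoint simple closed curves permuted by the rotation for $2m-1<a<2m$, $m\in\{1,\dots,n\}$ (for $a=2m-1/2$ they are circles with centers on the rays $\theta=2\pi d/k$, $0\le d\le k-1$). Let $\zeta:\Sigma_g\to\Sigma_g$ be this rotation; it has order $k$ and fixes exactly the $2n+2$ points of $\Sigma_g$ on the $z$-axis. The quotient $\Sigma_g/\langle\zeta\rangle$ is a sphere $\Sigma_0$, and the quotient map $p_{g,k}:\Sigma_g\to\Sigma_0$ is a $k$-fold cyclic branched cover with deck group $\langle\zeta\rangle$, branched over the set $\mathcal{B}$ of images of the $2n+2$ fixed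 points, numbered $1,\dots,2n+2$ in order of increasing $z$-value. (It is modeled by the normalization of $y^k=(x-a_1)(x-a_2)^{k-1}\cdots(x-a_{2n+1})(x-a_{2n+2})^{k-1}$, the $i$th branch point being $a_i$.) $\mathrm{Mod}(\Sigma_0,\mathcal{B})$ is the group of homotopy classes of orientation-preserving homeomorphisms of $\Sigma_0$, where homeomorphisms and homotopies preserve $\mathcal{B}$ (setwise). $\mathrm{LMod}_{g,k}(\Sigma_0,\mathcal{B})\le \mathrm{Mod}(\Sigma_0,\mathcal{B})$ is the subgroup of classes of homeomorphisms $f$ that lift, i.e. for which there is a homeomorphism $\tilde f$ of $\Sigma_g$ with $p_{g,k}\tilde f=f p_{g,k}$. The two covers have the same number $2n+2$ of branch points, where $n=g_1/(k_1-1)=g_2/(k_2-1)$; the two quotient spheres with branch sets are identified with one pair $(\Sigma_0,\mathcal{B})$ by an orientation-preserving homeomorphism respecting the numbering of the branch points. *)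

theory Defs
  imports "HOL-Homology.Homology"
begin

text \<open>
  Euclidean three-space is \<^typ>\<open>complex \<times> real\<close>; a point is \<open>(w, z)\<close> with \<open>w\<close> the horizontal
  coordinate and \<open>z\<close> the height, so the \<open>z\<close>-axis is \<open>w = 0\<close>.
\<close>

definition rotation :: "nat \<Rightarrow> complex \<times> real \<Rightarrow> complex \<times> real" where
  "rotation k = (\<lambda>(w, z). (cis (2 * pi / real k) * w, z))"

definition slice :: "(complex \<times> real) set \<Rightarrow> real \<Rightarrow> complex set" where
  "slice S a = {w. (w, a) \<in> S}"

definition simple_closed_curve :: "complex set \<Rightarrow> bool" where
  "simple_closed_curve C \<longleftrightarrow> C homeomorphic sphere (0::complex) 1"

definition rose :: "nat \<Rightarrow> complex \<Rightarrow> complex set \<Rightarrow> bool" where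
  "rose k v R \<longleftrightarrow>
     (\<exists>C. (\<forall>i<k. simple_closed_curve (C i) \<and> v \<in> C i) \<and>
          (\<forall>i<k. \<forall>j<k. i \<noteq> j \<longrightarrow> C i \<inter> C j = {v}) \<and>
          R = (\<Union>i<k. C i))"

text \<open>Orientability is \<open>H\<^sub>2 \<cong> \<int>\<close>, and the genus is half the rank of \<open>H\<^sub>1\<close>.\<close>

definition closed_orientable_surface :: "nat \<Rightarrow> (complex \<times> real) set \<Rightarrow> bool" where
  "closed_orientable_surface g S \<longleftrightarrow>
     compact S \<and> connected S \<and> S \<noteq> {} \<and>
     (\<forall>x\<in>S. \<exists>U. openin (top_of_set S) U \<and> x \<in> U \<and> U homeomorphic ball (0::complex) 1) \<and>
     homology_group 2 (top_of_set S) \<cong> integer_group \<and>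
     homology_group 1 (top_of_set S) \<cong> free_Abelian_group {..<2 * g}"

definition balanced_superelliptic_surface ::
    "nat \<Rightarrow> nat \<Rightarrow> (complex \<times> real) set \<Rightarrow> bool" where
  "balanced_superelliptic_surface g k S \<longleftrightarrow>
     closed_orientable_surface g S \<and> rotation k ` S = S \<and>
     (let n = g div (k - 1) in
        (\<forall>a. a < 0 \<or> a > real (2 * n + 1) \<longrightarrow> slice S a = {}) \<and>
        slice S 0 = {0} \<and> slice S (real (2 * n + 1)) = {0} \<and>
        (\<forall>m\<le>n. \<forall>a. real (2 * m) < a \<and> a < real (2 * m + 1) \<longrightarrow>
           simple_closed_curve (slice S a)) \<and>
        (\<forall>j\<in>{1..2 * n}. rose k 0 (slice S (real j))) \<and>
        (\<forall>m\<in>{1..n}. \<forall>a. real (2 * m - 1) < a \<and> a < real (2 * m) \<longrightarrow>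
           (\<exists>C :: nat \<Rightarrow> complex set.
              (\<forall>d<k. simple_closed_curve (C d)) \<and>
              (\<forall>d<k. \<forall>e<k. d \<noteq> e \<longrightarrow> C d \<inter> C e = {}) \<and>
              (\<forall>d<k. C d = (\<lambda>w. cis (2 * pi * real d / real k) * w) ` C 0) \<and>
              slice S a = (\<Union>d<k. C d) \<and>
              (a = real (2 * m) - 1 / 2 \<longrightarrow>
                 (\<exists>R>0. \<exists>r>0. \<forall>d<k.
                    C d = sphere (of_real R * cis (2 * pi * real d / real k)) r)))))"

text \<open>
  The sphere \<open>\<Sigma>\<^sub>0\<close> is \<^term>\<open>nsphere 2\<close>. A map \<open>p\<close> as below is the same thing as a
  homeomorphism from the orbit space of \<open>S\<close> under the rotation onto \<open>\<Sigma>\<^sub>0\<close> that sends the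
  \<open>j\<close>-th fixed point (in order of height) to \<open>b j\<close>. Two such maps with the same \<open>b\<close> identify
  the two orbit spaces. No compatibility of orientations is imposed: if \<open>p\<close> is such a map for
  \<open>S\<close>, then composing it with the reflection \<open>(w, z) \<mapsto> (cnj w, z)\<close> gives one for the mirror
  image of \<open>S\<close>, with the same liftable homeomorphisms and the other orientation.
\<close>

definition balanced_superelliptic_cover ::
    "nat \<Rightarrow> nat \<Rightarrow> (complex \<times> real) set \<Rightarrow> (complex \<times> real \<Rightarrow> nat \<Rightarrow> real) \<Rightarrow>
      (nat \<Rightarrow> nat \<Rightarrow> real) \<Rightarrow> bool" where
  "balanced_superelliptic_cover g k S p b \<longleftrightarrow>
     balanced_superelliptic_surface g k S \<and>
     quotient_map (top_of_set S) (nsphere 2) p \<and>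
     (\<forall>x\<in>S. \<forall>y\<in>S. p x = p y \<longleftrightarrow> (\<exists>i. y = (rotation k ^^ i) x)) \<and>
     (\<forall>j\<in>{1..2 * (g div (k - 1)) + 2}. p (0, real j - 1) = b j)"

definition branch_homeos :: "(nat \<Rightarrow> real) set \<Rightarrow> ((nat \<Rightarrow> real) \<Rightarrow> nat \<Rightarrow> real) set" where
  "branch_homeos B =
     {f. homeomorphic_map (nsphere 2) (nsphere 2) f \<and> Brouwer_degree2 2 f = 1 \<and> f ` B = B}"

text \<open>
  A homotopy preserves \<open>B\<close> when every stage maps \<open>B\<close> onto \<open>B\<close> and the complement of \<open>B\<close> to
  itself. Without the condition on the complement, any two elements of \<^term>\<open>branch_homeos B\<close>
  that agree on a finite \<open>B\<close> would be homotopic.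
\<close>

definition branch_homotopic ::
    "(nat \<Rightarrow> real) set \<Rightarrow> ((nat \<Rightarrow> real) \<Rightarrow> nat \<Rightarrow> real) \<Rightarrow> ((nat \<Rightarrow> real) \<Rightarrow> nat \<Rightarrow> real) \<Rightarrow> bool" where
  "branch_homotopic B =
     homotopic_with
       (\<lambda>h. h ` B = B \<and> h ` (topspace (nsphere 2) - B) \<subseteq> topspace (nsphere 2) - B)
       (nsphere 2) (nsphere 2)"

definition mapping_class ::
    "(nat \<Rightarrow> real) set \<Rightarrow> ((nat \<Rightarrow> real) \<Rightarrow> nat \<Rightarrow> real) \<Rightarrow> ((nat \<Rightarrow> real) \<Rightarrow> nat \<Rightarrow> real) set" where
  "mapping_class B f = {h \<in> branch_homeos B. branch_homotopic B f h}"

definition Mod_group :: "(nat \<Rightarrow> real) set \<Rightarrow> ((nat \<Rightarrow> real) \<Rightarrow> nat \<Rightarrow> real) set monoid" where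
  "Mod_group B =
     \<lparr>carrier = mapping_class B ` branch_homeos B,
      monoid.mult = (\<lambda>X Y. \<Union>f\<in>X. \<Union>h\<in>Y. mapping_class B (f \<circ> h)),
      one = mapping_class B id\<rparr>"

definition lifts ::
    "(complex \<times> real) set \<Rightarrow> (complex \<times> real \<Rightarrow> nat \<Rightarrow> real) \<Rightarrow>
      ((nat \<Rightarrow> real) \<Rightarrow> nat \<Rightarrow> real) \<Rightarrow> bool" where
  "lifts S p f \<longleftrightarrow>
     (\<exists>f'. homeomorphic_map (top_of_set S) (top_of_set S) f' \<and> (\<forall>x\<in>S. p (f' x) = f (p x)))"

definition LMod ::
    "(complex \<times> real) set \<Rightarrow> (complex \<times> real \<Rightarrow> nat \<Rightarrow> real) \<Rightarrow> (nat \<Rightarrow> real) set \<Rightarrow>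
      ((nat \<Rightarrow> real) \<Rightarrow> nat \<Rightarrow> real) set monoid" where
  "LMod S p B =
     (Mod_group B)\<lparr>carrier := mapping_class B ` {f \<in> branch_homeos B. lifts S p f}\<rparr>"

end

theory Submission
  imports Defs "HOL-Analysis.Analysis"
begin

text \<open>
  The horizontal coordinate \<open>w\<close> on the surface \<open>S\<close> satisfies \<open>w (\<zeta> x) = \<omega> * w x\<close> with
  \<open>\<omega> = cis (2 * pi / k)\<close>, so \<open>w ^ k\<close> descends to a function \<open>h\<close> on the sphere that vanishes
  exactly at the branch points, and the cover is the pullback of \<open>u \<mapsto> u ^ k\<close> along \<open>h\<close>.
  Hence \<open>f\<close> lifts if and only if, for some \<open>s\<close>, the function \<open>h \<circ> f / h ^ s\<close> is a \<open>k\<close>-th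
  power on the punctured sphere, which is a condition on the indices of \<open>h\<close> at the branch points.

  These indices are \<open>c, -c, c, -c, \<dots>\<close> with \<open>c\<close> coprime to \<open>k\<close>. Coprimality holds because
  \<open>S\<close> is locally a disc at the fixed points. For the alternation, \<open>w ^ k\<close> and the height embed the
  quotient sphere in \<open>\<complex> \<times> \<real>\<close>. The complement of the image has two components, and if the axis
  passes from a component back into the same one, then the indices of the branch points in between
  add up to \<open>0\<close>: the line bundle pulled back from the Hopf bundle by the direction seen from a
  point does not change while the point moves inside the component. As no index is \<open>0\<close>, the axis
  changes the component at every branch point, and two consecutive indices cancel.

  Pulling back by \<open>f\<close> permutes the indices up to signs. As \<open>k > 2\<close>, the lifting condition says
  that the alternating pattern is preserved up to one global sign, and this does not involve \<open>k\<close>.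
\<close>

section \<open>Logarithms and indices of functions on punctured neighbourhoods\<close>

text \<open>Winding numbers and fundamental groups are replaced by continuous logarithms:
  \<open>\<phi>\<close> has index \<open>m\<close> at a point if \<open>\<phi>\<close> divided by
  the \<open>m\<close>-th power of a model function satisfies \<open>germ_log\<close> for the filter
  of punctured neighbourhoods. Products, inverses and roots of functions then become sums, negatives
  and fractions of logarithms.

  The obstacle is the index pattern. The hypotheses describe every horizontal slice as a set, but
  not how neighbouring slices fit together, and the surface may be wildly embedded, so the indices
  cannot be read off by following curves from slice to slice. They come from the way in which the
  quotient sphere separates space; the slices only locate the points on the axis.

  The degree disappears through one function \<open>R\<close>, made from the numbered branch points
  and a chart alone, with simple zeros and poles alternating along the numbering. Measured by
  \<open>R\<close>, the index pattern is a constant \<open>c\<close>, and for both covers the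
  lifting condition becomes \<open>R (f y) = R y powi u * exp (\<gamma> y)\<close> with
  \<open>u = 1\<close> or \<open>u = -1\<close>.\<close>

definition germ_log :: "'a::topological_space filter \<Rightarrow> ('a \<Rightarrow> complex) \<Rightarrow> bool" where
  "germ_log F \<phi> \<longleftrightarrow>
     (\<exists>U g. eventually (\<lambda>x. x \<in> U) F \<and> continuous_on U g \<and> (\<forall>x\<in>U. \<phi> x = exp (g x)))"

lemma germ_log_mult:
  assumes "germ_log F \<phi>" "germ_log F \<psi>"
  shows "germ_log F (\<lambda>x. \<phi> x * \<psi> x)"
proof -
  obtain U g V h where
    "eventually (\<lambda>x. x \<in> U) F" "continuous_on U g" "\<And>x. x \<in> U \<Longrightarrow> \<phi> x = exp (g x)"
    "eventually (\<lambda>x. x \<in> V) F" "continuous_on V h" "\<And>x. x \<in> V \<Longrightarrow> \<psi> x = exp (h x)"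
    using assms unfolding germ_log_def by metis
  then show ?thesis
    unfolding germ_log_def
    by (intro exI[of _ "U \<inter> V"] exI[of _ "\<lambda>x. g x + h x"])
       (auto simp: exp_add eventually_conj_iff intro!: continuous_on_add elim: continuous_on_subset)
qed

lemma germ_log_inverse:
  assumes "germ_log F \<phi>"
  shows "germ_log F (\<lambda>x. inverse (\<phi> x))"
proof -
  obtain U g where
    "eventually (\<lambda>x. x \<in> U) F" "continuous_on U g" "\<And>x. x \<in> U \<Longrightarrow> \<phi> x = exp (g x)"
    using assms unfolding germ_log_def by metis
  then show ?thesis
    unfolding germ_log_def
    by (intro exI[of _ U] exI[of _ "\<lambda>x. - g x"]) (auto simp: exp_minus intro!: continuous_on_minus)
qed

lemma germ_log_divide:
  "germ_log F \<phi> \<Longrightarrow> germ_log F \<psi> \<Longrightarrow> germ_log F (\<lambda>x. \<phi> x / \<psi> x)"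
  unfolding divide_inverse by (intro germ_log_mult germ_log_inverse)

lemma germ_log_powi:
  assumes "germ_log F \<phi>"
  shows "germ_log F (\<lambda>x. \<phi> x powi m)"
proof -
  obtain U g where
    "eventually (\<lambda>x. x \<in> U) F" "continuous_on U g" "\<And>x. x \<in> U \<Longrightarrow> \<phi> x = exp (g x)"
    using assms unfolding germ_log_def by metis
  then show ?thesis
    unfolding germ_log_def
    by (intro exI[of _ U] exI[of _ "\<lambda>x. of_int m * g x"]) (auto simp: exp_power_int intro!: continuous_intros)
qed

lemma germ_log_cong:
  assumes "germ_log F \<phi>" "eventually (\<lambda>x. \<phi> x = \<psi> x) F"
  shows "germ_log F \<psi>"
proof -
  obtain U g where
    "eventually (\<lambda>x. x \<in> U) F" "continuous_on U g" "\<And>x. x \<in> U \<Longrightarrow> \<phi> x = exp (g x)"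
    using assms unfolding germ_log_def by metis
  then show ?thesis
    unfolding germ_log_def using assms(2)
    by (intro exI[of _ "U \<inter> {x. \<phi> x = \<psi> x}"] exI[of _ g])
       (auto simp: eventually_conj_iff elim: continuous_on_subset)
qed

lemma germ_log_compose:
  assumes "germ_log F \<phi>" "filterlim f F F'" "continuous_on V f" "eventually (\<lambda>x. x \<in> V) F'"
  shows "germ_log F' (\<lambda>x. \<phi> (f x))"
proof -
  obtain U g where *:
    "eventually (\<lambda>x. x \<in> U) F" "continuous_on U g" "\<And>x. x \<in> U \<Longrightarrow> \<phi> x = exp (g x)"
    using assms unfolding germ_log_def by metis
  have "eventually (\<lambda>x. f x \<in> U) F'"
    using * assms(2) by (auto simp: filterlim_iff)
  moreover have "continuous_on (V \<inter> {x. f x \<in> U}) (\<lambda>x. g (f x))"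
    by (rule continuous_on_compose2[OF *(2)]) (use assms(3) in \<open>auto elim: continuous_on_subset\<close>)
  ultimately show ?thesis
    unfolding germ_log_def using assms(4) *(3)
    by (intro exI[of _ "V \<inter> {x. f x \<in> U}"] exI[of _ "\<lambda>x. g (f x)"])
       (auto simp: eventually_conj_iff)
qed

text \<open>Values within distance \<open>norm c\<close> of \<open>c\<close> lie, after division by
  \<open>c\<close>, in the right half-plane, where the principal logarithm is continuous.\<close>

lemma germ_log_tendsto:
  assumes "(\<phi> \<longlongrightarrow> c) F" "c \<noteq> 0" "continuous_on V \<phi>" "eventually (\<lambda>x. x \<in> V) F"
  shows "germ_log F \<phi>"
proof -
  define U where "U = {x \<in> V. dist (\<phi> x) c < norm c}"
  have "eventually (\<lambda>x. x \<in> U) F"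
    using tendstoD[OF assms(1), of "norm c"] assms unfolding U_def by (auto simp: eventually_conj_iff)
  moreover have nn: "\<phi> x / c \<notin> \<real>\<^sub>\<le>\<^sub>0" "\<phi> x \<noteq> 0" if "x \<in> U" for x
  proof -
    have "dist (\<phi> x / c) 1 < 1"
      using that assms(2) unfolding U_def dist_norm
      by (simp add: diff_divide_distrib[symmetric] norm_divide divide_simps flip: diff_divide_distrib)
    then have "Re (\<phi> x / c) > 0"
      using abs_Re_le_cmod[of "\<phi> x / c - 1"] by (auto simp: dist_norm)
    then show "\<phi> x / c \<notin> \<real>\<^sub>\<le>\<^sub>0"
      by (auto simp: complex_nonpos_Reals_iff)
    then show "\<phi> x \<noteq> 0" by auto
  qed
  moreover have "continuous_on U (\<lambda>x. Ln (\<phi> x / c) + Ln c)"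
    by (intro continuous_intros continuous_on_subset[OF assms(3)]) (use nn assms in \<open>auto simp: U_def\<close>)
  ultimately show ?thesis
    unfolding germ_log_def using assms(2)
    by (intro exI[of _ U] exI[of _ "\<lambda>x. Ln (\<phi> x / c) + Ln c"]) (auto simp: exp_add)
qed

section \<open>Uniqueness and existence of local indices\<close>

lemma exp_eq_imp_diff_const:
  assumes "connected S" "continuous_on S g" "continuous_on S h"
    and "\<And>x. x \<in> S \<Longrightarrow> exp (g x) = exp (h x :: complex)"
  obtains m :: int where "\<And>x. x \<in> S \<Longrightarrow> g x = h x + 2 * of_int m * pi * \<i>"
proof -
  \<comment> \<open>The difference in units of the period of \<open>exp\<close>: continuous with
    integer values, hence constant on a connected set.\<close>
  define d where "d x = (g x - h x) / (2 * pi * \<i>)" for x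
  have d: "d x \<in> \<int>" if xS: "x \<in> S" for x
  proof -
    obtain n :: int where "g x = h x + (of_int (2 * n) * pi) * \<i>"
      using assms(4)[OF xS] unfolding exp_eq by blast
    then have "d x = of_int n" by (simp add: d_def)
    then show ?thesis by simp
  qed
  have "d constant_on S"
  proof (rule continuous_discrete_range_constant[OF assms(1)])
    show "continuous_on S d"
      unfolding d_def by (intro continuous_intros assms) auto
    show "\<exists>e>0. \<forall>y. y \<in> S \<and> d y \<noteq> d x \<longrightarrow> e \<le> cmod (d y - d x)" if xS: "x \<in> S" for x
    proof (intro exI[of _ 1] conjI allI impI)
      fix y assume y: "y \<in> S \<and> d y \<noteq> d x"
      then obtain n :: int where n: "d y - d x = of_int n"
        using Ints_diff[OF d d, of y x] xS by (auto elim: Ints_cases)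
      then have "n \<noteq> 0" using y by auto
      then show "1 \<le> cmod (d y - d x)" unfolding n norm_of_int by linarith
    qed auto
  qed
  then obtain c where c: "\<And>x. x \<in> S \<Longrightarrow> d x = c"
    unfolding constant_on_def by auto
  show thesis
  proof (cases "S = {}")
    case False
    then obtain m where "c = of_int m" using c d by (metis Ints_cases ex_in_conv)
    then have "g x = h x + 2 * of_int m * pi * \<i>" if "x \<in> S" for x
      using c[OF that] unfolding d_def by (auto simp: field_simps)
    then show thesis by (rule that)
  qed (use that in auto)
qed

text \<open>On a small circle \<open>m * (ln r + \<i> * t)\<close> is another logarithm of the same
  power, so it differs from \<open>g\<close> by a constant. After a full turn \<open>g\<close>
  returns to its value, while the other has grown by \<open>2 * pi * \<i> * m\<close>.\<close>

lemma germ_log_powi_at_0: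
  assumes "germ_log (at 0) (\<lambda>z::complex. z powi m)"
  shows "m = 0"
proof -
  obtain U g where *:
    "eventually (\<lambda>x. x \<in> U) (at (0::complex))" "continuous_on U g" "\<And>x. x \<in> U \<Longrightarrow> x powi m = exp (g x)"
    using assms unfolding germ_log_def by metis
  obtain e where e: "e > 0" "\<And>x::complex. x \<noteq> 0 \<Longrightarrow> norm x < e \<Longrightarrow> x \<in> U"
    using *(1) unfolding eventually_at by (auto simp: dist_norm)
  define r where "r = e / 2"
  have r: "r > 0" "r < e" using e by (auto simp: r_def)
  define \<gamma> where "\<gamma> t = complex_of_real r * exp (\<i> * of_real t)" for t :: real
  have \<gamma>U: "\<gamma> t \<in> U" for t
    by (rule e(2)) (use r in \<open>auto simp: \<gamma>_def norm_mult\<close>)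
  obtain n :: int where n: "\<And>t. t \<in> UNIV \<Longrightarrow> g (\<gamma> t) = of_int m * (of_real (ln r) + \<i> * of_real t) + 2 * of_int n * pi * \<i>"
  proof (rule exp_eq_imp_diff_const[of UNIV "\<lambda>t. g (\<gamma> t)" "\<lambda>t. of_int m * (of_real (ln r) + \<i> * of_real t)"])
    show "continuous_on UNIV (\<lambda>t. g (\<gamma> t))"
      by (rule continuous_on_compose2[OF *(2)]) (use \<gamma>U in \<open>auto simp: \<gamma>_def intro!: continuous_intros\<close>)
    show "exp (g (\<gamma> t)) = exp (of_int m * (of_real (ln r) + \<i> * of_real t))" for t
    proof -
      have "exp (of_real (ln r) + \<i> * of_real t) = \<gamma> t"
        using r by (simp add: \<gamma>_def exp_add exp_of_real)
      then show ?thesis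
        using *(3)[OF \<gamma>U[of t]] by (simp only: exp_power_int[symmetric])
    qed
  qed (auto intro!: continuous_intros)
  have "\<gamma> (2 * pi) = \<gamma> 0"
    by (simp add: \<gamma>_def exp_two_pi_i mult.commute[of \<i>] mult.assoc)
       (metis exp_two_pi_i mult.assoc)
  then show ?thesis using n[of 0] n[of "2 * pi"] by (auto simp: ring_distribs)
qed

lemma filterlim_diff_at: "filterlim (\<lambda>z::complex. z - a) (at 0) (at a)"
  by (auto simp: filterlim_at eventually_at_filter LIM_zero_iff tendsto_ident_at)

lemma filterlim_add_at: "filterlim (\<lambda>z::complex. z + a) (at a) (at 0)"
  by (auto simp: filterlim_at eventually_at_filter intro!: tendsto_eq_intros)

lemma germ_log_powi_at:
  assumes "germ_log (at a) (\<lambda>z::complex. (z - a) powi m)"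
  shows "m = 0"
proof (rule germ_log_powi_at_0)
  have "continuous_on UNIV (\<lambda>z. z + a)" by (intro continuous_intros)
  from germ_log_compose[OF assms filterlim_add_at[of a] this]
  show "germ_log (at 0) (\<lambda>z::complex. z powi m)" by simp
qed

lemma filterlim_inverse_at_0: "filterlim inverse (at (0::complex)) at_infinity"
  by (simp add: filterlim_def at_to_infinity)

lemma germ_log_powi_at_infinity:
  assumes "germ_log at_infinity (\<lambda>z::complex. z powi m)"
  shows "m = 0"
proof -
  have "germ_log (at 0) (\<lambda>z::complex. inverse z powi m)"
    by (rule germ_log_compose[OF assms filterlim_inverse_at_infinity, of "- {0}"])
       (auto intro!: continuous_intros simp: eventually_at_filter)
  then have "germ_log (at 0) (\<lambda>z::complex. z powi (-m))"
    by (simp add: power_int_inverse power_int_minus)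
  then show ?thesis using germ_log_powi_at_0 by fastforce
qed

text \<open>The exponential map unrolls the punctured disc to a half-plane, where
  \<open>\<phi>\<close> has a logarithm \<open>G\<close>. The index is the number of periods that
  \<open>G\<close> gains under translation by \<open>2 * pi * \<i>\<close>.\<close>

lemma germ_index_at_0:
  assumes "r > 0" and cont: "continuous_on (ball 0 r - {0}) \<phi>"
    and nz: "\<And>z. z \<in> ball 0 r - {0} \<Longrightarrow> \<phi> z \<noteq> 0"
  obtains m :: int where "germ_log (at (0::complex)) (\<lambda>z. \<phi> z / z powi m)"
proof -
  define H where "H = {z. Re z < ln r}"
  have H: "exp z \<in> ball 0 r - {0}" if "z \<in> H" for z
    using that assms(1) by (auto simp: H_def) (metis exp_less_cancel_iff exp_ln)
  have contH: "continuous_on H (\<lambda>z. \<phi> (exp z))"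
    by (rule continuous_on_compose2[OF cont]) (use H in \<open>auto intro!: continuous_intros\<close>)
  have convH: "convex H"
    unfolding H_def using convex_halfspace_Re_lt by blast
  obtain G where G: "continuous_on H G" "\<And>z. z \<in> H \<Longrightarrow> \<phi> (exp z) = exp (G z)"
    using continuous_logarithm_on_contractible[OF contH convex_imp_contractible[OF convH]] nz H by metis
  have shift: "z + 2 * pi * \<i> \<in> H" if "z \<in> H" for z using that by (auto simp: H_def)
  obtain m :: int where m: "\<And>z. z \<in> H \<Longrightarrow> G (z + 2 * pi * \<i>) = G z + 2 * of_int m * pi * \<i>"
  proof (rule exp_eq_imp_diff_const[of H "\<lambda>z. G (z + 2 * pi * \<i>)" G])
    show "continuous_on H (\<lambda>z. G (z + 2 * pi * \<i>))"
      by (rule continuous_on_compose2[OF G(1)]) (use shift in \<open>auto intro!: continuous_intros\<close>)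
    show "exp (G (z + 2 * pi * \<i>)) = exp (G z)" if "z \<in> H" for z
      using G(2)[OF that] G(2)[OF shift[OF that]] by (simp add: exp_add)
  qed (use G convH in \<open>auto simp: convex_connected\<close>)
  \<comment> \<open>Subtracting \<open>m * z\<close> removes this gain, so \<open>L\<close> is
    periodic and descends to the punctured disc; for the function itself this is the division by
    \<open>z powi m\<close>.\<close>
  define L where "L z = G z - of_int m * z" for z
  have Lshift1: "L (z + 2 * pi * \<i>) = L z" if "z \<in> H" for z
    using m[OF that] by (simp add: L_def algebra_simps)
  have Lshift_nat: "L (z + of_nat n * (2 * pi * \<i>)) = L z" if "z \<in> H" for z n
  proof (induction n)
    case (Suc n)
    have "z + of_nat n * (2 * pi * \<i>) \<in> H" using that by (auto simp: H_def)
    from Lshift1[OF this] Suc show ?case by (simp add: algebra_simps)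
  qed auto
  have Leq: "L x = L y" if xy: "x \<in> H" "y \<in> H" "exp x = exp y" for x y
  proof -
    obtain n :: int where n: "x = y + (of_int (2 * n) * pi) * \<i>"
      using xy(3) unfolding exp_eq by blast
    show ?thesis
    proof (cases "n \<ge> 0")
      case True
      then obtain j where "n = int j" by (metis nonneg_int_cases)
      then show ?thesis using Lshift_nat[OF that(2), of j] n by (simp add: algebra_simps)
    next
      case False
      then obtain j where j: "n = - int j" by (metis int_cases2 of_nat_0_le_iff)
      then have "y = x + of_nat j * (2 * pi * \<i>)" using n by (simp add: algebra_simps)
      then show ?thesis using Lshift_nat[OF that(1), of j] by simp
    qed
  qed
  define U where "U = ball (0::complex) r - {0}"
  have LnH: "Ln z \<in> H" if "z \<in> U" for z
    using that assms(1) by (auto simp: U_def H_def) 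
  have contL: "continuous_on H L"
    unfolding L_def by (intro continuous_intros G)
  \<comment> \<open>\<open>Ln\<close> jumps along the negative axis, so continuity at
    \<open>z0\<close> is checked with a branch \<open>l\<close> that is continuous on a
    neighbourhood of \<open>z0\<close>; by \<open>Leq\<close> both branches give the same value of
    \<open>L\<close>.\<close>
  have "continuous_on U (\<lambda>z. L (Ln z))"
    unfolding continuous_on_eq_continuous_within
  proof
    fix z0 assume z0: "z0 \<in> U"
    define V where "V = U \<inter> {z. z / z0 \<notin> \<real>\<^sub>\<le>\<^sub>0}"
    have "open V"
    proof -
      have "V = U \<inter> (\<lambda>z. z / z0) -` (- \<real>\<^sub>\<le>\<^sub>0)" by (auto simp: V_def)
      also have "open \<dots>"
        by (rule continuous_open_preimage) (use z0 in \<open>auto simp: U_def intro!: continuous_intros\<close>)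
      finally show ?thesis .
    qed
    have z0V: "z0 \<in> V" using z0 by (auto simp: V_def U_def)
    define l where "l z = Ln (z / z0) + Ln z0" for z
    have el: "exp (l z) = z" if "z \<in> V" for z
      using that z0 by (auto simp: l_def V_def U_def exp_add)
    have lH: "l z \<in> H" if "z \<in> V" for z
    proof -
      have "Re (l z) = ln (norm z)"
        using that z0 by (auto simp: l_def V_def U_def norm_divide ln_div)
      then show ?thesis using that assms(1) by (auto simp: H_def V_def U_def)
    qed
    have "continuous_on V l"
      unfolding l_def using z0 by (intro continuous_intros) (auto simp: V_def U_def)
    then have "continuous_on V (\<lambda>z. L (l z))"
      by (rule continuous_on_compose2[OF contL]) (use lH in auto)
    moreover have "L (l z) = L (Ln z)" if "z \<in> V" for z
      using Leq[OF lH[OF that] LnH] el[OF that] that by (auto simp: V_def U_def)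
    ultimately have "continuous_on V (\<lambda>z. L (Ln z))"
      by (simp cong: continuous_on_cong)
    then have "isCont (\<lambda>z. L (Ln z)) z0"
      using \<open>open V\<close> z0V continuous_on_eq_continuous_at by blast
    then show "continuous (at z0 within U) (\<lambda>z. L (Ln z))"
      using continuous_at_imp_continuous_at_within by blast
  qed
  moreover have "\<phi> z / z powi m = exp (L (Ln z))" if "z \<in> U" for z
  proof -
    have "z \<noteq> 0" using that by (auto simp: U_def)
    then show ?thesis using G(2)[OF LnH[OF that]]
      by (simp add: L_def exp_diff exp_power_int[symmetric])
  qed
  moreover have "eventually (\<lambda>x. x \<in> U) (at 0)"
    using assms(1) unfolding U_def eventually_at by (intro exI[of _ r]) (auto simp: dist_norm)
  ultimately have "germ_log (at 0) (\<lambda>z. \<phi> z / z powi m)"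
    unfolding germ_log_def by blast
  then show thesis by (rule that)
qed

lemma germ_index_at:
  assumes "open V" "a \<in> V" and cont: "continuous_on (V - {a}) \<phi>"
    and nz: "\<And>z. z \<in> V - {a} \<Longrightarrow> \<phi> z \<noteq> 0"
  obtains m :: int where "germ_log (at (a::complex)) (\<lambda>z. \<phi> z / (z - a) powi m)"
proof -
  obtain r where r: "r > 0" "ball a r \<subseteq> V" using assms openE by blast
  have sub: "(\<lambda>z. z + a) ` (ball 0 r - {0}) \<subseteq> V - {a}"
    using r(2) by (auto simp: dist_norm subset_iff)
  obtain m where m: "germ_log (at 0) (\<lambda>z. \<phi> (z + a) / z powi m)"
  proof (rule germ_index_at_0[OF r(1), of "\<lambda>z. \<phi> (z + a)"])
    show "continuous_on (ball 0 r - {0}) (\<lambda>z. \<phi> (z + a))"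
      by (rule continuous_on_compose2[OF cont _ sub]) (auto intro!: continuous_intros)
    show "\<phi> (z + a) \<noteq> 0" if "z \<in> ball 0 r - {0}" for z
      using nz[of "z + a"] sub that by blast
  qed
  have "continuous_on UNIV (\<lambda>z. z - a)" by (intro continuous_intros)
  from germ_log_compose[OF m filterlim_diff_at[of a] this]
  show thesis by (intro that[of m]) simp
qed

text \<open>The inversion carries a neighbourhood of infinity to a punctured disc at
  \<open>0\<close> and reverses the sign of the index.\<close>

lemma germ_index_at_infinity:
  assumes cont: "continuous_on {z. R < norm z} \<phi>"
    and nz: "\<And>z. R < norm z \<Longrightarrow> \<phi> z \<noteq> 0"
  obtains m :: int where "germ_log at_infinity (\<lambda>z::complex. \<phi> z / z powi m)"
proof -
  \<comment> \<open>The maximum keeps the radius positive also for \<open>R \<le> 0\<close>.\<close>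
  define r where "r = inverse (max R 1)"
  have r: "r > 0" by (auto simp: r_def)
  have sub: "R < norm (inverse z)" if "z \<in> ball 0 r - {0}" for z :: complex
  proof -
    have "norm z * max R 1 < 1" "norm z > 0" using that by (auto simp: r_def field_simps)
    then have "max R 1 < norm (inverse z)" by (simp only: norm_inverse) (simp add: field_simps del: max_less_iff_conj)
    then show ?thesis by linarith
  qed
  obtain m where m: "germ_log (at 0) (\<lambda>z. \<phi> (inverse z) / z powi m)"
  proof (rule germ_index_at_0[OF r(1), of "\<lambda>z. \<phi> (inverse z)"])
    show "continuous_on (ball 0 r - {0}) (\<lambda>z. \<phi> (inverse z))"
      by (rule continuous_on_compose2[OF cont]) (use sub in \<open>auto intro!: continuous_intros\<close>)
  qed (use nz sub in auto)
  have "germ_log at_infinity (\<lambda>z. \<phi> (inverse (inverse z)) / inverse z powi m)"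
    by (rule germ_log_compose[OF m filterlim_inverse_at_0, of "- {0}"])
       (auto intro!: continuous_intros simp: eventually_at_infinity intro: exI[of _ 1])
  then show thesis
    by (intro that[of "-m"]) (simp add: power_int_inverse power_int_minus)
qed

text \<open>Punctures are filled one at a time: multiplying \<open>\<phi>\<close> by
  \<open>exp (- G)\<close>, where \<open>G\<close> is the local logarithm at \<open>a\<close> cut
  off at some distance, makes it equal to \<open>1\<close> near \<open>a\<close>. Once no puncture
  is left, the plane is contractible and a logarithm exists.\<close>

lemma continuous_logarithm_punctured_plane:
  assumes "finite A" "continuous_on (- A) \<phi>" "\<And>z. z \<notin> A \<Longrightarrow> \<phi> z \<noteq> 0"
    and "\<And>a. a \<in> A \<Longrightarrow> germ_log (at a) \<phi>"
  obtains g where "continuous_on (- A) g" "\<And>z::complex. z \<notin> A \<Longrightarrow> \<phi> z = exp (g z)"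
  using assms
proof (induction A arbitrary: \<phi> thesis rule: finite_induct)
  case empty
  then show ?case
    using continuous_logarithm_on_contractible[of UNIV \<phi>] convex_imp_contractible[of "UNIV :: complex set"]
    by auto
next
  case (insert a A)
  obtain U g0 where *:
    "eventually (\<lambda>x. x \<in> U) (at a)" "continuous_on U g0" "\<And>x. x \<in> U \<Longrightarrow> \<phi> x = exp (g0 x)"
    using insert.prems(4)[of a] unfolding germ_log_def by auto
  obtain e1 where e1: "e1 > 0" "\<And>x. x \<noteq> a \<Longrightarrow> dist x a < e1 \<Longrightarrow> x \<in> U"
    using *(1) unfolding eventually_at by auto
  have "open (- A)" using insert.hyps by (simp add: finite_imp_closed open_Compl)
  then obtain e2 where e2: "e2 > 0" "ball a e2 \<subseteq> - A"
    using insert.hyps openE by (metis ComplI)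
  define r where "r = min e1 e2 / 2"
  have r: "r > 0" "r < e1" "r < e2" using e1 e2 by (auto simp: r_def)
  \<comment> \<open>\<open>cut\<close> is \<open>1\<close> up to distance \<open>r / 2\<close> and
    \<open>0\<close> at distance \<open>r\<close>, so \<open>G\<close> agrees with \<open>g0\<close>
    near \<open>a\<close> and continues by \<open>0\<close> outside the disc.\<close>
  define cut :: "complex \<Rightarrow> real" where "cut z = max 0 (min 1 (2 - 2 * dist z a / r))" for z
  define G where "G z = (if dist z a \<le> r then of_real (cut z) * g0 z else 0)" for z
  have contG: "continuous_on (- {a}) G"
  proof -
    have "continuous_on ((cball a r - {a}) \<union> (- ball a r)) G"
      unfolding G_def
    proof (rule continuous_on_cases_local)
      show "closedin (top_of_set (cball a r - {a} \<union> - ball a r)) (cball a r - {a})"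
        using r(1) by (auto simp: closedin_closed intro!: exI[of _ "cball a r"])
      show "closedin (top_of_set (cball a r - {a} \<union> - ball a r)) (- ball a r)"
        by (auto simp: closedin_closed intro!: exI[of _ "- ball a r"])
      have "cball a r - {a} \<subseteq> U"
        using r e1(2) by (auto simp: dist_commute intro!: e1(2))
      then show "continuous_on (cball a r - {a}) (\<lambda>z. complex_of_real (cut z) * g0 z)"
        unfolding cut_def
        by (intro continuous_intros continuous_on_subset[OF *(2)]) (use r in auto)
    qed (use r in \<open>auto simp: cut_def dist_commute field_simps intro!: continuous_intros\<close>)
    then show ?thesis by (rule continuous_on_subset) (use r in auto)
  qed
  define \<psi> where "\<psi> z = (if z = a then 1 else \<phi> z * exp (- G z))" for z
  have psi1: "\<psi> z = 1" if "dist z a < r / 2" for z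
  proof (cases "z = a")
    case False
    have "cut z = 1" using that r by (auto simp: cut_def field_simps)
    then have "G z = g0 z" using that r by (auto simp: G_def)
    moreover have "\<phi> z = exp (g0 z)" using False that r e1 *(3) by auto
    ultimately show ?thesis using False by (simp add: \<psi>_def exp_minus)
  qed (auto simp: \<psi>_def)
  have cont\<psi>: "continuous_on (- A) \<psi>"
  proof -
    have "continuous_on (- insert a A) \<psi>"
    proof (subst continuous_on_cong[OF refl])
      show "\<psi> z = \<phi> z * exp (- G z)" if "z \<in> - insert a A" for z using that by (auto simp: \<psi>_def)
      show "continuous_on (- insert a A) (\<lambda>z. \<phi> z * exp (- G z))"
        by (intro continuous_intros insert.prems continuous_on_subset[OF contG]) auto
    qed
    moreover have "continuous_on (ball a (r/2)) \<psi>"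
      by (subst continuous_on_cong[OF refl, of _ _ "\<lambda>_. 1"]) (auto simp: psi1 dist_commute)
    ultimately have "continuous_on ((- insert a A) \<union> ball a (r/2)) \<psi>"
      using insert.hyps by (intro continuous_on_open_Un) (auto simp: finite_imp_closed open_Compl)
    then show ?thesis by (rule continuous_on_subset) (use r in auto)
  qed
  have germ: "germ_log (at b) \<psi>" if "b \<in> A" for b
  proof -
    have "germ_log (at b) \<phi>" using insert.prems that by auto
    moreover have "germ_log (at b) (\<lambda>z. exp (- G z))"
      unfolding germ_log_def
      by (intro exI[of _ "- {a}"] exI[of _ "\<lambda>z. - G z"])
         (use contG that insert.hyps in \<open>auto intro!: continuous_intros eventually_neq_at_within\<close>)
    ultimately have "germ_log (at b) (\<lambda>z. \<phi> z * exp (- G z))" by (rule germ_log_mult)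
    moreover have "eventually (\<lambda>z. \<phi> z * exp (- G z) = \<psi> z) (at b)"
      using eventually_neq_at_within[of a b UNIV] by eventually_elim (auto simp: \<psi>_def)
    ultimately show ?thesis by (rule germ_log_cong)
  qed
  obtain g where g: "continuous_on (- A) g" "\<And>z. z \<notin> A \<Longrightarrow> \<psi> z = exp (g z)"
  proof (rule insert.IH[of \<psi>])
    show "\<psi> z \<noteq> 0" if "z \<notin> A" for z
      using insert.prems(3)[of z] that by (auto simp: \<psi>_def)
  qed (use cont\<psi> germ in auto)
  show ?case
  proof (rule insert.prems(1)[of "\<lambda>z. g z + G z"])
    show "continuous_on (- insert a A) (\<lambda>z. g z + G z)"
      by (intro continuous_intros continuous_on_subset[OF contG] continuous_on_subset[OF g(1)]) auto
    show "\<phi> z = exp (g z + G z)" if "z \<notin> insert a A" for z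
      using g(2)[of z] that by (auto simp: \<psi>_def exp_add exp_minus field_simps)
  qed
qed

section \<open>Embedded spheres in three-space and the Hopf bundle\<close>

text \<open>
  For \<open>E = (h, t)\<close> these are the eigenvectors of the Hermitian matrix with rows \<open>(t, h)\<close> and
  \<open>(cnj h, -t)\<close> for the eigenvalue \<open>norm E\<close>, that is, the fibre of the Hopf line bundle over the
  direction of \<open>E\<close>; \<open>eigenproj\<close> is a multiple of the projection onto it.
\<close>

definition eigenline :: "complex \<times> real \<Rightarrow> complex \<times> complex \<Rightarrow> bool" where
  "eigenline E v \<longleftrightarrow>
     of_real (snd E) * fst v + fst E * snd v = of_real (norm E) * fst v \<and>
     cnj (fst E) * fst v - of_real (snd E) * snd v = of_real (norm E) * snd v"

definition eigenproj :: "complex \<times> real \<Rightarrow> complex \<times> complex \<Rightarrow> complex \<times> complex" where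
  "eigenproj E v =
     ((of_real (norm E) + of_real (snd E)) * fst v + fst E * snd v,
      cnj (fst E) * fst v + (of_real (norm E) - of_real (snd E)) * snd v)"

lemma norm_complex_real_sq:
  "complex_of_real (norm E) * of_real (norm E)
     = fst E * cnj (fst E) + of_real (snd E) * of_real (snd (E :: complex \<times> real))"
proof -
  have "norm E * norm E = norm (fst E) ^ 2 + snd E * snd E"
    by (cases E) (simp add: norm_Pair power2_eq_square)
  then have "complex_of_real (norm E * norm E) = of_real (norm (fst E) ^ 2) + of_real (snd E * snd E)"
    by (simp only: of_real_add)
  then show ?thesis
    by (simp add: complex_norm_square del: of_real_power)
qed

text \<open>Let \<open>A\<close> be the Hermitian matrix of \<open>E\<close>. Then
  \<open>eigenproj E\<close> is \<open>A + norm E\<close>, and since the square of \<open>A\<close>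
  is the scalar \<open>norm E * norm E\<close>, applying \<open>A\<close> to a vector in the image
  of \<open>A + norm E\<close> multiplies it by \<open>norm E\<close>.\<close>

lemma eigenline_eigenproj: "eigenline E (eigenproj E v)"
proof -
  let ?r = "complex_of_real (norm E)"
  let ?t = "complex_of_real (snd E)"
  have n: "?r * ?r = fst E * cnj (fst E) + ?t * ?t" by (rule norm_complex_real_sq)
  have "?t * ((?r + ?t) * a + fst E * b) + fst E * (cnj (fst E) * a + (?r - ?t) * b)
        = ?r * ((?r + ?t) * a + fst E * b)" for a b
  proof -
    have "?t * ((?r + ?t) * a + fst E * b) + fst E * (cnj (fst E) * a + (?r - ?t) * b)
        - ?r * ((?r + ?t) * a + fst E * b) = (fst E * cnj (fst E) + ?t * ?t - ?r * ?r) * a"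
      by (simp add: algebra_simps)
    then show ?thesis using n by simp
  qed
  moreover have "cnj (fst E) * ((?r + ?t) * a + fst E * b) - ?t * (cnj (fst E) * a + (?r - ?t) * b)
        = ?r * (cnj (fst E) * a + (?r - ?t) * b)" for a b
  proof -
    have "cnj (fst E) * ((?r + ?t) * a + fst E * b) - ?t * (cnj (fst E) * a + (?r - ?t) * b)
        - ?r * (cnj (fst E) * a + (?r - ?t) * b) = (fst E * cnj (fst E) + ?t * ?t - ?r * ?r) * b"
      by (simp add: algebra_simps)
    then show ?thesis using n by simp
  qed
  ultimately show ?thesis by (simp add: eigenline_def eigenproj_def)
qed

text \<open>If the projection vanished, \<open>v\<close> would be an eigenvector for
  \<open>E'\<close> with eigenvalue \<open>- norm E'\<close>. The matrix of \<open>E - E'\<close>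
  would then have the eigenvalue \<open>norm E + norm E'\<close>, but its eigenvalues have absolute
  value \<open>norm (E - E')\<close>, which is smaller.\<close>

lemma eigenproj_nonzero:
  assumes "eigenline E v" "v \<noteq> 0" "norm (E - E') < norm E"
  shows "eigenproj E' v \<noteq> 0"
proof
  assume "eigenproj E' v = 0"
  define R where "R = complex_of_real (norm E + norm E')"
  define tD where "tD = complex_of_real (snd (E - E'))"
  define hD where "hD = fst (E - E')"
  have 1: "tD * fst v + hD * snd v = R * fst v"
    using assms(1) \<open>eigenproj E' v = 0\<close>
    unfolding eigenline_def eigenproj_def tD_def hD_def R_def zero_prod_def prod.inject
    by (simp add: algebra_simps)
  have 2: "cnj hD * fst v - tD * snd v = R * snd v"
    using assms(1) \<open>eigenproj E' v = 0\<close>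
    unfolding eigenline_def eigenproj_def tD_def hD_def R_def zero_prod_def prod.inject
    by (simp add: algebra_simps)
  let ?n = "complex_of_real (norm (E - E'))"
  have n: "?n * ?n = hD * cnj hD + tD * tD"
    unfolding hD_def tD_def by (rule norm_complex_real_sq)
  have "R * R * fst v = R * (tD * fst v + hD * snd v)"
    unfolding 1 by simp
  also have "\<dots> = tD * (R * fst v) + hD * (R * snd v)"
    by (simp add: algebra_simps)
  also have "\<dots> = ?n * ?n * fst v"
    unfolding 1[symmetric] 2[symmetric] n by (simp add: algebra_simps)
  finally have e1: "?n * ?n * fst v = R * R * fst v" by (rule sym)
  have "R * R * snd v = R * (cnj hD * fst v - tD * snd v)"
    unfolding 2 by simp
  then have "R * R * snd v = cnj hD * (R * fst v) - tD * (R * snd v)"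
    by (simp add: algebra_simps)
  then have e2: "?n * ?n * snd v = R * R * snd v"
    unfolding 1[symmetric] 2[symmetric] n by (simp add: algebra_simps)
  have "fst v \<noteq> 0 \<or> snd v \<noteq> 0" using assms(2) by (auto simp: prod_eq_iff)
  then have "?n * ?n = R * R"
    using mult_right_cancel[THEN iffD1, OF _ e1] mult_right_cancel[THEN iffD1, OF _ e2] by blast
  then have "norm (E - E') * norm (E - E') = (norm E + norm E') * (norm E + norm E')"
    unfolding R_def by (metis of_real_eq_iff of_real_mult)
  then have "norm (E - E') = norm E + norm E'"
    by (metis abs_norm_cancel abs_of_nonneg add_nonneg_nonneg norm_ge_zero power2_eq_square power2_eq_iff_nonneg)
  then show False using assms(3) by (smt (verit) norm_ge_zero)
qed

text \<open>For nonzero \<open>E\<close> the eigenvalues \<open>norm E\<close> and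
  \<open>- norm E\<close> differ, so the eigenspace is a line. Concretely,
  \<open>norm E - snd E\<close> and \<open>norm E + snd E\<close> do not both vanish, and whichever
  is nonzero forces the determinant of \<open>v\<close> and \<open>v'\<close> to be
  \<open>0\<close>.\<close>

lemma eigenline_parallel:
  assumes "eigenline E v" "eigenline E v'" "E \<noteq> 0"
  shows "fst v * snd v' = snd v * fst v'"
proof -
  let ?r = "complex_of_real (norm E)"
  let ?t = "complex_of_real (snd E)"
  let ?h = "fst E"
  have e: "(?r - ?t) * fst v = ?h * snd v" "(?r + ?t) * snd v = cnj ?h * fst v"
     "(?r - ?t) * fst v' = ?h * snd v'" "(?r + ?t) * snd v' = cnj ?h * fst v'"
    using assms(1,2) unfolding eigenline_def by (simp_all add: algebra_simps)
  have "(?r - ?t) * (fst v * snd v' - snd v * fst v') = 0"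
       "(?r + ?t) * (fst v * snd v' - snd v * fst v') = 0"
  proof -
    have "(?r - ?t) * (fst v * snd v' - snd v * fst v')
       = (?r - ?t) * fst v * snd v' - snd v * ((?r - ?t) * fst v')" by (simp add: algebra_simps)
    then show "(?r - ?t) * (fst v * snd v' - snd v * fst v') = 0" unfolding e by simp
    have "(?r + ?t) * (fst v * snd v' - snd v * fst v')
       = fst v * ((?r + ?t) * snd v') - (?r + ?t) * snd v * fst v'" by (simp add: algebra_simps)
    then show "(?r + ?t) * (fst v * snd v' - snd v * fst v') = 0" unfolding e by simp
  qed
  moreover have "?r - ?t \<noteq> 0 \<or> ?r + ?t \<noteq> 0"
  proof (rule ccontr)
    assume "\<not> ?thesis"
    then have "?r - ?t = 0" "?r + ?t = 0" by auto
    moreover have "2 * ?r = (?r - ?t) + (?r + ?t)" by simp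
    ultimately have "2 * ?r = 0" by (simp only: add_0_left)
    then have "?r = 0" by simp
    then show False using assms(3) by simp
  qed
  ultimately show ?thesis by auto
qed

text \<open>The Hermitian product of \<open>v\<close> and \<open>w\<close> over that of
  \<open>w\<close> with itself. For parallel vectors this is the scalar that takes \<open>w\<close>
  to \<open>v\<close>, in one formula that is continuous wherever \<open>w\<close> does not
  vanish.\<close>

definition vratio :: "complex \<times> complex \<Rightarrow> complex \<times> complex \<Rightarrow> complex" where
  "vratio v w = (fst v * cnj (fst w) + snd v * cnj (snd w)) / (fst w * cnj (fst w) + snd w * cnj (snd w))"

lemma vratio_denom: "w \<noteq> 0 \<Longrightarrow> fst w * cnj (fst w) + snd w * cnj (snd w) \<noteq> 0"
proof -
  assume "w \<noteq> 0"
  have "fst w * cnj (fst w) + snd w * cnj (snd w) = of_real (norm (fst w) ^ 2 + norm (snd w) ^ 2)"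
    by (simp only: of_real_add complex_norm_square)
  moreover have "norm (fst w) ^ 2 + norm (snd w) ^ 2 \<noteq> 0"
    using \<open>w \<noteq> 0\<close> by (auto simp: prod_eq_iff sum_power2_eq_zero_iff)
  ultimately show ?thesis by (metis of_real_eq_0_iff)
qed

lemma vratio_eq:
  assumes "fst v * snd w = snd v * fst w" "w \<noteq> 0"
  shows "fst v = vratio v w * fst w" "snd v = vratio v w * snd w"
proof -
  define D where "D = fst w * cnj (fst w) + snd w * cnj (snd w)"
  define N where "N = fst v * cnj (fst w) + snd v * cnj (snd w)"
  have "D \<noteq> 0" using vratio_denom[OF assms(2)] by (simp add: D_def)
  moreover have "D * fst v = N * fst w" "D * snd v = N * snd w"
  proof -
    have "D * fst v - N * fst w = cnj (snd w) * (fst v * snd w - snd v * fst w)"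
         "D * snd v - N * snd w = cnj (fst w) * (snd v * fst w - fst v * snd w)"
      unfolding D_def N_def by (simp_all add: algebra_simps)
    then show "D * fst v = N * fst w" "D * snd v = N * snd w" using assms(1) by simp_all
  qed
  ultimately show "fst v = vratio v w * fst w" "snd v = vratio v w * snd w"
    unfolding vratio_def D_def[symmetric] N_def[symmetric] by (simp_all add: field_simps)
qed

lemma continuous_on_vratio:
  assumes "continuous_on S f" "continuous_on S g" "\<And>x. x \<in> S \<Longrightarrow> g x \<noteq> 0"
  shows "continuous_on S (\<lambda>x. vratio (f x) (g x))"
  unfolding vratio_def by (intro continuous_intros assms ballI vratio_denom)

lemma vratio_nonzero:
  assumes "eigenline E v" "eigenline E w" "E \<noteq> 0" "v \<noteq> 0" "w \<noteq> 0"
  shows "vratio v w \<noteq> 0"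
proof
  assume 0: "vratio v w = 0"
  have "fst v = 0" "snd v = 0"
    using vratio_eq[OF eigenline_parallel[OF assms(1-3)] assms(5), unfolded 0] by simp_all
  then show False using assms(4) by (auto simp: prod_eq_iff)
qed

text \<open>The line bundle is represented by a frame on each of two sets and the transition
  function \<open>h\<close> between them. Moving the viewpoint a short way and applying
  \<open>eigenproj\<close> keeps the frames nonzero, and linearity of the projection keeps
  \<open>h\<close>; connectedness of \<open>U\<close> chains such moves together.\<close>

lemma eigenline_frames_transport:
  fixes \<Phi> :: "'a::topological_space \<Rightarrow> complex \<times> real"
  assumes cont: "continuous_on M \<Phi>" and "closed (\<Phi> ` M)"
    and U: "connected U" "U \<inter> \<Phi> ` M = {}" "y \<in> U" "y' \<in> U"
    and M: "MA \<subseteq> M" "MB \<subseteq> M"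
    and ZA: "continuous_on MA ZA" "\<And>x. x \<in> MA \<Longrightarrow> ZA x \<noteq> 0 \<and> eigenline (\<Phi> x - y) (ZA x)"
    and ZB: "continuous_on MB ZB" "\<And>x. x \<in> MB \<Longrightarrow> ZB x \<noteq> 0 \<and> eigenline (\<Phi> x - y) (ZB x)"
    and AB: "\<And>x. x \<in> MA \<inter> MB \<Longrightarrow> ZA x = (h x * fst (ZB x), h x * snd (ZB x))"
  obtains ZA' ZB' where
    "continuous_on MA ZA'" "\<And>x. x \<in> MA \<Longrightarrow> ZA' x \<noteq> 0 \<and> eigenline (\<Phi> x - y') (ZA' x)"
    "continuous_on MB ZB'" "\<And>x. x \<in> MB \<Longrightarrow> ZB' x \<noteq> 0 \<and> eigenline (\<Phi> x - y') (ZB' x)"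
    "\<And>x. x \<in> MA \<inter> MB \<Longrightarrow> ZA' x = (h x * fst (ZB' x), h x * snd (ZB' x))"
proof -
  define P where "P u \<longleftrightarrow> (\<exists>ZA ZB.
      continuous_on MA ZA \<and> (\<forall>x\<in>MA. ZA x \<noteq> 0 \<and> eigenline (\<Phi> x - u) (ZA x)) \<and>
      continuous_on MB ZB \<and> (\<forall>x\<in>MB. ZB x \<noteq> 0 \<and> eigenline (\<Phi> x - u) (ZB x)) \<and>
      (\<forall>x\<in>MA \<inter> MB. ZA x = (h x * fst (ZB x), h x * snd (ZB x))))" for u
  have step: "P u'" if u: "P u" and close: "\<And>x. x \<in> M \<Longrightarrow> dist u u' < norm (\<Phi> x - u)" for u u'
  proof -
    obtain ZA ZB where Z: "continuous_on MA ZA" "\<And>x. x \<in> MA \<Longrightarrow> ZA x \<noteq> 0 \<and> eigenline (\<Phi> x - u) (ZA x)"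
      "continuous_on MB ZB" "\<And>x. x \<in> MB \<Longrightarrow> ZB x \<noteq> 0 \<and> eigenline (\<Phi> x - u) (ZB x)"
      "\<And>x. x \<in> MA \<inter> MB \<Longrightarrow> ZA x = (h x * fst (ZB x), h x * snd (ZB x))"
      using u unfolding P_def by blast
    have nz: "eigenproj (\<Phi> x - u') v \<noteq> 0" if "x \<in> M" "v \<noteq> 0" "eigenline (\<Phi> x - u) v" for x v
      by (rule eigenproj_nonzero[OF that(3,2)]) (use close[OF that(1)] in \<open>simp add: dist_norm norm_minus_commute\<close>)
    have contp: "continuous_on N (\<lambda>x. eigenproj (\<Phi> x - u') (Z x))"
      if "continuous_on N Z" "N \<subseteq> M" for N and Z :: "'a \<Rightarrow> complex \<times> complex"
      unfolding eigenproj_def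
      by (intro continuous_intros that continuous_on_subset[OF cont])
    show ?thesis
      unfolding P_def
    proof (intro exI conjI ballI)
      show "continuous_on MA (\<lambda>x. eigenproj (\<Phi> x - u') (ZA x))" 
           "continuous_on MB (\<lambda>x. eigenproj (\<Phi> x - u') (ZB x))"
        using contp Z M by auto
      show "eigenproj (\<Phi> x - u') (ZA x) =
         (h x * fst (eigenproj (\<Phi> x - u') (ZB x)), h x * snd (eigenproj (\<Phi> x - u') (ZB x)))" if "x \<in> MA \<inter> MB" for x
        using Z(5)[OF that] by (simp add: eigenproj_def algebra_simps)
      show "eigenproj (\<Phi> x - u') (ZA x) \<noteq> 0" if "x \<in> MA" for x
        using nz[of x "ZA x"] Z(2)[OF that] M that by blast
      show "eigenproj (\<Phi> x - u') (ZB x) \<noteq> 0" if "x \<in> MB" for x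
        using nz[of x "ZB x"] Z(4)[OF that] M that by blast
    qed (rule eigenline_eigenproj)+
  qed
  have "P y'"
  proof (rule connected_induction_simple[OF U(1,3,4), where P = P])
    show "P y" unfolding P_def using ZA ZB AB by blast
    fix a assume "a \<in> U"
    then have "a \<in> - \<Phi> ` M" using U by auto
    then obtain d where d: "d > 0" "ball a d \<subseteq> - \<Phi> ` M"
      using assms(2) open_Compl openE by blast
    show "\<exists>T. openin (top_of_set U) T \<and> a \<in> T \<and> (\<forall>x\<in>T. \<forall>y\<in>T. P x \<longrightarrow> P y)"
    proof (intro exI conjI ballI impI)
      \<comment> \<open>Two points of this ball are less than \<open>2 * d / 3\<close> apart, while
        both are farther than \<open>2 * d / 3\<close> from the image of
        \<open>\<Phi>\<close>.\<close>
      show "openin (top_of_set U) (U \<inter> ball a (d/3))" by auto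
      show "a \<in> U \<inter> ball a (d/3)" using d \<open>a \<in> U\<close> by auto
      fix u u' assume uu: "u \<in> U \<inter> ball a (d/3)" "u' \<in> U \<inter> ball a (d/3)" "P u"
      show "P u'"
      proof (rule step[OF uu(3)])
        fix x assume "x \<in> M"
        then have "\<Phi> x \<notin> ball a d" using d by auto
        then have "d \<le> dist a (\<Phi> x)" by auto
        moreover have "dist a (\<Phi> x) \<le> dist a u + dist u (\<Phi> x)" "dist u u' \<le> dist a u + dist a u'"
          by (metis dist_triangle, metis dist_triangle2 dist_commute)
        ultimately have "dist u u' < dist u (\<Phi> x)" using uu by auto
        then show "dist u u' < norm (\<Phi> x - u)" by (simp add: dist_norm norm_minus_commute)
      qed
    qed
  qed
  then show thesis unfolding P_def using that by blast
qed

text \<open>This section of the eigenline vanishes exactly on the closed half-axis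
  \<open>h = 0\<close>, \<open>t \<ge> 0\<close>, so it is a frame everywhere else.\<close>

lemma eigenline_north:
  fixes h :: complex and t :: real
  defines "r \<equiv> norm (h, t)"
  shows "eigenline (h, t) (h, of_real (r - t))"
proof -
  have "complex_of_real r * r = h * cnj h + of_real t * t"
    using norm_complex_real_sq[of "(h, t)"] by (simp add: r_def)
  then show ?thesis unfolding eigenline_def r_def[symmetric]
    by (simp add: algebra_simps)
qed

text \<open>A frame away from the half-axis \<open>h = 0\<close>, \<open>t \<le> 0\<close>. By the
  second claim the section of \<open>eigenline_north\<close> is \<open>h\<close> times this one,
  which is how \<open>h\<close> becomes the transition function of the bundle.\<close>

lemma eigenline_south:
  fixes h :: complex and t :: real
  defines "r \<equiv> norm (h, t)"
  assumes "r + t \<noteq> 0"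
  shows "eigenline (h, t) (1, cnj h / of_real (r + t))"
    and "h * (cnj h / of_real (r + t)) = of_real (r - t)"
proof -
  have *: "complex_of_real r * r = h * cnj h + of_real t * t"
    using norm_complex_real_sq[of "(h, t)"] by (simp add: r_def)
  have nz: "complex_of_real r + of_real t \<noteq> 0"
    using assms(2) by (metis of_real_add of_real_eq_0_iff)
  have "h * cnj h = (complex_of_real r - of_real t) * (complex_of_real r + of_real t)"
    using * by (simp add: algebra_simps)
  then show 2: "h * (cnj h / of_real (r + t)) = of_real (r - t)"
    using nz by (simp add: field_simps)
  show "eigenline (h, t) (1, cnj h / of_real (r + t))"
    unfolding eigenline_def r_def[symmetric]
    using 2 nz by (auto simp: field_simps)
qed

lemma norm_pair_ge:
  fixes h :: complex and t :: real
  shows "norm (h, t) \<ge> \<bar>t\<bar>" "h \<noteq> 0 \<Longrightarrow> norm (h, t) > \<bar>t\<bar>"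
proof -
  have "\<bar>t\<bar> = sqrt (t\<^sup>2)" by simp
  also have "\<dots> \<le> norm (h, t)" unfolding norm_Pair by (intro real_sqrt_le_mono) auto
  finally show "norm (h, t) \<ge> \<bar>t\<bar>" .
next
  assume "h \<noteq> 0"
  have "\<bar>t\<bar> = sqrt (t\<^sup>2)" by simp
  also have "\<dots> < norm (h, t)" unfolding norm_Pair using \<open>h \<noteq> 0\<close> by (intro real_sqrt_less_mono) auto
  finally show "norm (h, t) > \<bar>t\<bar>" .
qed

text \<open>
  \<open>GA\<close>, \<open>GB\<close> and \<open>GC\<close> compare the frames transported from \<open>(0, \<alpha>)\<close> to \<open>(0, \<beta>)\<close> with the standard
  frames there, so they are one function off the axis that has index \<open>0\<close> outside the segment and
  the index of \<open>h\<close> inside.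
\<close>

lemma axis_points_same_component:
  fixes h :: "'a::topological_space \<Rightarrow> complex" and t :: "'a \<Rightarrow> real"
  assumes cont: "continuous_on M h" "continuous_on M t" and cl: "closed ((\<lambda>x. (h x, t x)) ` M)"
    and U: "connected U" "U \<inter> (\<lambda>x. (h x, t x)) ` M = {}" "(0, \<alpha>) \<in> U" "(0, \<beta>) \<in> U"
    and "\<alpha> < \<beta>"
  obtains GA GB GC where
    "continuous_on {x\<in>M. h x \<noteq> 0 \<or> t x < \<alpha>} GA" "\<And>x. x \<in> M \<Longrightarrow> h x \<noteq> 0 \<or> t x < \<alpha> \<Longrightarrow> GA x \<noteq> 0"
    "continuous_on {x\<in>M. h x \<noteq> 0 \<or> \<beta> < t x} GB" "\<And>x. x \<in> M \<Longrightarrow> h x \<noteq> 0 \<or> \<beta> < t x \<Longrightarrow> GB x \<noteq> 0"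
    "continuous_on {x\<in>M. h x \<noteq> 0 \<or> \<alpha> < t x \<and> t x < \<beta>} GC"
    "\<And>x. x \<in> M \<Longrightarrow> h x \<noteq> 0 \<or> \<alpha> < t x \<and> t x < \<beta> \<Longrightarrow> GC x \<noteq> 0"
    "\<And>x. x \<in> M \<Longrightarrow> h x \<noteq> 0 \<Longrightarrow> GA x = GB x \<and> GA x = h x * GC x"
proof -
  define \<Phi> where "\<Phi> x = (h x, t x)" for x
  have cont\<Phi>: "continuous_on M \<Phi>" unfolding \<Phi>_def by (intro continuous_intros cont)
  define N where "N c x = norm (h x, t x - c)" for c x
  \<comment> \<open>The two frames for directions seen from \<open>(0, c)\<close>: \<open>ZN\<close>
    serves except on the axis at or above height \<open>c\<close>, \<open>ZS\<close> except on the
    axis at or below it.\<close>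
  define ZN where "ZN c x = (h x, complex_of_real (N c x - (t x - c)))" for c x
  define ZS where "ZS c x = (1 :: complex, cnj (h x) / complex_of_real (N c x + (t x - c)))" for c x
  have contN: "continuous_on M (N c)" for c unfolding N_def by (intro continuous_intros cont)
  have pos: "N c x + (t x - c) > 0" if "h x \<noteq> 0 \<or> c < t x" for c x
    using that norm_pair_ge[where h = "h x" and t = "t x - c"] unfolding N_def by (smt (verit))
  have neg: "N c x - (t x - c) > 0" if "h x \<noteq> 0 \<or> t x < c" for c x
    using that norm_pair_ge[where h = "h x" and t = "t x - c"] unfolding N_def by (smt (verit))
  have ZNnz: "ZN c x \<noteq> 0 \<and> eigenline (\<Phi> x - (0, c)) (ZN c x)" if "h x \<noteq> 0 \<or> t x < c" for c x
    using neg[OF that] eigenline_north[of "h x" "t x - c"]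
    by (auto simp: ZN_def \<Phi>_def N_def zero_prod_def)
  have ZSnz: "ZS c x \<noteq> 0 \<and> eigenline (\<Phi> x - (0, c)) (ZS c x)" if "h x \<noteq> 0 \<or> c < t x" for c x
    using pos[OF that] eigenline_south(1)[of "h x" "t x - c"]
    by (auto simp: ZS_def \<Phi>_def N_def zero_prod_def)
  have contZN: "continuous_on {x\<in>M. h x \<noteq> 0 \<or> t x < c} (ZN c)" for c
    unfolding ZN_def by (intro continuous_intros continuous_on_subset[OF contN] continuous_on_subset[OF cont(1)] continuous_on_subset[OF cont(2)]) auto
  have nz: "complex_of_real (N c x + (t x - c)) \<noteq> 0" if "h x \<noteq> 0 \<or> c < t x" for c x
    using pos[OF that] by (simp only: of_real_eq_0_iff)
  have contZS: "continuous_on {x\<in>M. h x \<noteq> 0 \<or> c < t x} (ZS c)" for c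
    unfolding ZS_def
    by (intro continuous_intros continuous_on_subset[OF contN] continuous_on_subset[OF cont(1)] continuous_on_subset[OF cont(2)])
       (use nz in blast)+
  have NS: "ZN c x = (h x * fst (ZS c x), h x * snd (ZS c x))" if "h x \<noteq> 0" for c x
    using pos[of x c] that eigenline_south(2)[of "h x" "t x - c"]
    by (auto simp: ZN_def ZS_def N_def)
  have offaxis: "h x \<noteq> 0" if "x \<in> {x\<in>M. h x \<noteq> 0 \<or> t x < \<alpha>} \<inter> {x\<in>M. h x \<noteq> 0 \<or> \<alpha> < t x}" for x
    using that by auto
  \<comment> \<open>\<open>ZA\<close> and \<open>ZB\<close> arise from \<open>ZN \<alpha>\<close>
    and \<open>ZS \<alpha>\<close> by moving the viewpoint to \<open>(0, \<beta>)\<close>; they keep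
    their domains and their transition function.\<close>
  obtain ZA ZB where Z:
    "continuous_on {x\<in>M. h x \<noteq> 0 \<or> t x < \<alpha>} ZA" "\<And>x. x \<in> {x\<in>M. h x \<noteq> 0 \<or> t x < \<alpha>} \<Longrightarrow> ZA x \<noteq> 0 \<and> eigenline (\<Phi> x - (0, \<beta>)) (ZA x)"
    "continuous_on {x\<in>M. h x \<noteq> 0 \<or> \<alpha> < t x} ZB" "\<And>x. x \<in> {x\<in>M. h x \<noteq> 0 \<or> \<alpha> < t x} \<Longrightarrow> ZB x \<noteq> 0 \<and> eigenline (\<Phi> x - (0, \<beta>)) (ZB x)"
    "\<And>x. x \<in> {x\<in>M. h x \<noteq> 0 \<or> t x < \<alpha>} \<inter> {x\<in>M. h x \<noteq> 0 \<or> \<alpha> < t x} \<Longrightarrow> ZA x = (h x * fst (ZB x), h x * snd (ZB x))"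
  proof (rule eigenline_frames_transport[OF cont\<Phi> _ U(1) _ U(3,4) _ _ contZN[of \<alpha>] _ contZS[of \<alpha>]])
    show "closed (\<Phi> ` M)" "U \<inter> \<Phi> ` M = {}" using cl U(2) by (simp_all add: \<Phi>_def)
    show "ZN \<alpha> x = (h x * fst (ZS \<alpha> x), h x * snd (ZS \<alpha> x))"
      if "x \<in> {x\<in>M. h x \<noteq> 0 \<or> t x < \<alpha>} \<inter> {x\<in>M. h x \<noteq> 0 \<or> \<alpha> < t x}" for x
      by (rule NS) (rule offaxis[OF that])
    show "ZN \<alpha> x \<noteq> 0 \<and> eigenline (\<Phi> x - (0, \<alpha>)) (ZN \<alpha> x)" if "x \<in> {x\<in>M. h x \<noteq> 0 \<or> t x < \<alpha>}" for x
      by (rule ZNnz) (use that in auto)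
    show "ZS \<alpha> x \<noteq> 0 \<and> eigenline (\<Phi> x - (0, \<alpha>)) (ZS \<alpha> x)" if "x \<in> {x\<in>M. h x \<noteq> 0 \<or> \<alpha> < t x}" for x
      by (rule ZSnz) (use that in auto)
  qed auto
  have E: "\<Phi> x - (0, \<beta>) \<noteq> 0" if "x \<in> M" for x
  proof
    assume "\<Phi> x - (0, \<beta>) = 0"
    then have "\<Phi> x = (0, \<beta>)" by simp
    then have "(0, \<beta>) \<in> \<Phi> ` M" using imageI[OF that, of \<Phi>] by simp
    then show False using U(2,4) unfolding \<Phi>_def by blast
  qed
  \<comment> \<open>Off the axis \<open>ZA\<close> is \<open>h\<close> times \<open>ZB\<close> and
    \<open>ZN \<beta>\<close> is \<open>h\<close> times \<open>ZS \<beta>\<close>. Hence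
    \<open>ZA\<close> over \<open>ZN \<beta>\<close> equals \<open>ZB\<close> over
    \<open>ZS \<beta>\<close>, and it is \<open>h\<close> times \<open>ZB\<close> over
    \<open>ZN \<beta>\<close>. Each quotient extends over the part of the axis where both of its
    frames exist.\<close>
  show thesis
  proof (rule that)
    show "continuous_on {x\<in>M. h x \<noteq> 0 \<or> t x < \<alpha>} (\<lambda>x. vratio (ZA x) (ZN \<beta> x))"
      by (intro continuous_on_vratio continuous_on_subset[OF Z(1)] continuous_on_subset[OF contZN[of \<beta>]])
         (use ZNnz[of _ \<beta>] \<open>\<alpha> < \<beta>\<close> in auto)
    show "continuous_on {x\<in>M. h x \<noteq> 0 \<or> \<beta> < t x} (\<lambda>x. vratio (ZB x) (ZS \<beta> x))"
      by (intro continuous_on_vratio continuous_on_subset[OF Z(3)] continuous_on_subset[OF contZS[of \<beta>]])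
         (use ZSnz[of _ \<beta>] \<open>\<alpha> < \<beta>\<close> in auto)
    show "continuous_on {x\<in>M. h x \<noteq> 0 \<or> \<alpha> < t x \<and> t x < \<beta>} (\<lambda>x. vratio (ZB x) (ZN \<beta> x))"
      by (intro continuous_on_vratio continuous_on_subset[OF Z(3)] continuous_on_subset[OF contZN[of \<beta>]])
         (use ZNnz[of _ \<beta>] \<open>\<alpha> < \<beta>\<close> in auto)
    fix x assume x: "x \<in> M"
    show "vratio (ZA x) (ZN \<beta> x) \<noteq> 0" if "h x \<noteq> 0 \<or> t x < \<alpha>"
      using Z(2)[of x] ZNnz[of x \<beta>] E[OF x] that x \<open>\<alpha> < \<beta>\<close> by (intro vratio_nonzero) auto
    show "vratio (ZB x) (ZS \<beta> x) \<noteq> 0" if "h x \<noteq> 0 \<or> \<beta> < t x"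
      using Z(4)[of x] ZSnz[of x \<beta>] E[OF x] that x \<open>\<alpha> < \<beta>\<close> by (intro vratio_nonzero) auto
    show "vratio (ZB x) (ZN \<beta> x) \<noteq> 0" if "h x \<noteq> 0 \<or> \<alpha> < t x \<and> t x < \<beta>"
      using Z(4)[of x] ZNnz[of x \<beta>] E[OF x] that x \<open>\<alpha> < \<beta>\<close> by (intro vratio_nonzero) auto
    assume hx: "h x \<noteq> 0"
    have A: "ZA x = (h x * fst (ZB x), h x * snd (ZB x))" using Z(5)[of x] x hx by auto
    have s1: "vratio (a * v1, a * v2) (a * w1, a * w2) = vratio (v1, v2) (w1, w2)"
      if "a \<noteq> 0" for a v1 v2 w1 w2
    proof -
      have "a * v1 * cnj (a * w1) + a * v2 * cnj (a * w2) = (a * cnj a) * (v1 * cnj w1 + v2 * cnj w2)" 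
       for v1 v2 by (simp add: algebra_simps)
      moreover have "a * cnj a \<noteq> 0" using that by simp
      ultimately show ?thesis by (simp only: vratio_def fst_conv snd_conv mult_divide_mult_cancel_left_if if_False)
    qed
    have s2: "vratio (a * v1, a * v2) w = a * vratio (v1, v2) w" for a v1 v2 w
      by (simp add: vratio_def algebra_simps add_divide_distrib)
    show "vratio (ZA x) (ZN \<beta> x) = vratio (ZB x) (ZS \<beta> x) \<and> vratio (ZA x) (ZN \<beta> x) = h x * vratio (ZB x) (ZN \<beta> x)"
      unfolding A NS[OF hx, of \<beta>]
      using s1[OF hx, of "fst (ZB x)" "snd (ZB x)" "fst (ZS \<beta> x)" "snd (ZS \<beta> x)"]
        s2[of "h x" "fst (ZB x)" "snd (ZB x)"]
      by simp
  qed
qed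

section \<open>Complements of embedded spheres in three-space\<close>

definition R3_coords :: "complex \<times> real \<Rightarrow> nat \<Rightarrow> real" where
  "R3_coords u i = (if i = 0 then Re (fst u) else if i = 1 then Im (fst u) else if i = 2 then snd u else 0)"

definition R3_point :: "(nat \<Rightarrow> real) \<Rightarrow> complex \<times> real" where
  "R3_point x = (Complex (x 0) (x 1), x 2)"

lemma homeomorphic_maps_R3: "homeomorphic_maps euclidean (Euclidean_space 3) R3_coords R3_point"
  unfolding homeomorphic_maps_def
proof (intro conjI ballI)
  show "continuous_map euclidean (Euclidean_space 3) R3_coords"
    unfolding Euclidean_space_def continuous_map_in_subtopology continuous_map_componentwise
  proof (intro conjI ballI)
    show "continuous_map euclidean euclideanreal (\<lambda>x. R3_coords x k)" for k
      by (cases "k = 0"; cases "k = 1"; cases "k = 2")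
         (auto simp: R3_coords_def continuous_map_iff_continuous2 intro!: continuous_intros)
  qed (auto simp: R3_coords_def)
  have "continuous_on {x. \<forall>i\<ge>3. x i = 0} (\<lambda>x::nat \<Rightarrow> real. x i)" for i
    by (rule continuous_on_subset[OF continuous_on_product_coordinates]) auto
  then show "continuous_map (Euclidean_space 3) euclidean R3_point"
    unfolding Euclidean_space_def euclidean_product_topology continuous_map_iff_continuous R3_point_def
    by (intro continuous_on_Pair continuous_on_Complex)
  show "R3_point (R3_coords x) = x" for x
    by (simp add: R3_point_def R3_coords_def)
  show "R3_coords (R3_point y) = y" if "y \<in> topspace (Euclidean_space 3)" for y
  proof
    fix i :: nat
    show "R3_coords (R3_point y) i = y i"
      using that by (auto simp: R3_point_def R3_coords_def topspace_Euclidean_space)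
  qed
qed

lemma R3_coords_in_nsphere: "R3_coords u \<in> topspace (nsphere 2) \<longleftrightarrow> norm u = 1"
proof -
  have "norm u = 1 \<longleftrightarrow> norm u ^ 2 = 1" by (simp add: power2_eq_1_iff) (smt (verit) norm_ge_zero)
  also have "norm u ^ 2 = (Re (fst u))\<^sup>2 + (Im (fst u))\<^sup>2 + (snd u)\<^sup>2"
    by (cases u) (simp add: norm_Pair cmod_power2)
  finally show ?thesis
    by (auto simp: nsphere R3_coords_def numeral_2_eq_2)
qed

text \<open>The number of components of the complement of a closed subset of Euclidean space is a
  topological invariant of the subset. For the unit sphere it is at most two, so among three points
  of the complement two are joined.\<close>

lemma complement_embedded_sphere_components:
  fixes T :: "(complex \<times> real) set"
  assumes "compact T" and hom: "top_of_set T homeomorphic_space nsphere 2"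
    and abc: "a \<notin> T" "b \<notin> T" "c \<notin> T"
  shows "connected_component (- T) a b \<or> connected_component (- T) b c \<or> connected_component (- T) a c"
proof -
  let ?E = "Euclidean_space 3"
  note hm = homeomorphic_maps_R3
  have cmc: "continuous_map euclidean ?E R3_coords" and cmp: "continuous_map ?E euclidean R3_point"
    and inv: "\<And>x. R3_point (R3_coords x) = x"
    and inv': "\<And>y. y \<in> topspace ?E \<Longrightarrow> R3_coords (R3_point y) = y"
    using hm unfolding homeomorphic_maps_def by auto
  have range: "R3_coords u \<in> topspace ?E" for u using cmc unfolding continuous_map_def by auto
  have closed_im: "closedin ?E (R3_coords ` C)" if "closed C" for C
    using homeomorphic_maps_map[THEN iffD1, OF hm] that
    by (metis closed_closedin homeomorphic_imp_closed_map closed_map_def)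
  define S where "S = topspace (nsphere 2)"
  have Ssub: "S \<subseteq> topspace ?E" unfolding S_def nsphere_def by (simp add: numeral_3_eq_3 numeral_2_eq_2)
  have nS: "subtopology ?E S = nsphere 2"
    unfolding S_def nsphere_def by (simp add: numeral_3_eq_3 numeral_2_eq_2 subtopology_restrict)
  have clS: "closedin ?E S" 
  proof -
    have "S = R3_coords ` sphere 0 1"
    proof (intro equalityI subsetI)
      fix x assume "x \<in> S"
      then have x: "x = R3_coords (R3_point x)" using inv' Ssub by (metis subsetD)
      then have "norm (R3_point x) = 1"
        using \<open>x \<in> S\<close> R3_coords_in_nsphere unfolding S_def by metis
      then show "x \<in> R3_coords ` sphere 0 1" using x by (metis imageI mem_sphere_0)
    qed (auto simp: S_def R3_coords_in_nsphere)
    then show ?thesis using closed_im[OF closed_sphere] by simp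
  qed
  have clT: "closedin ?E (R3_coords ` T)"
    using closed_im assms(1) compact_imp_closed by blast
  have homT: "subtopology ?E (R3_coords ` T) homeomorphic_space subtopology ?E S"
  proof -
    have "homeomorphic_maps (top_of_set T) (subtopology ?E (R3_coords ` T)) R3_coords R3_point"
      by (rule homeomorphic_maps_subtopologies[OF hm]) (auto simp: range inv)
    then have "top_of_set T homeomorphic_space subtopology ?E (R3_coords ` T)"
      unfolding homeomorphic_space_def by blast
    then show ?thesis using hom nS by (metis homeomorphic_space_sym homeomorphic_space_trans)
  qed
  define X where "X = subtopology ?E (topspace ?E - R3_coords ` T)"
  define Y where "Y = subtopology ?E (topspace ?E - S)"
  have eq: "connected_components_of X \<approx> connected_components_of Y"
    unfolding X_def Y_def by (rule eqpoll_connected_components_Euclidean_complements[OF clT clS homT])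
  have conn: "connected_component_of Y (R3_coords u) (R3_coords v)"
    if "connected C" "u \<in> C" "v \<in> C" "\<And>x. x \<in> C \<Longrightarrow> norm x \<noteq> 1" for u v C
    unfolding connected_component_of_def
  proof (intro exI conjI)
    have "connectedin ?E (R3_coords ` C)"
      by (rule connectedin_continuous_map_image[OF cmc]) (use that in auto)
    then show "connectedin Y (R3_coords ` C)"
      unfolding Y_def using that range R3_coords_in_nsphere by (auto simp: connectedin_subtopology S_def)
  qed (use that in auto)
  \<comment> \<open>Every point off the unit sphere is joined to the centre or to a point of norm
    \<open>2\<close>: balls and complements of balls are connected.\<close>
  have subY: "connected_components_of Y \<subseteq> {connected_component_of_set Y (R3_coords (0,0)), connected_component_of_set Y (R3_coords (0,2))}"
  proof
    fix C assume "C \<in> connected_components_of Y"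
    then obtain y where y: "y \<in> topspace Y" "C = connected_component_of_set Y y"
      unfolding connected_components_of_def by auto
    define u where "u = R3_point y"
    have yu: "y = R3_coords u" using y inv' by (auto simp: u_def Y_def)
    have "norm u \<noteq> 1" using y(1) R3_coords_in_nsphere unfolding yu Y_def S_def by auto
    then consider "norm u < 1" | "norm u > 1" by linarith
    then show "C \<in> {connected_component_of_set Y (R3_coords (0,0)), connected_component_of_set Y (R3_coords (0,2))}"
    proof cases
      case 1
      have "connected_component_of Y y (R3_coords (0,0))" unfolding yu
        by (rule conn[of "ball 0 1"]) (use 1 in \<open>auto simp: zero_prod_def[symmetric]\<close>)
      from this[THEN connected_component_of_equiv[THEN iffD1]]
      show ?thesis unfolding y(2) by auto
    next
      case 2
      have "connected_component_of Y y (R3_coords (0,2))" unfolding yu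
      proof (rule conn[of "- cball 0 1"])
        show "connected (- cball (0 :: complex \<times> real) 1)"
          by (rule connected_complement_bounded_convex) auto
      qed (use 2 in \<open>auto simp: norm_Pair\<close>)
      from this[THEN connected_component_of_equiv[THEN iffD1]]
      show ?thesis unfolding y(2) by auto
    qed
  qed
  have two: "card {P, Q} \<le> 2" for P Q :: "(nat \<Rightarrow> real) set"
    by (simp add: card_insert_if)
  have "finite (connected_components_of Y)"
    by (rule finite_subset[OF subY]) auto
  moreover have "card (connected_components_of Y) \<le> 2"
    by (rule le_trans[OF card_mono[OF _ subY] two]) auto
  ultimately have finX: "finite (connected_components_of X)" "card (connected_components_of X) \<le> 2"
    using eq eqpoll_finite_iff[OF eq] eqpoll_iff_card[of "connected_components_of X" "connected_components_of Y"]
    by simp_all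
  have in_top: "R3_coords u \<in> topspace X" if "u \<notin> T" for u
    using that range[of u] by (simp add: X_def inj_image_mem_iff[OF inj_on_inverseI[of UNIV R3_point R3_coords]] inv)
  have mem: "connected_component_of_set X (R3_coords u) \<in> connected_components_of X" if "u \<notin> T" for u
    using in_top[OF that] by (simp add: connected_component_in_connected_components_of)
  have joined: "connected_component (- T) u v"
    if "connected_component_of_set X (R3_coords u) = connected_component_of_set X (R3_coords v)" "u \<notin> T" "v \<notin> T" for u v
  proof -
    have "connected_component_of X (R3_coords u) (R3_coords v)"
      using that in_top connected_component_of_refl[of X] by (metis mem_Collect_eq)
    then obtain C where C: "connectedin X C" "R3_coords u \<in> C" "R3_coords v \<in> C"
      unfolding connected_component_of_def by auto
    have C': "connectedin ?E C" "C \<subseteq> topspace ?E - R3_coords ` T" using C(1) unfolding X_def connectedin_subtopology by auto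
    have "connected (R3_point ` C)" using connectedin_continuous_map_image[OF cmp C'(1)] by simp
    moreover have "R3_point ` C \<subseteq> - T"
    proof
      fix x assume "x \<in> R3_point ` C"
      then obtain y where y: "y \<in> C" "x = R3_point y" by auto
      then have "y \<in> topspace ?E" "y \<notin> R3_coords ` T" using C'(2) by auto
      then show "x \<in> - T" using inv'[of y] y(2) by (metis ComplI imageI)
    qed
    moreover have "u \<in> R3_point ` C" "v \<in> R3_point ` C" using C inv by (metis imageI)+
    ultimately show ?thesis unfolding connected_component_def by blast
  qed
  have "card {connected_component_of_set X (R3_coords a), connected_component_of_set X (R3_coords b), connected_component_of_set X (R3_coords c)} \<le> 2"
    by (rule le_trans[OF card_mono[OF finX(1)] finX(2)]) (simp add: mem abc)
  moreover have "P = Q \<or> Q = R \<or> P = R" if "card {P, Q, R} \<le> 2" for P Q R :: "(nat \<Rightarrow> real) set"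
    using that by (simp add: card_insert_if split: if_splits)
  ultimately have "connected_component_of_set X (R3_coords a) = connected_component_of_set X (R3_coords b) \<or>
     connected_component_of_set X (R3_coords b) = connected_component_of_set X (R3_coords c) \<or>
     connected_component_of_set X (R3_coords a) = connected_component_of_set X (R3_coords c)"
    by blast
  then show ?thesis using joined abc by blast
qed

section \<open>Indices on the punctured sphere\<close>

text \<open>For distinct \<open>a j\<close>, the rational function with index \<open>m j\<close> at
  \<open>a j\<close>. At infinity its index in the coordinate \<open>z\<close> is the sum of the
  \<open>m j\<close>, since each \<open>(z - a j) / z\<close> tends to \<open>1\<close>.\<close>

definition factor_product :: "'i set \<Rightarrow> ('i \<Rightarrow> complex) \<Rightarrow> ('i \<Rightarrow> int) \<Rightarrow> complex \<Rightarrow> complex" where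
  "factor_product J a m z = (\<Prod>j\<in>J. (z - a j) powi m j)"

lemma germ_log_const: "c \<noteq> 0 \<Longrightarrow> germ_log F (\<lambda>_. c)"
  by (rule germ_log_tendsto[of _ c _ UNIV]) auto

lemma germ_log_prod:
  assumes "finite J" "\<And>j. j \<in> J \<Longrightarrow> germ_log F (\<phi> j)"
  shows "germ_log F (\<lambda>x. \<Prod>j\<in>J. \<phi> j x)"
  using assms by (induction J rule: finite_induct) (auto intro: germ_log_const germ_log_mult)

lemma factor_product_at:
  assumes "finite J" "inj_on a J" "i \<in> J"
  shows "germ_log (at (a i)) (\<lambda>z. factor_product J a m z / (z - a i) powi m i)"
proof (rule germ_log_cong)
  show "germ_log (at (a i)) (\<lambda>z. \<Prod>j\<in>J - {i}. (z - a j) powi m j)"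
  proof (intro germ_log_prod germ_log_powi)
    fix j assume j: "j \<in> J - {i}"
    show "germ_log (at (a i)) (\<lambda>z. z - a j)"
    proof (rule germ_log_tendsto)
      show "LIM z (at (a i)). z - a j :> nhds (a i - a j)"
        by (intro tendsto_intros)
      show "a i - a j \<noteq> 0" using j assms by (auto dest: inj_onD)
      show "continuous_on UNIV (\<lambda>z. z - a j)" by (intro continuous_intros)
    qed auto
  qed (use assms in auto)
  show "\<forall>\<^sub>F z in at (a i). (\<Prod>j\<in>J - {i}. (z - a j) powi m j) = factor_product J a m z / (z - a i) powi m i"
    using eventually_neq_at_within[of "a i" "a i" UNIV]
    by eventually_elim (simp add: factor_product_def prod.remove[OF assms(1,3)])
qed

lemma germ_log_diff_at_infinity: "germ_log at_infinity (\<lambda>z::complex. (z - a) / z)"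
proof (rule germ_log_tendsto)
  have "LIM z at_infinity. 1 - a * inverse z :> nhds (1 - a * 0)"
    by (intro tendsto_intros tendsto_inverse_0)
  moreover have "\<forall>\<^sub>F z::complex in at_infinity. 1 - a * inverse z = (z - a) / z"
    unfolding eventually_at_infinity
  proof (intro exI[of _ 1] allI impI)
    fix z :: complex assume "1 \<le> norm z"
    then have "z \<noteq> 0" by auto
    then show "1 - a * inverse z = (z - a) / z" by (simp add: divide_simps)
  qed
  ultimately show "LIM z at_infinity. (z - a) / z :> nhds 1"
    by (auto elim: Lim_transform_eventually)
  show "continuous_on (- {0}) (\<lambda>z. (z - a) / z)" by (auto intro!: continuous_intros)
  show "\<forall>\<^sub>F z::complex in at_infinity. z \<in> - {0}"
    unfolding eventually_at_infinity by (intro exI[of _ 1]) auto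
qed auto

lemma power_int_sum:
  fixes z :: complex
  assumes "finite J" "z \<noteq> 0"
  shows "z powi (\<Sum>j\<in>J. m j) = (\<Prod>j\<in>J. z powi m j)"
  using assms by (induction J rule: finite_induct) (auto simp: power_int_add)

lemma factor_product_at_infinity:
  assumes "finite J"
  shows "germ_log at_infinity (\<lambda>z. factor_product J a m z / z powi (\<Sum>j\<in>J. m j))"
proof (rule germ_log_cong)
  show "germ_log at_infinity (\<lambda>z. \<Prod>j\<in>J. ((z - a j) / z) powi m j)"
    using assms by (intro germ_log_prod germ_log_powi germ_log_diff_at_infinity)
  have "\<forall>\<^sub>F z::complex in at_infinity. z \<noteq> 0"
    unfolding eventually_at_infinity by (intro exI[of _ 1]) auto
  then show "\<forall>\<^sub>F z in at_infinity. (\<Prod>j\<in>J. ((z - a j) / z) powi m j) = factor_product J a m z / z powi (\<Sum>j\<in>J. m j)"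
    by eventually_elim
       (simp add: factor_product_def power_int_sum assms power_int_divide_distrib prod_dividef)
qed

lemma continuous_on_factor_product:
  "continuous_on (- a ` J) (factor_product J a m)"
  unfolding factor_product_def by (auto intro!: continuous_intros)

lemma factor_product_nonzero: "z \<notin> a ` J \<Longrightarrow> finite J \<Longrightarrow> factor_product J a m z \<noteq> 0"
  unfolding factor_product_def by (auto simp: prod_zero_iff)

section \<open>The sphere and its chart at the branch points\<close>

lemma nsphere2_eq_top_of_set: "nsphere 2 = top_of_set (topspace (nsphere 2))"
  by (simp add: nsphere euclidean_product_topology)

lemma filterlim_at_within_homeomorphism:
  fixes f :: "'a::topological_space \<Rightarrow> 'b::topological_space"
  assumes "continuous_on S f" "inj_on f S" "f ` S \<subseteq> T" "x \<in> S"
  shows "filterlim f (at (f x) within T) (at x within S)"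
  unfolding filterlim_at
proof
  show "\<forall>\<^sub>F y in at x within S. f y \<in> T \<and> f y \<noteq> f x"
    unfolding eventually_at_filter using assms by (auto intro!: always_eventually dest: inj_onD)
  show "LIM y (at x within S). f y :> nhds (f x)"
    using assms by (auto simp: continuous_on_def)
qed

lemma R3_point_R3_coords: "R3_point (R3_coords u) = u"
  by (simp add: R3_point_def R3_coords_def)

lemma R3_coords_R3_point: "x \<in> topspace (nsphere 2) \<Longrightarrow> R3_coords (R3_point x) = x"
proof -
  assume "x \<in> topspace (nsphere 2)"
  then have "x \<in> topspace (Euclidean_space 3)"
    by (auto simp: nsphere topspace_Euclidean_space numeral_3_eq_3 numeral_2_eq_2)
  then show ?thesis using homeomorphic_maps_R3 unfolding homeomorphic_maps_def by blast
qed

lemma continuous_on_R3_coords: "continuous_on UNIV R3_coords"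
  using homeomorphic_maps_R3 unfolding homeomorphic_maps_def Euclidean_space_def
  by (auto simp: euclidean_product_topology continuous_map_in_subtopology)

lemma continuous_on_R3_point: "continuous_on (topspace (nsphere 2)) R3_point"
proof -
  have "continuous_map (Euclidean_space 3) euclidean R3_point"
    using homeomorphic_maps_R3 unfolding homeomorphic_maps_def by blast
  then have "continuous_on (topspace (Euclidean_space 3)) R3_point"
    by (simp add: Euclidean_space_def euclidean_product_topology)
  then show ?thesis
    by (rule continuous_on_subset)
       (auto simp: nsphere topspace_Euclidean_space numeral_3_eq_3 numeral_2_eq_2)
qed

lemma norm_R3_point: "x \<in> topspace (nsphere 2) \<Longrightarrow> norm (R3_point x) = 1"
  using R3_coords_in_nsphere[of "R3_point x"] R3_coords_R3_point[of x] by simp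

lemma compact_nsphere2: "compact (topspace (nsphere 2))"
proof -
  have "topspace (nsphere 2) = R3_coords ` sphere 0 1"
    using R3_coords_R3_point norm_R3_point R3_coords_in_nsphere
    by (intro equalityI subsetI) (metis imageI mem_sphere_0, auto)
  then show ?thesis
    by (simp add: compact_continuous_image continuous_on_subset[OF continuous_on_R3_coords])
qed

text \<open>This depends on the numbered branch points and a chart, not on a cover, so two covers
  with the same \<open>b\<close> share it. The chart sends the last branch point to infinity and
  leaves the other \<open>2 * n + 1\<close> in the plane.\<close>

locale sphere_chart =
  fixes n :: nat and b :: "nat \<Rightarrow> nat \<Rightarrow> real"
    and \<tau> :: "complex \<Rightarrow> nat \<Rightarrow> real" and \<sigma> :: "(nat \<Rightarrow> real) \<Rightarrow> complex"
  assumes inj_b: "inj_on b {1..2 * n + 2}"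
    and b_in: "\<And>j. j \<in> {1..2 * n + 2} \<Longrightarrow> b j \<in> topspace (nsphere 2)"
    and chart: "homeomorphism UNIV (topspace (nsphere 2) - {b (2 * n + 2)}) \<tau> \<sigma>"
begin

abbreviation "M \<equiv> topspace (nsphere 2)"
abbreviation "B \<equiv> b ` {1..2 * n + 2}"
abbreviation "I \<equiv> {1..2 * n + 2}"
abbreviation "J \<equiv> {1..2 * n + 1}"

definition a :: "nat \<Rightarrow> complex" where "a j = \<sigma> (b j)"
definition \<epsilon> :: "nat \<Rightarrow> int" where "\<epsilon> j = (-1) ^ (j + 1)"
text \<open>The reference function: in the chart it has simple zeros at the odd and simple poles at
  the even branch points. Its total degree over \<open>J\<close> is \<open>1\<close>, so it grows
  like \<open>z\<close> at infinity; this is a simple pole at the even number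
  \<open>2 * n + 2\<close>, and the alternation includes infinity.\<close>

definition R :: "(nat \<Rightarrow> real) \<Rightarrow> complex" where "R y = factor_product J a \<epsilon> (\<sigma> y)"
definition chart_filter :: "nat \<Rightarrow> complex filter" where
  "chart_filter j = (if j = 2 * n + 2 then at_infinity else at (a j))"
definition coord :: "nat \<Rightarrow> complex \<Rightarrow> complex" where
  "coord j z = (if j = 2 * n + 2 then z else z - a j)"

lemma \<tau>_\<sigma>: "y \<in> M \<Longrightarrow> y \<noteq> b (2 * n + 2) \<Longrightarrow> \<tau> (\<sigma> y) = y"
  and \<sigma>_\<tau>: "\<sigma> (\<tau> z) = z" and \<tau>_in: "\<tau> z \<in> M" and \<tau>_neq: "\<tau> z \<noteq> b (2 * n + 2)"
  and cont_\<tau>: "continuous_on UNIV \<tau>" and cont_\<sigma>: "continuous_on (M - {b (2 * n + 2)}) \<sigma>"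
  using chart unfolding homeomorphism_def by auto

lemma \<tau>_a: "j \<in> J \<Longrightarrow> \<tau> (a j) = b j"
  using inj_b b_in unfolding a_def by (intro \<tau>_\<sigma>) (auto dest: inj_onD)

lemma inj_a: "inj_on a J"
  using \<tau>_a inj_b by (intro inj_onI) (metis inj_onD atLeastAtMost_iff le_SucI add_Suc_right one_add_one plus_1_eq_Suc add_2_eq_Suc')

lemma \<tau>_B: "\<tau> z \<in> M - B \<longleftrightarrow> z \<notin> a ` J"
proof
  assume "\<tau> z \<in> M - B"
  show "z \<notin> a ` J"
  proof
    assume "z \<in> a ` J"
    then obtain j where j: "j \<in> J" "z = a j" by blast
    moreover have "j \<in> I" using j by auto
    ultimately show False using \<open>\<tau> z \<in> M - B\<close> \<tau>_a[of j] by blast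
  qed
next
  assume z: "z \<notin> a ` J"
  have "\<tau> z \<noteq> b j" if "j \<in> I" for j
  proof (cases "j = 2 * n + 2")
    case False
    then have "j \<in> J" using that by auto
    then show ?thesis using z \<sigma>_\<tau>[of z] unfolding a_def by auto
  qed (use \<tau>_neq in auto)
  then have "\<tau> z \<notin> B" by blast
  then show "\<tau> z \<in> M - B" using \<tau>_in by blast
qed

lemma \<tau>_\<sigma>_B: "y \<in> M - B \<Longrightarrow> \<tau> (\<sigma> y) = y"
proof (rule \<tau>_\<sigma>)
  have "2 * n + 2 \<in> I" by auto
  then show "y \<in> M - B \<Longrightarrow> y \<noteq> b (2 * n + 2)" by blast
qed auto

lemma \<sigma>_B: "y \<in> M - B \<Longrightarrow> \<sigma> y \<notin> a ` J"
  using \<tau>_\<sigma>_B[of y] \<tau>_B[of "\<sigma> y"] by metis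

lemma R_\<tau>: "R (\<tau> z) = factor_product J a \<epsilon> z"
  by (simp add: R_def \<sigma>_\<tau>)

lemma continuous_R: "continuous_on (M - B) R"
proof -
  have "continuous_on (M - B) (\<lambda>y. factor_product J a \<epsilon> (\<sigma> y))"
    by (rule continuous_on_compose2[OF continuous_on_factor_product])
       (use \<sigma>_B in \<open>auto intro!: continuous_on_subset[OF cont_\<sigma>]\<close>)
  then show ?thesis by (simp add: R_def[abs_def])
qed

lemma R_nonzero: "y \<in> M - B \<Longrightarrow> R y \<noteq> 0"
  unfolding R_def by (intro factor_product_nonzero \<sigma>_B) auto

lemma eventually_punctured: "j \<in> I \<Longrightarrow> \<forall>\<^sub>F y in at (b j) within M. y \<in> M - B"
proof -
  assume "j \<in> I"
  have "open (- (B - {b j}))" by (intro open_Compl finite_imp_closed) auto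
  then have "\<forall>\<^sub>F y in at (b j) within M. y \<in> - (B - {b j})"
    by (intro topological_tendstoD[OF tendsto_ident_at]) auto
  then show ?thesis unfolding eventually_at_filter by eventually_elim auto
qed

lemma filterlim_\<tau>: assumes "j \<in> I" shows "filterlim \<tau> (at (b j) within M) (chart_filter j)"
proof (cases "j = 2 * n + 2")
  case False
  then have j: "j \<in> J" using assms by auto
  have "filterlim \<tau> (at (\<tau> (a j)) within M) (at (a j))"
    by (rule filterlim_at_within_homeomorphism[OF cont_\<tau>])
       (use \<tau>_in \<sigma>_\<tau> in \<open>auto intro: inj_on_inverseI\<close>)
  then show ?thesis using False \<tau>_a[OF j] by (simp add: chart_filter_def)
next
  case True
  have "filterlim \<tau> (at (b j) within M) at_infinity"
    unfolding filterlim_at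
  proof
    show "\<forall>\<^sub>F z :: complex in at_infinity. \<tau> z \<in> M \<and> \<tau> z \<noteq> b j" using \<tau>_in \<tau>_neq True by auto
    show "LIM z at_infinity. \<tau> z :> nhds (b j)"
    proof (rule topological_tendstoI)
      fix V assume V: "open V" "b j \<in> V"
      \<comment> \<open>The part of the sphere outside \<open>V\<close> is compact and misses
        \<open>b j\<close>, so \<open>\<sigma>\<close> is bounded there, and every \<open>z\<close>
        of larger norm lands in \<open>V\<close>.\<close>
      have "compact (M \<inter> - V)" using V compact_nsphere2 by (intro compact_Int_closed) auto
      moreover have "continuous_on (M \<inter> - V) \<sigma>"
        using V True by (auto intro!: continuous_on_subset[OF cont_\<sigma>])
      ultimately have "bounded (\<sigma> ` (M \<inter> - V))"
        using compact_continuous_image compact_imp_bounded by blast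
      then obtain r where r: "\<And>y. y \<in> M \<inter> - V \<Longrightarrow> norm (\<sigma> y) \<le> r" unfolding bounded_iff by auto
      show "\<forall>\<^sub>F z in at_infinity. \<tau> z \<in> V"
        unfolding eventually_at_infinity
      proof (intro exI[of _ "r + 1"] allI impI)
        fix z :: complex assume "r + 1 \<le> norm z"
        then show "\<tau> z \<in> V" using r[of "\<tau> z"] \<tau>_in[of z] \<sigma>_\<tau>[of z] by fastforce
      qed
    qed
  qed
  then show ?thesis using True by (simp add: chart_filter_def)
qed

lemma filterlim_\<sigma>: assumes "j \<in> I" shows "filterlim \<sigma> (chart_filter j) (at (b j) within M)"
proof (cases "j = 2 * n + 2")
  case False
  then have j: "j \<in> J" using assms by auto
  have neq: "b j \<noteq> b (2 * n + 2)" using False j inj_b by (auto dest: inj_onD)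
  have "filterlim \<sigma> (at (\<sigma> (b j)) within UNIV) (at (b j) within (M - {b (2 * n + 2)}))"
    by (rule filterlim_at_within_homeomorphism[OF cont_\<sigma>])
       (use neq b_in[OF assms] \<tau>_\<sigma> in \<open>auto intro: inj_on_inverseI\<close>)
  moreover have "at (b j) within (M - {b (2 * n + 2)}) = at (b j) within M"
    by (rule at_within_nhd[of _ "- {b (2 * n + 2)}"]) (use neq in auto)
  ultimately show ?thesis using False by (simp add: chart_filter_def a_def)
next
  case True
  have "filterlim \<sigma> at_infinity (at (b j) within M)"
    unfolding filterlim_at_infinity[OF order_refl]
  proof (intro allI impI)
    fix r :: real assume "r > 0"
    \<comment> \<open>\<open>\<tau>\<close> maps the disc to a compact set that misses
      \<open>b j\<close>, so points close to \<open>b j\<close> lie outside this set.\<close>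
    have "compact (\<tau> ` cball 0 r)"
      by (intro compact_continuous_image continuous_on_subset[OF cont_\<tau>]) auto
    then have "open (- \<tau> ` cball 0 r)" by (simp add: compact_imp_closed open_Compl)
    then have "\<forall>\<^sub>F y in at (b j) within M. y \<in> - \<tau> ` cball 0 r"
      by (intro topological_tendstoD[OF tendsto_ident_at]) (use \<tau>_neq True in \<open>auto simp: image_iff\<close>, metis)
    then have "\<forall>\<^sub>F y in at (b j) within M. y \<in> - \<tau> ` cball 0 r \<and> y \<in> M \<and> y \<noteq> b j"
      unfolding eventually_at_filter by eventually_elim auto
    then show "\<forall>\<^sub>F y in at (b j) within M. r \<le> norm (\<sigma> y)"
    proof eventually_elim
      case (elim y)
      then have "\<tau> (\<sigma> y) = y" using \<tau>_\<sigma> True by auto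
      then have "\<sigma> y \<notin> cball 0 r" using elim by (metis ComplD imageI)
      then show ?case by simp
    qed
  qed
  then show ?thesis using True by (simp add: chart_filter_def)
qed

lemma germ_log_chart_iff:
  assumes "j \<in> I"
  shows "germ_log (at (b j) within M) \<phi> \<longleftrightarrow> germ_log (chart_filter j) (\<lambda>z. \<phi> (\<tau> z))"
proof
  assume "germ_log (at (b j) within M) \<phi>"
  then show "germ_log (chart_filter j) (\<lambda>z. \<phi> (\<tau> z))"
    by (rule germ_log_compose[OF _ filterlim_\<tau>[OF assms] cont_\<tau>]) auto
next
  have ev: "\<forall>\<^sub>F y in at (b j) within M. y \<in> M - {b (2 * n + 2)}"
    using eventually_punctured[OF assms] by eventually_elim auto
  assume "germ_log (chart_filter j) (\<lambda>z. \<phi> (\<tau> z))"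
  from germ_log_compose[OF this filterlim_\<sigma>[OF assms] cont_\<sigma> ev]
  show "germ_log (at (b j) within M) \<phi>"
    by (rule germ_log_cong) (use ev in \<open>eventually_elim, auto simp: \<tau>_\<sigma>\<close>)
qed

lemma \<epsilon>_square: "\<epsilon> j * \<epsilon> j = 1"
  by (simp add: \<epsilon>_def flip: power_add) 

lemma \<epsilon>_Suc: "\<epsilon> (Suc j) = - \<epsilon> j"
  by (simp add: \<epsilon>_def)

lemma sum_\<epsilon>: "(\<Sum>j\<in>J. \<epsilon> j) = 1"
proof -
  have "(\<Sum>j\<in>{1..2 * m + 1}. \<epsilon> j) = 1" for m
    by (induction m) (auto simp: \<epsilon>_def)
  then show ?thesis .
qed

text \<open>At infinity the coordinate is \<open>z\<close> instead of \<open>1 / z\<close>, hence the sign.\<close>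

definition sgn_coord :: "nat \<Rightarrow> int" where
  "sgn_coord j = (if j = 2 * n + 2 then 1 else \<epsilon> j)"

lemma R_coord:
  assumes "j \<in> I"
  shows "germ_log (chart_filter j) (\<lambda>z. R (\<tau> z) / coord j z powi sgn_coord j)"
proof (cases "j = 2 * n + 2")
  case True
  then show ?thesis
    using factor_product_at_infinity[of J a \<epsilon>] unfolding sum_\<epsilon>
    by (simp add: R_\<tau> chart_filter_def coord_def sgn_coord_def)
next
  case False
  then have "j \<in> J" using assms by auto
  then show ?thesis
    using False factor_product_at[OF _ inj_a, of j \<epsilon>]
    by (simp add: R_\<tau> chart_filter_def coord_def sgn_coord_def)
qed

lemma eventually_coord_nonzero: "\<forall>\<^sub>F z in chart_filter j. coord j z \<noteq> 0"
proof (cases "j = 2 * n + 2")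
  case True
  then show ?thesis
    unfolding chart_filter_def coord_def by (simp add: eventually_at_infinity) (intro exI[of _ 1], auto)
next
  case False
  then show ?thesis
    using eventually_neq_at_within[of "a j" "a j" UNIV] by (simp add: chart_filter_def coord_def)
qed

lemma eventually_chart: "j \<in> I \<Longrightarrow> \<forall>\<^sub>F z in chart_filter j. z \<notin> a ` J"
proof -
  assume j: "j \<in> I"
  have "\<forall>\<^sub>F z in chart_filter j. \<tau> z \<in> M - B"
    using filterlim_\<tau>[OF j] eventually_punctured[OF j] by (auto simp: filterlim_iff)
  then show ?thesis by (simp only: \<tau>_B)
qed

lemma coord_index_unique:
  assumes "germ_log (chart_filter j) (\<lambda>z. coord j z powi m)"
  shows "m = 0"
  using assms germ_log_powi_at germ_log_powi_at_infinity
  by (auto simp: chart_filter_def coord_def split: if_splits)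

lemma R_coord_powi:
  assumes "j \<in> I"
  shows "germ_log (chart_filter j) (\<lambda>z. R (\<tau> z) powi m / coord j z powi (sgn_coord j * m))"
proof (rule germ_log_cong[OF germ_log_powi[OF R_coord[OF assms], of m]])
  show "\<forall>\<^sub>F z in chart_filter j. (R (\<tau> z) / coord j z powi sgn_coord j) powi m =
      R (\<tau> z) powi m / coord j z powi (sgn_coord j * m)"
    by (simp add: power_int_divide_distrib power_int_mult)
qed

lemma sgn_coord_square: "sgn_coord j * sgn_coord j = 1"
  by (simp add: sgn_coord_def \<epsilon>_square)

text \<open>At every branch point \<open>R\<close> has index \<open>1\<close> or \<open>-1\<close>
  in the local coordinate, so a nontrivial power of \<open>R\<close> has nonzero index. Hence
  \<open>R\<close> can serve as the unit in which all indices are measured.\<close>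

lemma index_unique:
  assumes "j \<in> I" "germ_log (at (b j) within M) (\<lambda>y. R y powi m)"
  shows "m = 0"
proof -
  have "germ_log (chart_filter j) (\<lambda>z. R (\<tau> z) powi m / (R (\<tau> z) powi m / coord j z powi (sgn_coord j * m)))"
    using assms by (intro germ_log_divide R_coord_powi) (simp_all add: germ_log_chart_iff)
  moreover have "\<forall>\<^sub>F z in chart_filter j. R (\<tau> z) powi m / (R (\<tau> z) powi m / coord j z powi (sgn_coord j * m)) = coord j z powi (sgn_coord j * m)"
    using eventually_chart[OF assms(1)] eventually_coord_nonzero[of j]
  proof eventually_elim
    case (elim z)
    then have "R (\<tau> z) \<noteq> 0" using R_nonzero \<tau>_B by blast
    then show ?case using elim by simp
  qed
  ultimately have "sgn_coord j * m = 0"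
    by (intro coord_index_unique[of j]) (rule germ_log_cong)
  then show ?thesis using sgn_coord_square[of j] by auto
qed

lemma index_exists:
  assumes "j \<in> I" and cont: "continuous_on (M - B) \<phi>" and nz: "\<And>y. y \<in> M - B \<Longrightarrow> \<phi> y \<noteq> 0"
  obtains m where "germ_log (at (b j) within M) (\<lambda>y. \<phi> y / R y powi m)"
proof -
  have c: "continuous_on (- a ` J) (\<lambda>z. \<phi> (\<tau> z))"
    by (rule continuous_on_compose2[OF cont continuous_on_subset[OF cont_\<tau>]]) (use \<tau>_B in auto)
  have nz': "\<phi> (\<tau> z) \<noteq> 0" if "z \<notin> a ` J" for z using nz \<tau>_B that by blast
  obtain m where m: "germ_log (chart_filter j) (\<lambda>z. \<phi> (\<tau> z) / coord j z powi m)"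
  proof (cases "j = 2 * n + 2")
    case True
    have "bounded (a ` J)" by (simp add: finite_imp_bounded)
    then obtain r where r: "\<And>z. z \<in> a ` J \<Longrightarrow> norm z \<le> r" unfolding bounded_iff by blast
    obtain m where "germ_log at_infinity (\<lambda>z. \<phi> (\<tau> z) / z powi m)"
    proof (rule germ_index_at_infinity[of r "\<lambda>z. \<phi> (\<tau> z)"])
      show "continuous_on {z. r < norm z} (\<lambda>z. \<phi> (\<tau> z))"
        by (rule continuous_on_subset[OF c]) (use r in force)
      show "\<phi> (\<tau> z) \<noteq> 0" if "r < norm z" for z using nz'[of z] r[of z] that by force
    qed auto
    then show thesis using that True by (simp add: chart_filter_def coord_def)
  next
    case False
    then have j: "j \<in> J" using assms by auto
    obtain m where "germ_log (at (a j)) (\<lambda>z. \<phi> (\<tau> z) / (z - a j) powi m)"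
    proof (rule germ_index_at[of "- (a ` J - {a j})" "a j" "\<lambda>z. \<phi> (\<tau> z)"])
      show "open (- (a ` J - {a j}))" by (intro open_Compl finite_imp_closed) auto
      show "continuous_on (- (a ` J - {a j}) - {a j}) (\<lambda>z. \<phi> (\<tau> z))"
        by (rule continuous_on_subset[OF c]) auto
    qed (use nz' in auto)
    then show thesis using that False by (simp add: chart_filter_def coord_def)
  qed
  \<comment> \<open>\<open>sgn_coord j\<close> is its own inverse, so this converts an index in the
    local coordinate into one relative to \<open>R\<close>.\<close>
  define m' where "m' = sgn_coord j * m"
  have mm: "sgn_coord j * m' = m"
    using sgn_coord_square[of j] by (simp add: m'_def mult.assoc[symmetric])
  have "germ_log (chart_filter j) (\<lambda>z. (\<phi> (\<tau> z) / coord j z powi m) / (R (\<tau> z) powi m' / coord j z powi m))"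
    using R_coord_powi[OF assms(1), of m'] unfolding mm by (rule germ_log_divide[OF m])
  moreover have "\<forall>\<^sub>F z in chart_filter j. (\<phi> (\<tau> z) / coord j z powi m) / (R (\<tau> z) powi m' / coord j z powi m) = \<phi> (\<tau> z) / R (\<tau> z) powi m'"
    using eventually_coord_nonzero[of j] by eventually_elim simp
  ultimately have "germ_log (chart_filter j) (\<lambda>z. \<phi> (\<tau> z) / R (\<tau> z) powi m')"
    by (rule germ_log_cong)
  then show thesis using that[of m'] assms(1) by (simp add: germ_log_chart_iff)
qed

lemma global_log:
  assumes cont: "continuous_on (M - B) \<phi>" and nz: "\<And>y. y \<in> M - B \<Longrightarrow> \<phi> y \<noteq> 0"
    and germ: "\<And>j. j \<in> I \<Longrightarrow> germ_log (at (b j) within M) \<phi>"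
  obtains g where "continuous_on (M - B) g" "\<And>y. y \<in> M - B \<Longrightarrow> \<phi> y = exp (g y)"
proof -
  have c: "continuous_on (- a ` J) (\<lambda>z. \<phi> (\<tau> z))"
    by (rule continuous_on_compose2[OF cont continuous_on_subset[OF cont_\<tau>]]) (use \<tau>_B in auto)
  obtain g where g: "continuous_on (- a ` J) g" "\<And>z. z \<notin> a ` J \<Longrightarrow> \<phi> (\<tau> z) = exp (g z)"
  proof (rule continuous_logarithm_punctured_plane[OF _ c])
    show "\<phi> (\<tau> z) \<noteq> 0" if "z \<notin> a ` J" for z using nz \<tau>_B that by blast
    fix x assume "x \<in> a ` J"
    then obtain j where j: "j \<in> J" "x = a j" by blast
    then have "j \<in> I" "j \<noteq> 2 * n + 2" by auto
    then show "germ_log (at x) (\<lambda>z. \<phi> (\<tau> z))"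
      using germ[of j] germ_log_chart_iff[of j \<phi>] j by (simp add: chart_filter_def)
  qed auto
  show thesis
  proof (rule that[of "\<lambda>y. g (\<sigma> y)"])
    show "continuous_on (M - B) (\<lambda>y. g (\<sigma> y))"
      by (rule continuous_on_compose2[OF g(1) continuous_on_subset[OF cont_\<sigma>]]) (use \<sigma>_B in auto)
    show "\<phi> y = exp (g (\<sigma> y))" if "y \<in> M - B" for y
      using g(2)[OF \<sigma>_B[OF that]] \<tau>_\<sigma>_B[OF that] by simp
  qed
qed

text \<open>The analogue of the fact that a divisor of a function on the sphere has degree
  \<open>0\<close>. The quotient of \<open>\<phi>\<close> by a rational function with the same
  finite indices has a logarithm on the whole punctured plane, so both have the same index at
  infinity. The signs come from measuring by \<open>R\<close>.\<close>

lemma index_sum: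
  assumes cont: "continuous_on (M - B) \<phi>" and nz: "\<And>y. y \<in> M - B \<Longrightarrow> \<phi> y \<noteq> 0"
    and germ: "\<And>j. j \<in> I \<Longrightarrow> germ_log (at (b j) within M) (\<lambda>y. \<phi> y / R y powi m j)"
  shows "(\<Sum>j\<in>I. \<epsilon> j * m j) = 0"
proof -
  \<comment> \<open>Index \<open>m j\<close> relative to \<open>R\<close> is index
    \<open>\<epsilon> j * m j\<close> in the coordinate \<open>z - a j\<close>.\<close>
  define P where "P = factor_product J a (\<lambda>j. \<epsilon> j * m j)"
  have c: "continuous_on (- a ` J) (\<lambda>z. \<phi> (\<tau> z))"
    by (rule continuous_on_compose2[OF cont continuous_on_subset[OF cont_\<tau>]]) (use \<tau>_B in auto)
  have nz': "\<phi> (\<tau> z) \<noteq> 0" if "z \<notin> a ` J" for z using nz \<tau>_B that by blast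
  have nzP: "P z \<noteq> 0" if "z \<notin> a ` J" for z using that by (simp add: P_def factor_product_nonzero)
  have nzR: "R (\<tau> z) \<noteq> 0" if "z \<notin> a ` J" for z using that R_nonzero \<tau>_B by blast
  have local: "germ_log (chart_filter j) (\<lambda>z. \<phi> (\<tau> z) / coord j z powi (sgn_coord j * m j))" if "j \<in> I" for j
  proof (rule germ_log_cong)
    have "germ_log (chart_filter j) (\<lambda>z. \<phi> (\<tau> z) / R (\<tau> z) powi m j)"
      using germ[OF that] that by (simp add: germ_log_chart_iff)
    then show "germ_log (chart_filter j) (\<lambda>z. (\<phi> (\<tau> z) / R (\<tau> z) powi m j) * (R (\<tau> z) powi m j / coord j z powi (sgn_coord j * m j)))"
      by (intro germ_log_mult R_coord_powi that)
    show "\<forall>\<^sub>F z in chart_filter j. (\<phi> (\<tau> z) / R (\<tau> z) powi m j) * (R (\<tau> z) powi m j / coord j z powi (sgn_coord j * m j)) = \<phi> (\<tau> z) / coord j z powi (sgn_coord j * m j)"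
      using eventually_chart[OF that] by eventually_elim (use nzR in simp)
  qed
  obtain g where g: "continuous_on (- a ` J) g" "\<And>z. z \<notin> a ` J \<Longrightarrow> \<phi> (\<tau> z) / P z = exp (g z)"
  proof (rule continuous_logarithm_punctured_plane[of "a ` J" "\<lambda>z. \<phi> (\<tau> z) / P z"])
    show "continuous_on (- a ` J) (\<lambda>z. \<phi> (\<tau> z) / P z)"
      using nzP by (intro continuous_on_divide c) (auto simp: P_def continuous_on_factor_product)
    show "\<phi> (\<tau> z) / P z \<noteq> 0" if "z \<notin> a ` J" for z using nz' nzP that by simp
    fix x assume "x \<in> a ` J"
    then obtain j where j: "j \<in> J" "x = a j" by blast
    then have jI: "j \<in> I" and jn: "j \<noteq> 2 * n + 2" by auto
    have "germ_log (at x) (\<lambda>z. \<phi> (\<tau> z) / (z - a j) powi (\<epsilon> j * m j))"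
      using local[OF jI] jn j by (simp add: chart_filter_def coord_def sgn_coord_def)
    moreover have "germ_log (at x) (\<lambda>z. P z / (z - a j) powi (\<epsilon> j * m j))"
      using factor_product_at[OF _ inj_a j(1)] j by (simp add: P_def)
    ultimately have "germ_log (at x) (\<lambda>z. (\<phi> (\<tau> z) / (z - a j) powi (\<epsilon> j * m j)) / (P z / (z - a j) powi (\<epsilon> j * m j)))"
      by (rule germ_log_divide)
    then show "germ_log (at x) (\<lambda>z. \<phi> (\<tau> z) / P z)"
    proof (rule germ_log_cong)
      show "\<forall>\<^sub>F z in at x. \<phi> (\<tau> z) / (z - a j) powi (\<epsilon> j * m j) / (P z / (z - a j) powi (\<epsilon> j * m j)) = \<phi> (\<tau> z) / P z"
        using eventually_neq_at_within[of x x UNIV] by eventually_elim (simp add: j)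
    qed
  qed auto
  let ?N = "2 * n + 2"
  define s where "s = (\<Sum>j\<in>J. \<epsilon> j * m j)"
  have N: "?N \<in> I" by auto
  have ev: "\<forall>\<^sub>F z in at_infinity. z \<notin> a ` J"
    using eventually_chart[OF N] by (simp add: chart_filter_def)
  have ev0: "\<forall>\<^sub>F z::complex in at_infinity. z \<noteq> 0"
    using eventually_coord_nonzero[of ?N] by (simp add: chart_filter_def coord_def)
  have g1: "germ_log at_infinity (\<lambda>z. \<phi> (\<tau> z) / P z)"
    unfolding germ_log_def using ev g by (intro exI[of _ "- a ` J"] exI[of _ g]) auto
  have g2: "germ_log at_infinity (\<lambda>z. P z / z powi s)"
    unfolding P_def s_def by (rule factor_product_at_infinity) auto
  have g3: "germ_log at_infinity (\<lambda>z. \<phi> (\<tau> z) / z powi m ?N)"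
    using local[OF N] by (simp add: chart_filter_def coord_def sgn_coord_def)
  from germ_log_divide[OF g3 germ_log_mult[OF g1 g2]]
  have "germ_log at_infinity (\<lambda>z. z powi (s - m ?N))"
  proof (rule germ_log_cong)
    show "\<forall>\<^sub>F z in at_infinity. \<phi> (\<tau> z) / z powi m ?N / (\<phi> (\<tau> z) / P z * (P z / z powi s)) = z powi (s - m ?N)"
      using ev ev0 by eventually_elim (use nz' nzP in \<open>simp add: power_int_diff\<close>)
  qed
  then have s: "s = m ?N" using germ_log_powi_at_infinity by fastforce
  have \<epsilon>N: "\<epsilon> ?N = -1" by (simp add: \<epsilon>_def)
  have IJ: "I = insert ?N J" by auto
  have "(\<Sum>j\<in>I. \<epsilon> j * m j) = \<epsilon> ?N * m ?N + s"
    unfolding s_def IJ by (rule sum.insert) auto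
  then show ?thesis by (simp only: s \<epsilon>N)
qed

end

lemma sphere_chart_exists:
  assumes "c \<in> topspace (nsphere 2)"
  obtains \<tau> \<sigma> where "homeomorphism (UNIV :: complex set) (topspace (nsphere 2) - {c}) \<tau> \<sigma>"
proof -
  let ?M = "topspace (nsphere 2)"
  note inv = R3_coords_R3_point and inv' = R3_point_R3_coords and on_sphere = norm_R3_point
  have "R3_coords u \<in> ?M - {c}" if "norm u = 1" "u \<noteq> R3_point c" for u
    using R3_coords_in_nsphere[of u] that inv'[of u] by auto
  moreover have "R3_point x \<noteq> R3_point c" if "x \<in> ?M" "x \<noteq> c" for x
    using inv[OF that(1)] inv[OF assms] that by metis
  ultimately have im: "R3_coords ` (sphere 0 1 - {R3_point c}) \<subseteq> ?M - {c}"
      "R3_point ` (?M - {c}) \<subseteq> sphere 0 1 - {R3_point c}"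
    using on_sphere by (fastforce simp: image_subset_iff)+
  have "homeomorphism (sphere 0 1 - {R3_point c}) (?M - {c}) R3_coords R3_point"
    by (intro homeomorphismI continuous_on_subset[OF continuous_on_R3_coords]
          continuous_on_subset[OF continuous_on_R3_point] im) (use inv inv' in blast)+
  then have "(sphere 0 1 - {R3_point c}) homeomorphic (?M - {c})"
    unfolding homeomorphic_def by blast
  moreover have "(sphere 0 1 - {R3_point c}) homeomorphic (UNIV :: complex set)"
    by (rule homeomorphic_punctured_sphere_affine)
       (use on_sphere[OF assms] in \<open>auto simp: aff_dim_UNIV affine_UNIV\<close>)
  ultimately have "(UNIV :: complex set) homeomorphic (?M - {c})"
    using homeomorphic_sym homeomorphic_trans by blast
  then show thesis using that unfolding homeomorphic_def by blast
qed

section \<open>The quotient of the surface\<close>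

lemma rotation_funpow: "(rotation k ^^ i) (w, z) = (cis (2 * pi / real k) ^ i * w, z)"
  by (induction i) (simp_all add: rotation_def mult.assoc)

lemma cis_root_power:
  "cis (2 * pi / real k) ^ i = exp (2 * of_real pi * \<i> * of_nat i / of_nat k)"
proof -
  have "cis (2 * pi / real k) ^ i = exp (of_nat i * (\<i> * of_real (2 * pi / real k)))"
    by (simp only: cis_conv_exp exp_of_nat_mult)
  also have "of_nat i * (\<i> * of_real (2 * pi / real k)) = 2 * of_real pi * \<i> * of_nat i / of_nat k"
    by simp
  finally show ?thesis .
qed

lemma cis_root_power_eq_1_iff:
  assumes "k \<ge> 1"
  shows "cis (2 * pi / real k) ^ i = 1 \<longleftrightarrow> k dvd i"
  unfolding cis_root_power using complex_root_unity_eq_1[OF assms, of i] .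

lemma root_of_unity_eq_cis_power:
  assumes "k \<ge> 1" "z ^ k = 1"
  obtains i where "z = cis (2 * pi / real k) ^ i"
proof -
  have "z \<in> {exp (2 * of_real pi * \<i> * of_nat j / of_nat k) | j. j < k}"
    using complex_roots_unity[OF assms(1)] assms(2) by blast
  then obtain j where "z = exp (2 * of_real pi * \<i> * of_nat j / of_nat k)" by blast
  then have "z = cis (2 * pi / real k) ^ j"
    unfolding cis_root_power .
  then show thesis by (rule that)
qed

lemma power_eq_imp_rotate:
  fixes u v :: complex
  assumes "k \<ge> 1" "u ^ k = v ^ k"
  obtains i where "v = cis (2 * pi / real k) ^ i * u"
proof (cases "u = 0")
  case True
  then have "v = 0" using assms by (auto simp: power_0_left)
  then show ?thesis using that[of 0] True by simp
next
  case False
  then have "(v / u) ^ k = 1" using assms False by (auto simp: power_divide power_0_left)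
  then obtain i where "v / u = cis (2 * pi / real k) ^ i" by (rule root_of_unity_eq_cis_power[OF assms(1)])
  then show ?thesis using that[of i] False by (simp add: field_simps)
qed

text \<open>Without a fixed point \<open>\<rho> y - y\<close> keeps one sign by the intermediate
  value theorem, so the iterates of \<open>x\<close> move strictly in one direction and never
  return.\<close>

lemma periodic_real_map_fixpoint:
  fixes \<rho> :: "real \<Rightarrow> real"
  assumes cont: "continuous_on UNIV \<rho>" and per: "(\<rho> ^^ k) x = x" and "k \<ge> 1"
  obtains y where "\<rho> y = y"
proof (rule ccontr)
  assume "\<not> thesis"
  then have ne: "\<rho> y \<noteq> y" for y using that by blast
  have "connected ((\<lambda>y. \<rho> y - y) ` UNIV)"
    by (intro connected_continuous_image continuous_intros cont connected_UNIV)
  then have iv: "is_interval ((\<lambda>y. \<rho> y - y) ` UNIV)" by (simp add: is_interval_connected_1)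
  have "(\<forall>y. \<rho> y > y) \<or> (\<forall>y. \<rho> y < y)"
  proof (rule ccontr)
    assume "\<not> ?thesis"
    then obtain y y' where "\<rho> y \<le> y" "\<rho> y' \<ge> y'" by (auto simp: not_less)
    then have "0 \<in> (\<lambda>y. \<rho> y - y) ` UNIV"
      using mem_is_interval_1_I[OF iv, of "\<rho> y - y" "\<rho> y' - y'" 0] by auto
    then show False using ne by auto
  qed
  then show False
  proof
    assume gt: "\<forall>y. \<rho> y > y"
    have "(\<rho> ^^ Suc i) x > x" for i
      by (induction i) (use gt in \<open>auto intro: less_trans\<close>)
    then show False using per \<open>k \<ge> 1\<close> by (metis Suc_le_D less_irrefl One_nat_def)
  next
    assume lt: "\<forall>y. \<rho> y < y"
    have "(\<rho> ^^ Suc i) x < x" for i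
      by (induction i) (use lt in \<open>auto intro: less_trans\<close>)
    then show False using per \<open>k \<ge> 1\<close> by (metis Suc_le_D less_irrefl One_nat_def)
  qed
qed

text \<open>Removing \<open>0\<close> from the curve would leave a copy of the real line on which
  the rotation acts with finite order. Such an action has a fixed point, but the rotation fixes only
  \<open>0\<close>.\<close>

lemma zero_notin_rotated_curve:
  assumes "simple_closed_curve C" and inv: "(\<lambda>w. cis (2 * pi / real k) * w) ` C = C" and k: "k \<ge> 2"
  shows "0 \<notin> C"
proof
  assume "0 \<in> C"
  let ?\<omega> = "cis (2 * pi / real k)"
  obtain f g where fg: "homeomorphism C (sphere (0::complex) 1) f g"
    using assms(1) unfolding simple_closed_curve_def homeomorphic_def by blast
  have "f 0 \<in> sphere 0 1" using fg \<open>0 \<in> C\<close> unfolding homeomorphism_def by blast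
  have "inj_on f C" using fg unfolding homeomorphism_def by (auto intro: inj_on_inverseI)
  then have "f ` (C - {0}) = sphere 0 1 - {f 0}"
    using inj_on_image_set_diff[of f C C "{0}"] fg \<open>0 \<in> C\<close> unfolding homeomorphism_def by auto
  then have "homeomorphism (C - {0}) (sphere 0 1 - {f 0}) f g"
    using homeomorphism_of_subsets[OF fg, of "C - {0}" "sphere 0 1" "sphere 0 1 - {f 0}"] by blast
  then have "(C - {0}) homeomorphic (sphere 0 1 - {f 0})" unfolding homeomorphic_def by blast
  also have "(sphere 0 1 - {f 0}) homeomorphic (UNIV :: real set)"
    by (rule homeomorphic_punctured_sphere_affine) (use \<open>f 0 \<in> sphere 0 1\<close> in \<open>auto simp: aff_dim_UNIV\<close>)
  finally obtain F G where FG: "homeomorphism (C - {0}) (UNIV :: real set) F G"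
    unfolding homeomorphic_def by blast
  have G: "G t \<in> C" "G t \<noteq> 0" "F (G t) = t" for t
    using FG unfolding homeomorphism_def by auto
  have F: "G (F w) = w" if "w \<in> C" "w \<noteq> 0" for w
    using FG that unfolding homeomorphism_def by auto
  have rot: "?\<omega> * w \<in> C" if "w \<in> C" for w using inv that by blast
  define \<rho> where "\<rho> t = F (?\<omega> * G t)" for t
  have G\<rho>: "G (\<rho> t) = ?\<omega> * G t" for t
    unfolding \<rho>_def by (rule F) (use G rot in auto)
  have "continuous_on UNIV \<rho>"
    unfolding \<rho>_def
    by (rule continuous_on_compose2[of "C - {0}" F])
       (use FG G rot in \<open>auto simp: homeomorphism_def intro!: continuous_intros\<close>)
  moreover have "(\<rho> ^^ k) 0 = 0"
  proof -
    have "G ((\<rho> ^^ i) t) = ?\<omega> ^ i * G t" for i t by (induction i) (auto simp: G\<rho>)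
    moreover have "?\<omega> ^ k = 1" using cis_root_power_eq_1_iff[of k k] k by simp
    ultimately have "G ((\<rho> ^^ k) 0) = G 0" by simp
    then show ?thesis using G(3) by metis
  qed
  ultimately obtain t where "\<rho> t = t" using periodic_real_map_fixpoint[of \<rho> k 0] k by auto
  then have "?\<omega> * G t = G t" using G\<rho>[of t] by simp
  then have "?\<omega> ^ 1 = 1" using G(2)[of t] by simp
  then show False using cis_root_power_eq_1_iff[of k 1] k by simp
qed

text \<open>A disc chart provides arbitrarily small neighbourhoods that become punctured discs when
  \<open>x\<close> is removed; that these are connected is where the dimension of the surface
  enters.\<close>

lemma surface_neighbourhood:
  fixes S :: "'a::t2_space set"
  assumes U: "openin (top_of_set S) U" "x \<in> U" "U homeomorphic ball (0::complex) 1"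
    and W: "open W" "x \<in> W"
  obtains V where "openin (top_of_set S) V" "x \<in> V" "V \<subseteq> W" "connected (V - {x})" "V - {x} \<noteq> {}"
proof -
  obtain f g where fg: "homeomorphism U (ball (0::complex) 1) f g"
    using U(3) unfolding homeomorphic_def by blast
  have f: "f ` U = ball 0 1" "continuous_on U f" "\<And>y. y \<in> U \<Longrightarrow> g (f y) = y"
    and g: "g ` ball 0 1 = U" "continuous_on (ball 0 1) g" "\<And>z. z \<in> ball 0 1 \<Longrightarrow> f (g z) = z"
    using fg unfolding homeomorphism_def by auto
  have "openin (top_of_set (ball 0 1)) (ball 0 1 \<inter> g -` W)"
    using g(2) W(1) continuous_openin_preimage_gen by blast
  then have "open (ball 0 1 \<inter> g -` W)" by (simp add: openin_open_eq)
  moreover have fx: "f x \<in> ball 0 1" "g (f x) = x" using f U(2) by auto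
  ultimately obtain e where e: "e > 0" "ball (f x) e \<subseteq> ball 0 1 \<inter> g -` W"
    using W(2) openE by (metis IntI vimageI)
  define V where "V = U \<inter> f -` ball (f x) e"
  have "openin (top_of_set U) V"
    unfolding V_def using f(2) continuous_openin_preimage_gen by blast
  then have opV: "openin (top_of_set S) V" using U(1) openin_trans by blast
  have Vx: "V - {x} = g ` (ball (f x) e - {f x})"
  proof (intro equalityI subsetI)
    fix y assume y: "y \<in> V - {x}"
    then have "y = g (f y)" "f y \<in> ball (f x) e" using f(3) unfolding V_def by auto
    moreover have "f y \<noteq> f x" using y f(3)[of y] fx(2) unfolding V_def by auto
    ultimately show "y \<in> g ` (ball (f x) e - {f x})" by blast
  next
    fix y assume "y \<in> g ` (ball (f x) e - {f x})"
    then obtain z where z: "z \<in> ball (f x) e" "z \<noteq> f x" "y = g z" by blast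
    then have z1: "z \<in> ball 0 1" using e by blast
    then have "f y = z" "y \<in> U" using g z(3) by auto
    then show "y \<in> V - {x}" using z unfolding V_def by auto
  qed
  show thesis
  proof (rule that[OF opV])
    show "x \<in> V" using U(2) e unfolding V_def by auto
    show "V \<subseteq> W"
    proof
      fix y assume y: "y \<in> V"
      then have "f y \<in> ball (f x) e" "g (f y) = y" using f(3) by (auto simp: V_def)
      then show "y \<in> W" using e(2) by (metis IntD2 subsetD vimageE)
    qed
    have "connected (ball (f x) e - {f x})" by (rule connected_punctured_ball) simp
    moreover have "continuous_on (ball (f x) e - {f x}) g"
      using e by (auto intro: continuous_on_subset[OF g(2)])
    ultimately show "connected (V - {x})" unfolding Vx using connected_continuous_image by blast
    have "f x + of_real (e / 2) \<in> ball (f x) e - {f x}" using e by (simp add: dist_norm)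
    then show "V - {x} \<noteq> {}" unfolding Vx by blast
  qed
qed

text \<open>In a splitting of \<open>M - {x}\<close> the connected set \<open>V - {x}\<close> lies
  on one side. Enlarging that side by the whole neighbourhood \<open>V\<close> would split
  \<open>M\<close>.\<close>

lemma connected_delete_point:
  fixes M :: "'a::t2_space set"
  assumes "connected M" "openin (top_of_set M) V" "x \<in> V" "connected (V - {x})" "V - {x} \<noteq> {}"
  shows "connected (M - {x})"
proof (rule connectedI)
  fix A B
  assume AB: "open A" "open B" "A \<inter> (M - {x}) \<noteq> {}" "B \<inter> (M - {x}) \<noteq> {}"
    "A \<inter> B \<inter> (M - {x}) = {}" "M - {x} \<subseteq> A \<union> B"
  have VM: "V \<subseteq> M" using assms(2) openin_imp_subset by blast
  obtain O' where O': "open O'" "V = M \<inter> O'" using assms(2) by (auto simp: openin_open)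
  have key: False if A: "open A" "V - {x} \<subseteq> A" and B: "open B" "B \<inter> (M - {x}) \<noteq> {}"
    "A \<inter> B \<inter> (M - {x}) = {}" "M - {x} \<subseteq> A \<union> B" for A B
  proof -
    have "(A \<union> O') \<inter> M = {} \<or> (B - {x}) \<inter> M = {}"
    proof (rule connectedD[OF assms(1)])
      show "open (A \<union> O')" using A O' by auto
      show "open (B - {x})" using B by auto
      show "(A \<union> O') \<inter> (B - {x}) \<inter> M = {}" using A B O'(2) by blast
      show "M \<subseteq> A \<union> O' \<union> (B - {x})" using B O'(2) assms(3) by blast
    qed
    then show False using assms(3) O'(2) B(2) by blast
  qed
  have "A \<inter> (V - {x}) = {} \<or> B \<inter> (V - {x}) = {}"
    using connectedD[OF assms(4) AB(1,2)] AB(5,6) VM by blast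
  then show False
  proof
    assume "A \<inter> (V - {x}) = {}"
    then have "V - {x} \<subseteq> B" using AB VM by blast
    then show False using key[of B A] AB by (simp add: Int_commute Un_commute)
  next
    assume "B \<inter> (V - {x}) = {}"
    then have "V - {x} \<subseteq> A" using AB VM by blast
    then show False using key[of A B] AB by simp
  qed
qed

lemma connected_surface_delete_finite:
  fixes S :: "'a::t2_space set"
  assumes "connected S"
    and surf: "\<And>x. x \<in> S \<Longrightarrow> \<exists>U. openin (top_of_set S) U \<and> x \<in> U \<and> U homeomorphic ball (0::complex) 1"
    and "finite F" "F \<subseteq> S"
  shows "connected (S - F)"
  using assms(3,4)
proof (induction F rule: finite_induct)
  case empty
  then show ?case using assms(1) by simp
next
  case (insert x F)
  obtain U where U: "openin (top_of_set S) U" "x \<in> U" "U homeomorphic ball (0::complex) 1"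
    using surf insert.prems by blast
  have "open (- F)" using insert.hyps by (simp add: finite_imp_closed open_Compl)
  then obtain V where V: "openin (top_of_set S) V" "x \<in> V" "V \<subseteq> - F" "connected (V - {x})" "V - {x} \<noteq> {}"
    using surface_neighbourhood[OF U] insert.hyps by (metis ComplI)
  have "V \<subseteq> S - F" using V openin_imp_subset by blast
  then have "openin (top_of_set (S - F)) V" using V(1) openin_subset_trans by blast
  then have "connected (S - F - {x})"
    using V insert by (intro connected_delete_point[of "S - F" V]) auto
  then show ?case by (subst Diff_insert)
qed

locale superelliptic_cover =
  fixes g k :: nat and S :: "(complex \<times> real) set" and p :: "complex \<times> real \<Rightarrow> nat \<Rightarrow> real"
    and b :: "nat \<Rightarrow> nat \<Rightarrow> real" and n :: nat
  assumes cover: "balanced_superelliptic_cover g k S p b"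
    and k: "k > 2" and n: "g div (k - 1) = n"
begin

abbreviation "\<omega> \<equiv> cis (2 * pi / real k)"
abbreviation "M \<equiv> topspace (nsphere 2)"
abbreviation "B \<equiv> b ` {1..2 * n + 2}"
abbreviation "I \<equiv> {1..2 * n + 2}"
abbreviation "rot \<equiv> rotation k"

lemma surface: "balanced_superelliptic_surface g k S"
  using cover unfolding balanced_superelliptic_cover_def by (elim conjE)

lemma quot: "quotient_map (top_of_set S) (nsphere 2) p"
  using cover unfolding balanced_superelliptic_cover_def by (elim conjE)

lemma fibres:
  assumes "x \<in> S" "y \<in> S"
  shows "p x = p y \<longleftrightarrow> (\<exists>i. y = (rot ^^ i) x)"
proof -
  have "\<forall>x\<in>S. \<forall>y\<in>S. p x = p y \<longleftrightarrow> (\<exists>i. y = (rot ^^ i) x)"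
    using cover unfolding balanced_superelliptic_cover_def by (elim conjE)
  from bspec[OF bspec[OF this assms(1)] assms(2)] show ?thesis .
qed

lemma p_axis:
  assumes "j \<in> I"
  shows "p (0, real j - 1) = b j"
proof -
  have "\<forall>j\<in>I. p (0, real j - 1) = b j"
    using cover unfolding balanced_superelliptic_cover_def n by (elim conjE)
  from bspec[OF this assms] show ?thesis .
qed

lemma closed_surface: "closed_orientable_surface g S"
  using surface unfolding balanced_superelliptic_surface_def by (elim conjE)

lemma compact_S: "compact S"
  using closed_surface unfolding closed_orientable_surface_def by (elim conjE)

lemma connected_S: "connected S"
  using closed_surface unfolding closed_orientable_surface_def by (elim conjE)

lemma locally_disc:
  assumes "x \<in> S"
  shows "\<exists>U. openin (top_of_set S) U \<and> x \<in> U \<and> U homeomorphic ball (0::complex) 1"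
proof -
  have "\<forall>x\<in>S. \<exists>U. openin (top_of_set S) U \<and> x \<in> U \<and> U homeomorphic ball (0::complex) 1"
    using closed_surface unfolding closed_orientable_surface_def by (elim conjE)
  from bspec[OF this assms] show ?thesis .
qed

lemma rot_S: "rot ` S = S"
  using surface unfolding balanced_superelliptic_surface_def by (elim conjE)

lemma slice_top_bottom:
  "a < 0 \<or> a > real (2 * n + 1) \<Longrightarrow> slice S a = {}" "slice S 0 = {0}" "slice S (real (2 * n + 1)) = {0}"
proof -
  have "\<forall>a. a < 0 \<or> a > real (2 * n + 1) \<longrightarrow> slice S a = {}"
    using surface unfolding balanced_superelliptic_surface_def Let_def n by (elim conjE)
  then show "a < 0 \<or> a > real (2 * n + 1) \<Longrightarrow> slice S a = {}" by blast
  show "slice S 0 = {0}"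
    using surface unfolding balanced_superelliptic_surface_def Let_def n by (elim conjE)
  show "slice S (real (2 * n + 1)) = {0}"
    using surface unfolding balanced_superelliptic_surface_def Let_def n by (elim conjE)
qed

lemma slice_circle:
  assumes "m \<le> n" "real (2 * m) < a" "a < real (2 * m + 1)"
  shows "simple_closed_curve (slice S a)"
proof -
  have "\<forall>m\<le>n. \<forall>a. real (2 * m) < a \<and> a < real (2 * m + 1) \<longrightarrow> simple_closed_curve (slice S a)"
    using surface unfolding balanced_superelliptic_surface_def Let_def n by (elim conjE)
  then show ?thesis using assms by blast
qed

lemma slice_rose: "j \<in> {1..2 * n} \<Longrightarrow> rose k 0 (slice S (real j))"
proof -
  have "\<forall>j\<in>{1..2 * n}. rose k 0 (slice S (real j))"
    using surface unfolding balanced_superelliptic_surface_def Let_def n by (elim conjE)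
  then show "j \<in> {1..2 * n} \<Longrightarrow> rose k 0 (slice S (real j))" by blast
qed

lemma slice_circles:
  assumes "m \<in> {1..n}" "real (2 * m - 1) < a" "a < real (2 * m)"
  obtains C where "\<forall>d<k. \<forall>e<k. d \<noteq> e \<longrightarrow> C d \<inter> C e = {}"
    "\<forall>d<k. C d = (\<lambda>w. cis (2 * pi * real d / real k) * w) ` C 0" "slice S a = (\<Union>d<k. C d)"
proof -
  have "\<forall>m\<in>{1..n}. \<forall>a. real (2 * m - 1) < a \<and> a < real (2 * m) \<longrightarrow>
           (\<exists>C :: nat \<Rightarrow> complex set.
              (\<forall>d<k. simple_closed_curve (C d)) \<and>
              (\<forall>d<k. \<forall>e<k. d \<noteq> e \<longrightarrow> C d \<inter> C e = {}) \<and>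
              (\<forall>d<k. C d = (\<lambda>w. cis (2 * pi * real d / real k) * w) ` C 0) \<and>
              slice S a = (\<Union>d<k. C d) \<and>
              (a = real (2 * m) - 1 / 2 \<longrightarrow>
                 (\<exists>R>0. \<exists>r>0. \<forall>d<k.
                    C d = sphere (of_real R * cis (2 * pi * real d / real k)) r)))"
    using surface unfolding balanced_superelliptic_surface_def Let_def n by (elim conjE)
  from this[rule_format, OF assms(1) conjI[OF assms(2,3)]] show thesis
    by (elim exE conjE) (rule that)
qed

lemma \<omega>_power: "\<omega> ^ i = 1 \<longleftrightarrow> k dvd i"
  by (rule cis_root_power_eq_1_iff) (use k in linarith)

lemma \<omega>_nz: "\<omega> \<noteq> 0" by (simp add: cis_neq_zero)

lemma rot_slice: "(\<lambda>w. \<omega> * w) ` slice S a = slice S a"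
proof -
  have "w \<in> slice S a \<Longrightarrow> \<omega> * w \<in> slice S a" for w
    using rot_S unfolding slice_def rotation_def by force
  moreover have "\<exists>w'\<in>slice S a. w = \<omega> * w'" if "w \<in> slice S a" for w
    using rot_S that unfolding slice_def rotation_def by force
  ultimately show ?thesis by blast
qed

text \<open>Integer heights give the two end points and the vertices of the roses; the shift by one
  turns a number into a height. At other heights a single invariant curve avoids the axis by
  \<open>zero_notin_rotated_curve\<close>, and \<open>k\<close> curves rotated into one another
  would all contain \<open>0\<close> if one did, against disjointness.\<close>

lemma axis_points: "(0, a) \<in> S \<longleftrightarrow> (\<exists>j\<in>I. a = real j - 1)"
proof
  assume "\<exists>j\<in>I. a = real j - 1"
  then obtain j where j: "j \<in> I" "a = real j - 1" by blast
  then consider "j = 1" | "j = 2 * n + 2" | "j - 1 \<in> {1..2 * n}" by fastforce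
  then have "0 \<in> slice S a"
  proof cases
    case 3
    then have "rose k 0 (slice S (real (j - 1)))" by (rule slice_rose)
    moreover have "real (j - 1) = a" using j by auto
    ultimately show ?thesis using k unfolding rose_def by (metis UN_I lessThan_iff gr0I not_less0)
  qed (use j slice_top_bottom in auto)
  then show "(0, a) \<in> S" by (simp add: slice_def)
next
  assume "(0, a) \<in> S"
  then have 0: "0 \<in> slice S a" by (simp add: slice_def)
  then have a: "0 \<le> a" "a \<le> real (2 * n + 1)" using slice_top_bottom(1)[of a] by (auto simp: not_less[symmetric])
  define i where "i = nat \<lfloor>a\<rfloor>"
  have i: "real i \<le> a" "a < real i + 1" using a unfolding i_def by linarith+
  show "\<exists>j\<in>I. a = real j - 1"
  proof (cases "a = real i")
    case True
    then have "i + 1 \<in> I" "a = real (i + 1) - 1" using a by auto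
    then show ?thesis by blast
  next
    case False
    then have i': "real i < a" "i < 2 * n + 1" using i a by auto
    show ?thesis
    proof (cases "even i")
      case True
      then obtain m where m: "i = 2 * m" by blast
      then have "simple_closed_curve (slice S a)" using i i' by (intro slice_circle[of m]) auto
      then show ?thesis using zero_notin_rotated_curve[OF _ rot_slice] 0 k by auto
    next
      case odd: False
      define m where "m = (i + 1) div 2"
      have m: "i = 2 * m - 1" "m \<in> {1..n}" using odd i'(2) unfolding m_def by (auto elim!: oddE)
      obtain C where C: "\<forall>d<k. \<forall>e<k. d \<noteq> e \<longrightarrow> C d \<inter> C e = {}"
          "\<forall>d<k. C d = (\<lambda>w. cis (2 * pi * real d / real k) * w) ` C 0" "slice S a = (\<Union>d<k. C d)"
      proof (rule slice_circles[of m a])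
        show "m \<in> {1..n}" by (rule m(2))
        show "real (2 * m - 1) < a" "a < real (2 * m)" using i i' m by auto
      qed blast
      obtain d where d: "d < k" "0 \<in> C d" using C(3) 0 by blast
      have Cd: "C d = (\<lambda>w. cis (2 * pi * real d / real k) * w) ` C 0"
        using C(2) d(1) by blast
      then obtain w where w: "w \<in> C 0" "cis (2 * pi * real d / real k) * w = 0"
        using d(2) by (metis imageE)
      then have "0 \<in> C 0" by (simp add: cis_neq_zero)
      have all: "0 \<in> C e" if "e < k" for e
      proof -
        have "C e = (\<lambda>w. cis (2 * pi * real e / real k) * w) ` C 0" using C(2) that by blast
        then show ?thesis using image_eqI[OF _ \<open>0 \<in> C 0\<close>, of 0 "\<lambda>w. cis (2 * pi * real e / real k) * w"] by simp
      qed
      have "0 \<in> C 0 \<inter> C 1" using all[of 0] all[of 1] k by auto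
      then show ?thesis using C(1)[rule_format, of 0 1] k by auto
    qed
  qed
qed

lemma p_image: "p ` S = M"
  using quotient_imp_surjective_map[OF quot] unfolding topspace_euclidean_subtopology .

lemma continuous_p: "continuous_on S p"
proof -
  have "continuous_map (top_of_set S) (top_of_set M) p"
    using quotient_imp_continuous_map[OF quot] by (subst nsphere2_eq_top_of_set[symmetric])
  then show ?thesis by (simp add: continuous_map_in_subtopology)
qed

lemma fibre_cases:
  assumes "x \<in> S" "y \<in> S" "p x = p y"
  obtains i where "fst y = \<omega> ^ i * fst x" "snd y = snd x"
proof -
  obtain i where "y = (rot ^^ i) x" using iffD1[OF fibres[OF assms(1,2)] assms(3)] by (rule exE)
  then show thesis by (intro that[of i]) (cases x; simp add: rotation_funpow)+
qed

text \<open>The functions \<open>w ^ k\<close> and height, descended to the sphere. They are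
  evaluated at an arbitrary preimage, which is harmless on points of the sphere because the fibres
  are rotation orbits.\<close>

definition hq :: "(nat \<Rightarrow> real) \<Rightarrow> complex" where "hq y = fst (inv_into S p y) ^ k"
definition tq :: "(nat \<Rightarrow> real) \<Rightarrow> real" where "tq y = snd (inv_into S p y)"

lemma hq_p: "x \<in> S \<Longrightarrow> hq (p x) = fst x ^ k" and tq_p: "x \<in> S \<Longrightarrow> tq (p x) = snd x"
proof -
  assume x: "x \<in> S"
  define y where "y = inv_into S p (p x)"
  have y: "y \<in> S" "p y = p x" using x by (auto simp: y_def inv_into_into f_inv_into_f)
  then obtain i where i: "fst y = \<omega> ^ i * fst x" "snd y = snd x" using fibre_cases[OF x y(1)] by metis
  have "(\<omega> ^ i) ^ k = 1" using \<omega>_power[of "i * k"] by (simp add: power_mult)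
  then show "hq (p x) = fst x ^ k" "tq (p x) = snd x"
    unfolding hq_def tq_def y_def[symmetric] i by (simp_all add: power_mult_distrib)
qed

lemma continuous_on_descend:
  fixes \<phi> :: "(nat \<Rightarrow> real) \<Rightarrow> 'b::topological_space"
  assumes "continuous_on S (\<lambda>x. \<phi> (p x))"
  shows "continuous_on M \<phi>"
proof -
  have "continuous_map (top_of_set S) euclidean (\<phi> \<circ> p)" using assms by (simp add: o_def)
  then have "continuous_map (nsphere 2) euclidean \<phi>" by (rule continuous_compose_quotient_map[OF quot])
  then have "continuous_map (top_of_set M) euclidean \<phi>"
    by (subst nsphere2_eq_top_of_set[symmetric])
  then show ?thesis by simp
qed

lemma continuous_hq: "continuous_on M hq"
proof (rule continuous_on_descend)
  have "continuous_on S (\<lambda>x. fst x ^ k)" by (intro continuous_intros)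
  then show "continuous_on S (\<lambda>x. hq (p x))" by (rule continuous_on_eq) (simp only: hq_p)
qed

lemma continuous_tq: "continuous_on M tq"
proof (rule continuous_on_descend)
  have "continuous_on S (\<lambda>x. snd x)" by (intro continuous_intros)
  then show "continuous_on S (\<lambda>x. tq (p x))" by (rule continuous_on_eq) (simp only: tq_p)
qed

lemma axis_in: "j \<in> I \<Longrightarrow> (0, real j - 1) \<in> S"
  unfolding axis_points by (rule bexI[of _ j]) (rule refl)

lemma b_in: "j \<in> I \<Longrightarrow> b j \<in> M"
  using imageI[OF axis_in, of j p] unfolding p_image by (simp only: p_axis)

lemma hq_b: assumes "j \<in> I" shows "hq (b j) = 0"
  using hq_p[OF axis_in[OF assms]] k unfolding p_axis[OF assms] by (simp add: power_0_left)

lemma tq_b: assumes "j \<in> I" shows "tq (b j) = real j - 1"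
  using tq_p[OF axis_in[OF assms]] unfolding p_axis[OF assms] by simp

lemma inj_b: "inj_on b I"
proof (rule inj_onI)
  fix i j assume ij: "i \<in> I" "j \<in> I" "b i = b j"
  have "real i - 1 = real j - 1" unfolding tq_b[OF ij(1), symmetric] tq_b[OF ij(2), symmetric] ij(3) ..
  then show "i = j" by linarith
qed

lemma p_in_B_iff: assumes "x \<in> S" shows "p x \<in> B \<longleftrightarrow> fst x = 0"
proof
  assume "p x \<in> B"
  then obtain j where "j \<in> I" "p x = b j" by (rule imageE)
  then have "fst x ^ k = 0" using hq_p[OF assms] hq_b[of j] by simp
  then show "fst x = 0" by simp
next
  assume "fst x = 0"
  then have x: "x = (0, snd x)" by (cases x) simp
  then have "(0, snd x) \<in> S" using assms by simp
  then obtain j where j: "j \<in> I" "snd x = real j - 1" unfolding axis_points by (rule bexE)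
  then have "p x = b j" using p_axis[OF j(1)] x by simp
  then show "p x \<in> B" using j(1) by (rule image_eqI)
qed

lemma hq_eq_0_iff: assumes "y \<in> M" shows "hq y = 0 \<longleftrightarrow> y \<in> B"
proof -
  obtain x where x: "x \<in> S" "y = p x" using assms unfolding p_image[symmetric] by (rule imageE)
  show ?thesis unfolding x(2) hq_p[OF x(1)] p_in_B_iff[OF x(1)] using k by simp
qed

text \<open>Points with equal \<open>k\<close>-th powers differ by a power of
  \<open>\<omega>\<close>, so at equal height they lie in one orbit.\<close>

lemma inj_hq_tq: "inj_on (\<lambda>y. (hq y, tq y)) M"
proof (rule inj_onI)
  fix y y' assume "y \<in> M" "y' \<in> M" and eq: "(hq y, tq y) = (hq y', tq y')"
  then obtain x x' where x: "x \<in> S" "x' \<in> S" "y = p x" "y' = p x'" using p_image by (metis imageE)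
  then have "fst x ^ k = fst x' ^ k" "snd x = snd x'" using eq by (auto simp: hq_p tq_p)
  obtain i where "fst x' = \<omega> ^ i * fst x"
    by (rule power_eq_imp_rotate[of k "fst x" "fst x'"])
       (use k \<open>fst x ^ k = fst x' ^ k\<close> in auto)
  then have "x' = (rot ^^ i) x" using \<open>snd x = snd x'\<close> by (cases x; cases x') (auto simp: rotation_funpow)
  then show "y = y'" unfolding x(3,4) by (intro iffD2[OF fibres[OF x(1,2)]] exI)
qed

lemma complement_components:
  assumes "u \<notin> (\<lambda>y. (hq y, tq y)) ` M" "v \<notin> (\<lambda>y. (hq y, tq y)) ` M" "w \<notin> (\<lambda>y. (hq y, tq y)) ` M"
  shows "connected_component (- (\<lambda>y. (hq y, tq y)) ` M) u v \<or>
         connected_component (- (\<lambda>y. (hq y, tq y)) ` M) v w \<or>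
         connected_component (- (\<lambda>y. (hq y, tq y)) ` M) u w"
proof (rule complement_embedded_sphere_components)
  let ?\<Phi> = "\<lambda>y. (hq y, tq y)"
  have cont: "continuous_on M ?\<Phi>" by (intro continuous_intros continuous_hq continuous_tq)
  show "compact (?\<Phi> ` M)" by (rule compact_continuous_image[OF cont compact_nsphere2])
  obtain \<Psi> where "homeomorphism M (?\<Phi> ` M) ?\<Phi> \<Psi>"
    using homeomorphism_compact[OF compact_nsphere2 cont refl inj_hq_tq] by blast
  then have "homeomorphic_maps (top_of_set M) (top_of_set (?\<Phi> ` M)) ?\<Phi> \<Psi>"
    unfolding homeomorphic_maps_def homeomorphism_def by (auto simp: continuous_map_in_subtopology)
  then have "top_of_set M homeomorphic_space top_of_set (?\<Phi> ` M)"
    unfolding homeomorphic_space_def by blast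
  then show "top_of_set (?\<Phi> ` M) homeomorphic_space nsphere 2"
    using nsphere2_eq_top_of_set by (metis homeomorphic_space_sym)
qed (use assms in auto)

end

section \<open>The reference function under homeomorphisms\<close>

lemma germ_log_continuous_at:
  assumes "continuous_on X \<phi>" "x \<in> X" "\<phi> x \<noteq> 0" "\<forall>\<^sub>F y in at x within M. y \<in> X"
  shows "germ_log (at x within M) \<phi>"
proof (rule germ_log_tendsto[OF _ assms(3) assms(1) assms(4)])
  have "at x within M \<le> at x within X"
    unfolding at_within_def[of x X]
  proof (rule inf_greatest)
    show "at x within M \<le> nhds x" by (simp add: at_within_def)
    show "at x within M \<le> principal (X - {x})"
      using assms(4) unfolding le_principal eventually_at_filter by eventually_elim auto
  qed
  then show "filterlim \<phi> (nhds (\<phi> x)) (at x within M)"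
    using assms(1,2) unfolding continuous_on_def by (blast intro: tendsto_mono)
qed

context sphere_chart
begin

lemma homeo_punctured:
  assumes f: "homeomorphism M M f fi" and fB: "f ` B = B" and y: "y \<in> M - B"
  shows "f y \<in> M - B" "fi y \<in> M - B"
proof -
  have fM: "f ` M = M" "fi ` M = M" "\<And>y. y \<in> M \<Longrightarrow> fi (f y) = y" "\<And>y. y \<in> M \<Longrightarrow> f (fi y) = y"
    using f unfolding homeomorphism_def by auto
  have BM: "B \<subseteq> M" using b_in by blast
  show "f y \<in> M - B"
  proof
    show "f y \<in> M" using fM(1) y by blast
    show "f y \<notin> B"
    proof
      assume "f y \<in> B"
      then obtain y' where y': "y' \<in> B" "f y = f y'" using fB by blast
      then have "y = y'" using fM(3)[of y] fM(3)[of y'] BM y by (metis DiffD1 subsetD)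
      then show False using y y' by blast
    qed
  qed
  show "fi y \<in> M - B"
  proof
    show "fi y \<in> M" using fM(2) y by blast
    show "fi y \<notin> B"
    proof
      assume "fi y \<in> B"
      then have "f (fi y) \<in> B" using fB by blast
      then show False using fM(4)[of y] y by simp
    qed
  qed
qed

lemma homeo_inverse_B:
  assumes f: "homeomorphism M M f fi" and fB: "f ` B = B"
  shows "fi ` B = B"
proof -
  have fi: "\<And>y. y \<in> M \<Longrightarrow> fi (f y) = y" using f unfolding homeomorphism_def by auto
  have BM: "B \<subseteq> M" using b_in by blast
  have "fi ` (f ` B) = (\<lambda>y. fi (f y)) ` B" by (rule image_image)
  also have "\<dots> = (\<lambda>y. y) ` B" by (rule image_cong[OF refl]) (use fi BM in blast)
  finally show ?thesis unfolding fB by simp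
qed

lemma germ_log_homeo:
  assumes f: "homeomorphism M M f fi" and x: "x \<in> M" and "germ_log (at (f x) within M) \<phi>"
  shows "germ_log (at x within M) (\<lambda>y. \<phi> (f y))"
proof (rule germ_log_compose[OF assms(3), of f "at x within M" M])
  have "continuous_on M f" "f ` M \<subseteq> M" "inj_on f M"
    using f unfolding homeomorphism_def by (auto intro: inj_on_inverseI)
  then show "filterlim f (at (f x) within M) (at x within M)"
    using filterlim_at_within_homeomorphism x by blast
  show "continuous_on M f" by fact
  show "\<forall>\<^sub>F y in at x within M. y \<in> M" unfolding eventually_at_filter by simp
qed

lemma continuous_R_homeo:
  assumes f: "homeomorphism M M f fi" and fB: "f ` B = B"
  shows "continuous_on (M - B) (\<lambda>y. R (f y))"
proof (rule continuous_on_compose2[OF continuous_R])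
  show "continuous_on (M - B) f"
    using f unfolding homeomorphism_def by (auto intro: continuous_on_subset)
  show "f ` (M - B) \<subseteq> M - B" by (rule image_subsetI) (rule homeo_punctured(1)[OF f fB])
qed

text \<open>Indices multiply under composition, and going by \<open>f\<close> and back by
  \<open>fi\<close> returns \<open>R\<close>, whose relative index is \<open>1\<close>. So
  \<open>u * v = 1\<close> holds in the integers.\<close>

lemma R_homeo_index:
  assumes f: "homeomorphism M M f fi" and fB: "f ` B = B" and j: "j \<in> I"
  obtains u where "u = 1 \<or> u = -1" "germ_log (at (b j) within M) (\<lambda>y. R (f y) / R y powi u)"
proof -
  note fi = homeomorphism_symD[OF f] and fiB = homeo_inverse_B[OF f fB]
  obtain i where i: "i \<in> I" "f (b j) = b i" using fB j by blast
  obtain u where u: "germ_log (at (b j) within M) (\<lambda>y. R (f y) / R y powi u)"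
    by (rule index_exists[OF j continuous_R_homeo[OF f fB]])
       (rule R_nonzero[OF homeo_punctured(1)[OF f fB]])
  obtain v where v: "germ_log (at (b i) within M) (\<lambda>y. R (fi y) / R y powi v)"
    by (rule index_exists[OF i(1) continuous_R_homeo[OF fi fiB]])
       (rule R_nonzero[OF homeo_punctured(1)[OF fi fiB]])
  have v': "germ_log (at (b j) within M) (\<lambda>y. R (fi (f y)) / R (f y) powi v)"
    by (rule germ_log_homeo[OF f b_in[OF j], of "\<lambda>y. R (fi y) / R y powi v"]) (use v i(2) in simp)
  have "germ_log (at (b j) within M) (\<lambda>y. (R (fi (f y)) / R (f y) powi v) * (R (f y) / R y powi u) powi v)"
    by (intro germ_log_mult germ_log_powi u v')
  then have "germ_log (at (b j) within M) (\<lambda>y. R y powi (1 - u * v))"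
  proof (rule germ_log_cong)
    show "\<forall>\<^sub>F y in at (b j) within M. R (fi (f y)) / R (f y) powi v * (R (f y) / R y powi u) powi v = R y powi (1 - u * v)"
      using eventually_punctured[OF j]
    proof eventually_elim
      case (elim y)
      then have "fi (f y) = y" using f unfolding homeomorphism_def by blast
      moreover have "R (f y) \<noteq> 0" "R y \<noteq> 0"
        by (rule R_nonzero[OF homeo_punctured(1)[OF f fB elim]], rule R_nonzero[OF elim])
      ultimately show ?case
        by (simp add: power_int_divide_distrib power_int_diff power_int_mult)
    qed
  qed
  then have "1 - u * v = 0" by (rule index_unique[OF j])
  then have "u * v = 1" by simp
  then have "u = 1 \<or> u = -1" using zmult_eq_1_iff by blast
  then show thesis using u that by blast
qed

end

section \<open>The indices of the descended coordinate\<close>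

locale cover_chart = superelliptic_cover g k S p b n + sc: sphere_chart n b \<tau> \<sigma>
  for g k S p b n \<tau> \<sigma>
begin

lemma hq_nonzero: assumes "y \<in> M - B" shows "hq y \<noteq> 0"
proof
  assume "hq y = 0"
  then have "y \<in> B" by (rule iffD1[OF hq_eq_0_iff[OF DiffD1[OF assms]]])
  with assms show False by (rule DiffD2)
qed

lemma p_punctured: assumes "x \<in> S" "fst x \<noteq> 0" shows "p x \<in> M - B"
proof
  show "p x \<in> M" using imageI[OF assms(1), of p] unfolding p_image .
  show "p x \<notin> B" unfolding p_in_B_iff[OF assms(1)] by (rule assms(2))
qed

lemma rot_in: "x \<in> S \<Longrightarrow> rot x \<in> S"
  using imageI[of x S rot] unfolding rot_S .

lemma fst_rot: "fst (rot x) = \<omega> * fst x" and snd_rot: "snd (rot x) = snd x"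
proof -
  show "fst (rot x) = \<omega> * fst x" by (cases x; simp add: rotation_def)
  show "snd (rot x) = snd x" by (cases x; simp add: rotation_def)
qed

lemma continuous_rot: "continuous_on A rot"
proof -
  have "rot = (\<lambda>x. (\<omega> * fst x, snd x))" by (auto simp: rotation_def fun_eq_iff)
  then show ?thesis by (simp add: continuous_intros)
qed

lemma p_rot: "x \<in> S \<Longrightarrow> p (rot x) = p x"
proof -
  assume "x \<in> S"
  then have "p x = p (rot x)" by (intro iffD2[OF fibres] exI[of _ 1] rot_in) auto
  then show ?thesis by simp
qed

lemma p_eq_b: assumes "x \<in> S" "j \<in> I" "p x = b j" shows "x = (0, real j - 1)"
proof (rule prod_eqI)
  have "p x \<in> B" unfolding assms(3) using assms(2) by (rule imageI)
  then have "fst x = 0" by (rule iffD1[OF p_in_B_iff[OF assms(1)]])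
  then show "fst x = fst (0, real j - 1)" by simp
  have "snd x = real j - 1" unfolding tq_p[OF assms(1), symmetric] assms(3) by (rule tq_b[OF assms(2)])
  then show "snd x = snd (0::complex, real j - 1)" by simp
qed

text \<open>Suppose \<open>l > 1\<close> divides \<open>m\<close> and \<open>k = l * k'\<close>.
  Then \<open>hq\<close> has an \<open>l\<close>-th root \<open>Q\<close> near \<open>b j\<close>,
  and \<open>fst x ^ k'\<close> over \<open>Q (p x)\<close> is an \<open>l\<close>-th root of unity,
  hence constant on a connected punctured disc. But the rotation multiplies it by
  \<open>\<omega> ^ k'\<close>, which is not \<open>1\<close> because
  \<open>0 < k' < k\<close>.\<close>

lemma index_coprime:
  assumes j: "j \<in> I" and germ: "germ_log (at (b j) within M) (\<lambda>y. hq y / sc.R y powi m)"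
  shows "coprime m (int k)"
proof (rule ccontr)
  assume nc: "\<not> coprime m (int k)"
  define l where "l = nat (gcd m (int k))"
  have l: "int l = gcd m (int k)" by (simp add: l_def)
  have "gcd m (int k) \<noteq> 1" using nc by (simp add: coprime_iff_gcd_eq_1)
  moreover have "gcd m (int k) > 0" using k by simp
  ultimately have l1: "l > 1" using l by linarith
  have "int l dvd m" unfolding l by simp
  then obtain m' where m': "m = int l * m'" by (rule dvdE)
  have "int l dvd int k" unfolding l by simp
  then have "l dvd k" by simp
  then obtain k' where k': "k = l * k'" by (rule dvdE)
  obtain U \<gamma> where U: "\<forall>\<^sub>F y in at (b j) within M. y \<in> U" "continuous_on U \<gamma>"
     "\<And>y. y \<in> U \<Longrightarrow> hq y / sc.R y powi m = exp (\<gamma> y)"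
    using germ unfolding germ_log_def by blast
  have "\<forall>\<^sub>F y in at (b j) within M. y \<in> U \<inter> (M - B)"
    using U(1) sc.eventually_punctured[OF j] by eventually_elim blast
  then obtain P where P: "open P" "b j \<in> P" "\<And>y. y \<in> P \<Longrightarrow> y \<noteq> b j \<Longrightarrow> y \<in> M \<Longrightarrow> y \<in> U \<inter> (M - B)"
    unfolding eventually_at_topological by blast
  define Q where "Q y = sc.R y powi m' * exp (\<gamma> y / of_nat l)" for y
  have Q: "Q y ^ l = hq y" "Q y \<noteq> 0" if "y \<in> U \<inter> (M - B)" for y
  proof -
    have R: "sc.R y \<noteq> 0" using that sc.R_nonzero by blast
    then show "Q y \<noteq> 0" by (simp add: Q_def)
    have "exp (\<gamma> y / of_nat l) ^ l = exp (\<gamma> y)"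
      using l1 by (simp flip: exp_of_nat_mult)
    moreover have "(sc.R y powi m') ^ l = sc.R y powi m"
      unfolding m' by (simp add: power_int_mult mult.commute flip: power_int_of_nat)
    ultimately have "Q y ^ l = sc.R y powi m * exp (\<gamma> y)" by (simp add: Q_def power_mult_distrib)
    also have "\<dots> = hq y" using U(3)[of y] that R by (simp add: field_simps)
    finally show "Q y ^ l = hq y" .
  qed
  have contQ: "continuous_on (U \<inter> (M - B)) Q"
  proof -
    have "continuous_on (U \<inter> (M - B)) sc.R" by (rule continuous_on_subset[OF sc.continuous_R]) blast
    then have "continuous_on (U \<inter> (M - B)) (\<lambda>y. sc.R y powi m')"
      by (rule continuous_on_power_int) (intro disjI2 ballI, rule sc.R_nonzero, erule IntD2)
    moreover have "continuous_on (U \<inter> (M - B)) \<gamma>" by (rule continuous_on_subset[OF U(2)]) blast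
    then have "continuous_on (U \<inter> (M - B)) (\<lambda>y. exp (\<gamma> y / of_nat l))"
      using l1 by (intro continuous_on_exp continuous_on_divide continuous_on_const) simp_all
    ultimately show ?thesis unfolding Q_def by (rule continuous_on_mult)
  qed
  define xj where "xj = (0 :: complex, real j - 1)"
  have xj: "xj \<in> S" "p xj = b j" using axis_in[OF j] p_axis[OF j] by (simp_all add: xj_def)
  obtain W where W: "open W" "S \<inter> p -` P = S \<inter> W"
    using continuous_openin_preimage_gen[OF continuous_p P(1)] by (auto simp: openin_open)
  have "xj \<in> W" using W(2) xj P(2) by blast
  obtain D where D: "openin (top_of_set S) D" "xj \<in> D" "D homeomorphic ball (0::complex) 1"
    using locally_disc[OF xj(1)] by blast
  obtain V where V: "openin (top_of_set S) V" "xj \<in> V" "V \<subseteq> W" "connected (V - {xj})"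
    by (rule surface_neighbourhood[OF D W(1) \<open>xj \<in> W\<close>])
  obtain O1 where O1: "open O1" "V = S \<inter> O1" using V(1) by (auto simp: openin_open)
  have pV: "p x \<in> U \<inter> (M - B)" "x \<in> S" if "x \<in> V - {xj}" for x
  proof -
    show "x \<in> S" using that O1 by blast
    then have "p x \<in> P" using that V(3) W(2) by blast
    moreover have "p x \<noteq> b j" using p_eq_b[OF \<open>x \<in> S\<close> j] that unfolding xj_def by blast
    moreover have "p x \<in> M" using p_image \<open>x \<in> S\<close> by blast
    ultimately show "p x \<in> U \<inter> (M - B)" by (rule P(3))
  qed
  define \<psi> where "\<psi> x = fst x ^ k' / Q (p x)" for x
  have \<psi>: "\<psi> x ^ l = 1" if "x \<in> V - {xj}" for x
  proof -
    have "\<psi> x ^ l = fst x ^ k / hq (p x)"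
      using Q(1)[OF pV(1)[OF that]] by (simp add: \<psi>_def power_divide k' mult.commute flip: power_mult)
    then show ?thesis
      using hq_p[OF pV(2)[OF that]] hq_nonzero[of "p x"] pV(1)[OF that] by auto
  qed
  have cont\<psi>: "continuous_on (V - {xj}) \<psi>"
    unfolding \<psi>_def
  proof (intro continuous_intros)
    show "continuous_on (V - {xj}) (\<lambda>x. Q (p x))"
    proof (rule continuous_on_compose2[OF contQ])
      show "continuous_on (V - {xj}) p"
        by (rule continuous_on_subset[OF continuous_p]) (rule subsetI, rule pV(2))
      show "p ` (V - {xj}) \<subseteq> U \<inter> (M - B)"
        by (rule image_subsetI) (rule pV(1))
    qed
  qed (use pV Q in blast)
  have "\<psi> ` (V - {xj}) \<subseteq> {z. z ^ l = 1}" using \<psi> by blast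
  then have "finite (\<psi> ` (V - {xj}))"
    using finite_roots_unity[of l] l1 by (auto intro: finite_subset)
  then have "\<psi> constant_on (V - {xj})" using continuous_finite_range_constant[OF V(4) cont\<psi>] by blast
  then obtain c where c: "\<And>x. x \<in> V - {xj} \<Longrightarrow> \<psi> x = c" unfolding constant_on_def by blast
  have rot_xj: "rot xj = xj" by (simp add: xj_def rotation_def)
  \<comment> \<open>\<open>V\<close> need not be invariant under the rotation; a point of
    \<open>V'\<close> lies in \<open>V\<close> together with its rotated image.\<close>
  define V' where "V' = S \<inter> (O1 \<inter> rot -` O1)"
  have "open (rot -` O1)" by (rule open_vimage[OF O1(1) continuous_rot])
  then have opV': "openin (top_of_set S) V'" unfolding V'_def using O1(1) by (intro openin_open_Int) auto
  have xjV': "xj \<in> V'" using V(2) O1(2) rot_xj by (simp add: V'_def)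
  \<comment> \<open>Otherwise \<open>xj\<close> would be isolated and, by connectedness, all of
    \<open>S\<close>, which contains at least two axis points.\<close>
  have "V' \<noteq> {xj}"
  proof
    assume "V' = {xj}"
    then have "openin (top_of_set S) {xj}" using opV' by simp
    moreover have "closedin (top_of_set S) {xj}" by (rule closed_subset) (use xj(1) in auto)
    ultimately have S: "S = {xj}" using connected_S[unfolded connected_clopen, rule_format, of "{xj}"] by simp
    have "(0, real 1 - 1) \<in> S" "(0, real 2 - 1) \<in> S" by (intro axis_in; simp)+
    then have "snd xj = 0" "snd xj = 1" unfolding S by auto
    then show False by simp
  qed
  then obtain x where x: "x \<in> V'" "x \<noteq> xj" using xjV' by blast
  then have xS: "x \<in> S" by (simp add: V'_def)
  have "rot x \<noteq> xj"
  proof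
    assume "rot x = xj"
    then have "\<omega> * fst x = 0" "snd x = real j - 1" using fst_rot[of x] snd_rot[of x] by (simp_all add: xj_def)
    then have "x = xj" using \<omega>_nz by (cases x) (simp add: xj_def)
    then show False using x(2) by simp
  qed
  then have xV: "x \<in> V - {xj}" "rot x \<in> V - {xj}"
    using x O1(2) rot_in[OF xS] by (auto simp: V'_def)
  have "\<psi> (rot x) = \<omega> ^ k' * \<psi> x"
    by (simp add: \<psi>_def p_rot[OF xS] fst_rot power_mult_distrib)
  moreover have "\<psi> (rot x) = \<psi> x" using c[OF xV(1)] c[OF xV(2)] by simp
  moreover have "\<psi> x \<noteq> 0" using \<psi>[OF xV(1)] l1 by (auto simp: power_0_left)
  ultimately have "\<omega> ^ k' = 1" by simp
  then have "k dvd k'" using \<omega>_power by simp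
  moreover have "k' > 0" using k k' by (cases k') auto
  ultimately have "k \<le> k'" by (simp add: dvd_imp_le)
  moreover have "2 * k' \<le> l * k'" using l1 by (intro mult_right_mono) auto
  ultimately show False using k' \<open>k' > 0\<close> by linarith
qed

text \<open>Measured by \<open>R\<close>, the cancellation of consecutive indices reads
  \<open>\<epsilon> j * m j + \<epsilon> (j + 1) * m (j + 1) = 0\<close>, that is,
  \<open>m j = m (j + 1)\<close>.\<close>

lemma index_constant:
  obtains c where "coprime c (int k)"
    "\<And>j. j \<in> I \<Longrightarrow> germ_log (at (b j) within M) (\<lambda>y. hq y / sc.R y powi c)"
proof -
  have cont_hq: "continuous_on (M - B) hq" using continuous_hq by (rule continuous_on_subset) blast
  have "\<exists>m. germ_log (at (b j) within M) (\<lambda>y. hq y / sc.R y powi m)" if "j \<in> I" for j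
    using sc.index_exists[OF that cont_hq hq_nonzero] by blast
  then obtain m where m: "\<And>j. j \<in> I \<Longrightarrow> germ_log (at (b j) within M) (\<lambda>y. hq y / sc.R y powi m j)"
    by metis
  define T where "T = (\<lambda>y. (hq y, tq y)) ` M"
  \<comment> \<open>Halfway between the images of \<open>b i\<close> and \<open>b (i + 1)\<close>,
    which have heights \<open>i - 1\<close> and \<open>i\<close>; \<open>pt 0\<close> lies below the
    whole image.\<close>
  define pt where "pt i = (0 :: complex, real i - 1/2)" for i
  have ptT: "pt i \<notin> T" for i
  proof
    assume "pt i \<in> T"
    then obtain y where y: "y \<in> M" "hq y = 0" "tq y = real i - 1/2" by (auto simp: T_def pt_def)
    then obtain j where "j \<in> I" "y = b j" using hq_eq_0_iff[OF y(1)] by blast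
    then have "real j - 1 = real i - 1/2" using y(3) tq_b by simp
    then have "real (2 * j) = real (2 * i + 1)" by simp
    then have "2 * j = 2 * i + 1" by (simp only: of_nat_eq_iff)
    then show False by presburger
  qed
  \<comment> \<open>On the segment from \<open>pt i\<close> to \<open>pt l\<close> lie the branch
    points \<open>i + 1\<close> to \<open>l\<close>. There \<open>GA\<close> has the index of
    \<open>hq\<close>, and index \<open>0\<close> at all others, so \<open>index_sum\<close> applied
    to \<open>GA\<close> gives the claim.\<close>
  have sum0: "(\<Sum>j\<in>I. sc.\<epsilon> j * (if i < j \<and> j \<le> l then m j else 0)) = 0"
    if il: "i < l" and conn: "connected_component (- T) (pt i) (pt l)" for i l
  proof -
    obtain C where C: "connected C" "C \<subseteq> - T" "pt i \<in> C" "pt l \<in> C"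
      using conn unfolding connected_component_def by blast
    have comp: "compact T" unfolding T_def
      by (intro compact_continuous_image continuous_intros continuous_hq continuous_tq compact_nsphere2)
    let ?\<alpha> = "real i - 1/2" and ?\<beta> = "real l - 1/2"
    obtain GA GB GC where G:
      "continuous_on {x\<in>M. hq x \<noteq> 0 \<or> tq x < ?\<alpha>} GA" "\<And>x. x \<in> M \<Longrightarrow> hq x \<noteq> 0 \<or> tq x < ?\<alpha> \<Longrightarrow> GA x \<noteq> 0"
      "continuous_on {x\<in>M. hq x \<noteq> 0 \<or> ?\<beta> < tq x} GB" "\<And>x. x \<in> M \<Longrightarrow> hq x \<noteq> 0 \<or> ?\<beta> < tq x \<Longrightarrow> GB x \<noteq> 0"
      "continuous_on {x\<in>M. hq x \<noteq> 0 \<or> ?\<alpha> < tq x \<and> tq x < ?\<beta>} GC"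
      "\<And>x. x \<in> M \<Longrightarrow> hq x \<noteq> 0 \<or> ?\<alpha> < tq x \<and> tq x < ?\<beta> \<Longrightarrow> GC x \<noteq> 0"
      "\<And>x. x \<in> M \<Longrightarrow> hq x \<noteq> 0 \<Longrightarrow> GA x = GB x \<and> GA x = hq x * GC x"
    proof (rule axis_points_same_component[OF continuous_hq continuous_tq, of C ?\<alpha> ?\<beta>])
      show "closed ((\<lambda>x. (hq x, tq x)) ` M)" using comp by (simp add: T_def compact_imp_closed)
      show "C \<inter> (\<lambda>x. (hq x, tq x)) ` M = {}" using C(2) by (auto simp: T_def)
      show "(0, ?\<alpha>) \<in> C" "(0, ?\<beta>) \<in> C" using C by (simp_all add: pt_def)
    qed (use C il in auto)
    have germ: "germ_log (at (b j) within M) (\<lambda>y. GA y / sc.R y powi (if i < j \<and> j \<le> l then m j else 0))"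
      if j: "j \<in> I" for j
    proof -
      have lim: "filterlim tq (nhds (real j - 1)) (at (b j) within M)"
        using continuous_tq b_in[OF j] tq_b[OF j] unfolding continuous_on_def by metis
      have M: "\<forall>\<^sub>F y in at (b j) within M. y \<in> M - B" by (rule sc.eventually_punctured[OF j])
      have bj: "b j \<in> M" "tq (b j) = real j - 1" using b_in[OF j] tq_b[OF j] by auto
      consider "j \<le> i" | "i < j" "j \<le> l" | "l < j" by linarith
      then show ?thesis
      proof cases
        case 1
        then have lt: "real j - 1 < ?\<alpha>" by linarith
        have "germ_log (at (b j) within M) GA"
        proof (rule germ_log_continuous_at[OF G(1)])
          show "b j \<in> {x\<in>M. hq x \<noteq> 0 \<or> tq x < ?\<alpha>}" using bj lt by simp
          then show "GA (b j) \<noteq> 0" using G(2)[of "b j"] by blast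
          show "\<forall>\<^sub>F y in at (b j) within M. y \<in> {x\<in>M. hq x \<noteq> 0 \<or> tq x < ?\<alpha>}"
            using order_tendstoD(2)[OF lim lt] M by eventually_elim blast
        qed
        then show ?thesis using 1 by simp
      next
        case 3
        then have gt: "?\<beta> < real j - 1" by linarith
        have "germ_log (at (b j) within M) GB"
        proof (rule germ_log_continuous_at[OF G(3)])
          show "b j \<in> {x\<in>M. hq x \<noteq> 0 \<or> ?\<beta> < tq x}" using bj gt by simp
          then show "GB (b j) \<noteq> 0" using G(4)[of "b j"] by blast
          show "\<forall>\<^sub>F y in at (b j) within M. y \<in> {x\<in>M. hq x \<noteq> 0 \<or> ?\<beta> < tq x}"
            using order_tendstoD(1)[OF lim gt] M by eventually_elim blast
        qed
        moreover have "\<forall>\<^sub>F y in at (b j) within M. GB y = GA y"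
          using M by eventually_elim (use G(7) hq_nonzero in auto)
        ultimately have "germ_log (at (b j) within M) GA" by (rule germ_log_cong)
        then show ?thesis using 3 by simp
      next
        case 2
        then have between: "?\<alpha> < real j - 1" "real j - 1 < ?\<beta>" by linarith+
        have "germ_log (at (b j) within M) GC"
        proof (rule germ_log_continuous_at[OF G(5)])
          show "b j \<in> {x\<in>M. hq x \<noteq> 0 \<or> ?\<alpha> < tq x \<and> tq x < ?\<beta>}" using bj between by simp
          then show "GC (b j) \<noteq> 0" using G(6)[of "b j"] by blast
          show "\<forall>\<^sub>F y in at (b j) within M. y \<in> {x\<in>M. hq x \<noteq> 0 \<or> ?\<alpha> < tq x \<and> tq x < ?\<beta>}"
            using order_tendstoD(1)[OF lim between(1)] order_tendstoD(2)[OF lim between(2)] M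
            by eventually_elim blast
        qed
        from germ_log_mult[OF this m[OF j]]
        have "germ_log (at (b j) within M) (\<lambda>y. GA y / sc.R y powi m j)"
        proof (rule germ_log_cong)
          show "\<forall>\<^sub>F y in at (b j) within M. GC y * (hq y / sc.R y powi m j) = GA y / sc.R y powi m j"
            using M
          proof eventually_elim
            case (elim y)
            then have "GA y = hq y * GC y" using G(7)[of y] hq_nonzero[of y] by blast
            then show ?case by simp
          qed
        qed
        then show ?thesis using 2 by simp
      qed
    qed
    show ?thesis
    proof (rule sc.index_sum[OF _ _ germ])
      show "continuous_on (M - B) GA"
        by (rule continuous_on_subset[OF G(1)]) (use hq_nonzero in blast)
      show "GA y \<noteq> 0" if "y \<in> M - B" for y using G(2)[of y] hq_nonzero[OF that] that by blast
    qed
  qed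
  have single: "(\<Sum>j\<in>I. sc.\<epsilon> j * (if i < j \<and> j \<le> i + 1 then m j else 0)) = sc.\<epsilon> (i + 1) * m (i + 1)"
    if "i + 1 \<in> I" for i
  proof -
    have "(\<Sum>j\<in>I. sc.\<epsilon> j * (if i < j \<and> j \<le> i + 1 then m j else 0))
        = (\<Sum>j\<in>I. if j = i + 1 then sc.\<epsilon> j * m j else 0)"
      by (rule sum.cong) auto
    also have "\<dots> = sc.\<epsilon> (i + 1) * m (i + 1)"
      using that by (subst sum.delta) auto
    finally show ?thesis .
  qed
  have mnz: "m j \<noteq> 0" if "j \<in> I" for j
  proof
    assume "m j = 0"
    then have "coprime 0 (int k)" using index_coprime[OF that m[OF that]] by metis
    then show False using k by simp
  qed
  have \<epsilon>nz: "sc.\<epsilon> j \<noteq> 0" for j by (simp add: sc.\<epsilon>_def)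
  \<comment> \<open>Otherwise the only branch point between the two would have index
    \<open>0\<close>, which is not coprime to \<open>k\<close>.\<close>
  have apart: "\<not> connected_component (- T) (pt i) (pt (i + 1))" if "i + 1 \<in> I" for i
  proof
    assume "connected_component (- T) (pt i) (pt (i + 1))"
    from sum0[OF _ this] have "(\<Sum>j\<in>I. sc.\<epsilon> j * (if i < j \<and> j \<le> i + 1 then m j else 0)) = 0" by linarith
    then have "sc.\<epsilon> (i + 1) * m (i + 1) = 0" unfolding single[OF that] .
    then show False using mnz[OF that] \<epsilon>nz[of "i + 1"] by simp
  qed
  have step: "m (i + 1) = m (i + 2)" if i: "i + 2 \<in> I" for i
  proof -
    have i1: "i + 1 \<in> I" using i by auto
    have e: "i + 1 + 1 = i + 2" by simp
    \<comment> \<open>\<open>pt (i + 1)\<close> is joined to neither neighbour, so of the three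
      points the outer two share a component.\<close>
    have "connected_component (- T) (pt i) (pt (i + 2))"
      using complement_components[of "pt i" "pt (i + 1)" "pt (i + 2)", folded T_def, OF ptT ptT ptT]
        apart[OF i1] apart[of "i + 1", unfolded e, OF i] by blast
    from sum0[OF _ this] have s0: "(\<Sum>j\<in>I. sc.\<epsilon> j * (if i < j \<and> j \<le> i + 2 then m j else 0)) = 0" by linarith
    have "(\<Sum>j\<in>I. sc.\<epsilon> j * (if i < j \<and> j \<le> i + 2 then m j else 0))
       = (\<Sum>j\<in>I. (if j = i + 1 then sc.\<epsilon> j * m j else 0) + (if j = i + 2 then sc.\<epsilon> j * m j else 0))"
      by (rule sum.cong) auto
    also have "\<dots> = (\<Sum>j\<in>I. if j = i + 1 then sc.\<epsilon> j * m j else 0) + (\<Sum>j\<in>I. if j = i + 2 then sc.\<epsilon> j * m j else 0)"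
      by (rule sum.distrib)
    also have "(\<Sum>j\<in>I. if j = i + 1 then sc.\<epsilon> j * m j else 0) = sc.\<epsilon> (i + 1) * m (i + 1)"
      using i1 by (subst sum.delta) auto
    also have "(\<Sum>j\<in>I. if j = i + 2 then sc.\<epsilon> j * m j else 0) = sc.\<epsilon> (i + 2) * m (i + 2)"
      using i by (subst sum.delta) auto
    finally have s1: "sc.\<epsilon> (i + 1) * m (i + 1) + sc.\<epsilon> (i + 2) * m (i + 2) = 0" using s0 by linarith
    have "sc.\<epsilon> (i + 2) = - sc.\<epsilon> (i + 1)" using sc.\<epsilon>_Suc[of "i + 1"] by (simp only: e[symmetric] Suc_eq_plus1)
    then have "sc.\<epsilon> (i + 1) * (m (i + 1) - m (i + 2)) = 0" using s1 by (simp add: right_diff_distrib)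
    then show ?thesis using \<epsilon>nz[of "i + 1"] by simp
  qed
  have const: "m (Suc i) = m 1" if "Suc i \<le> 2 * n + 2" for i
    using that
  proof (induction i)
    case (Suc i)
    have "m (i + 1) = m (i + 2)" by (rule step) (use Suc.prems in auto)
    moreover have "m (Suc i) = m 1" by (rule Suc.IH) (use Suc.prems in linarith)
    ultimately show ?case by simp
  qed simp
  show thesis
  proof (rule that[of "m 1"])
    show "coprime (m 1) (int k)" by (rule index_coprime[OF _ m]) auto
    fix j assume j: "j \<in> I"
    then have "m j = m 1" using const[of "j - 1"] by simp
    then show "germ_log (at (b j) within M) (\<lambda>y. hq y / sc.R y powi m 1)" using m[OF j] by (simp only:)
  qed
qed

end

section \<open>Liftable homeomorphisms\<close>

context cover_chart
begin

lemma k_ge_1: "1 \<le> k"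
  using k by linarith

lemma R_powi_nonzero: "y \<in> M - B \<Longrightarrow> sc.R y powi c \<noteq> 0"
  using sc.R_nonzero[of y] by simp

lemma continuous_R_powi: "continuous_on (M - B) (\<lambda>y. sc.R y powi c)"
  by (rule continuous_on_power_int[OF sc.continuous_R]) (intro disjI2 ballI sc.R_nonzero)

text \<open>This makes continuous functions with values in the roots of unity constant on the whole
  surface off the axis.\<close>

lemma connected_off_axis: "connected {x \<in> S. fst x \<noteq> 0}"
proof -
  let ?F = "(\<lambda>j. (0 :: complex, real j - 1)) ` I"
  have "connected (S - ?F)"
    by (rule connected_surface_delete_finite[OF connected_S locally_disc])
       (simp_all add: image_subset_iff axis_in)
  moreover have "S - ?F = {x \<in> S. fst x \<noteq> 0}"
  proof (intro equalityI subsetI)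
    fix x assume x: "x \<in> S - ?F"
    have "fst x \<noteq> 0"
    proof
      assume "fst x = 0"
      then have x0: "x = (0, snd x)" by (cases x) simp
      then have "(0, snd x) \<in> S" using x by simp
      then obtain j where "j \<in> I" "snd x = real j - 1" unfolding axis_points by (rule bexE)
      then have "x \<in> ?F" using x0 by (intro image_eqI[of _ _ j]) simp_all
      then show False using x by simp
    qed
    then show "x \<in> {x \<in> S. fst x \<noteq> 0}" using x by simp
  qed auto
  ultimately show ?thesis by simp
qed

lemma fibre_rotate:
  assumes "x \<in> S" "y \<in> S" "p x = p y"
  obtains i where "y = (rot ^^ i) x"
  using iffD1[OF fibres[OF assms(1,2)] assms(3)] by (rule exE)

lemma funpow_rot_in: "x \<in> S \<Longrightarrow> (rot ^^ i) x \<in> S"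
  by (induction i) (simp_all add: rot_in)

lemma fst_funpow_rot: "fst ((rot ^^ i) x) = \<omega> ^ i * fst x"
  by (cases x) (simp add: rotation_funpow)

lemma p_funpow_rot: "x \<in> S \<Longrightarrow> p ((rot ^^ i) x) = p x"
  by (induction i) (simp_all add: p_rot funpow_rot_in)

lemma \<omega>_power_k: "(\<omega> ^ i) ^ k = 1"
  using \<omega>_power[of "i * k"] by (simp add: power_mult)

lemma cover_point_eqI:
  assumes "x \<in> S" "y \<in> S" "p x = p y" "fst x = fst y"
  shows "x = y"
proof (rule prod_eqI)
  show "snd x = snd y" unfolding tq_p[OF assms(1), symmetric] tq_p[OF assms(2), symmetric] assms(3) ..
qed (rule assms(4))

text \<open>
  A lift conjugates the rotation to a power \<open>s\<close> of itself, so the quotient of the pulled back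
  horizontal coordinate by the \<open>s\<close>-th power of the coordinate descends to the sphere.
\<close>

lemma lifts_imp_power:
  assumes f: "homeomorphism M M f fi" and fB: "f ` B = B" and lift: "lifts S p f"
  obtains s :: nat and q where "continuous_on (M - B) q"
    "\<And>y. y \<in> M - B \<Longrightarrow> q y \<noteq> 0 \<and> hq (f y) = hq y ^ s * q y ^ k"
proof -
  obtain f' where f': "homeomorphic_map (top_of_set S) (top_of_set S) f'" "\<And>x. x \<in> S \<Longrightarrow> p (f' x) = f (p x)"
    using lift unfolding lifts_def by blast
  have cf': "continuous_on S f'"
    using homeomorphic_imp_continuous_map[OF f'(1)] by (simp add: continuous_map_in_subtopology)
  have f'S: "f' x \<in> S" if "x \<in> S" for x
    using homeomorphic_imp_surjective_map[OF f'(1)] that by auto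
  let ?S' = "{x \<in> S. fst x \<noteq> 0}"
  have f'nz: "fst (f' x) \<noteq> 0" if "x \<in> ?S'" for x
  proof -
    have x: "x \<in> S" "fst x \<noteq> 0" using that by auto
    have "p (f' x) \<in> M - B"
      unfolding f'(2)[OF x(1)] by (rule sc.homeo_punctured(1)[OF f fB p_punctured[OF x]])
    then show ?thesis using p_in_B_iff[OF f'S[OF x(1)]] by simp
  qed
  have rotS': "rot x \<in> ?S'" if "x \<in> ?S'" for x
    using that rot_in[of x] \<omega>_nz by (simp add: fst_rot)
  \<comment> \<open>The factor by which the lifted coordinate turns under one rotation. It is a
    \<open>k\<close>-th root of unity, because \<open>f'\<close> maps \<open>x\<close> and
    \<open>rot x\<close> into one fibre.\<close>
  define r where "r x = fst (f' (rot x)) / fst (f' x)" for x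
  have contr: "continuous_on ?S' r"
    unfolding r_def
  proof (intro continuous_on_divide continuous_on_fst)
    show c: "continuous_on ?S' f'" by (rule continuous_on_subset[OF cf']) auto
    show "continuous_on ?S' (\<lambda>x. f' (rot x))"
      by (rule continuous_on_compose2[OF c continuous_rot]) (rule image_subsetI, rule rotS')
  qed (use f'nz in simp)
  have r1: "r x ^ k = 1" if "x \<in> ?S'" for x
  proof -
    have x: "x \<in> S" using that by simp
    have "p (f' x) = p (f' (rot x))" unfolding f'(2)[OF x] f'(2)[OF rot_in[OF x]] p_rot[OF x] ..
    then obtain i where "f' (rot x) = (rot ^^ i) (f' x)"
      by (rule fibre_rotate[OF f'S[OF x] f'S[OF rot_in[OF x]]])
    then have "r x = \<omega> ^ i" using f'nz[OF that] by (simp add: r_def fst_funpow_rot)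
    then show ?thesis by (simp only: \<omega>_power_k)
  qed
  have "r constant_on ?S'"
  proof (rule continuous_finite_range_constant[OF connected_off_axis contr])
    have "r ` ?S' \<subseteq> {z. z ^ k = 1}" by (rule image_subsetI) (simp add: r1)
    moreover have "finite {z :: complex. z ^ k = 1}" by (rule finite_roots_unity) (use k in linarith)
    ultimately show "finite (r ` ?S')" by (rule finite_subset)
  qed
  then obtain c where c: "\<And>x. x \<in> ?S' \<Longrightarrow> r x = c" unfolding constant_on_def by auto
  obtain s where s: "\<And>x. x \<in> ?S' \<Longrightarrow> r x = \<omega> ^ s"
  proof (cases "?S' = {}")
    case False
    then obtain x where "x \<in> ?S'" by blast
    then have "c ^ k = 1" using r1[of x] c[of x] by simp
    then obtain s where "c = \<omega> ^ s" by (rule root_of_unity_eq_cis_power[OF k_ge_1])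
    then show thesis using that[of s] c by simp
  qed (use that in simp)
  have equiv: "fst (f' (rot x)) = \<omega> ^ s * fst (f' x)" if "x \<in> ?S'" for x
    using s[OF that] f'nz[OF that] by (simp add: r_def field_simps)
  have equivi: "fst (f' ((rot ^^ i) x)) = \<omega> ^ (s * i) * fst (f' x)" if "x \<in> ?S'" for x i
  proof (induction i)
    case (Suc i)
    have "(rot ^^ i) x \<in> ?S'" using that \<omega>_nz by (simp add: funpow_rot_in fst_funpow_rot)
    from equiv[OF this] Suc show ?case by (simp add: power_add)
  qed simp
  \<comment> \<open>A rotation multiplies numerator and denominator by the same power of
    \<open>\<omega>\<close>, so \<open>q'\<close> is constant on fibres.\<close>
  define q' where "q' x = fst (f' x) / fst x ^ s" for x
  define q where "q y = q' (inv_into S p y)" for y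
  have qp: "q (p x) = q' x" if x: "x \<in> ?S'" for x
  proof -
    have xS: "x \<in> S" using x by simp
    define z where "z = inv_into S p (p x)"
    have z: "z \<in> S" "p z = p x"
      unfolding z_def by (rule inv_into_into, rule imageI, rule xS) (rule f_inv_into_f, rule imageI, rule xS)
    obtain i where i: "z = (rot ^^ i) x" by (rule fibre_rotate[OF xS z(1) z(2)[symmetric]])
    have "q' z = (\<omega> ^ (s * i) * fst (f' x)) / (\<omega> ^ i * fst x) ^ s"
      unfolding q'_def i equivi[OF x] fst_funpow_rot ..
    also have "(\<omega> ^ i * fst x) ^ s = \<omega> ^ (s * i) * fst x ^ s"
      by (simp only: power_mult_distrib power_mult[symmetric] mult.commute[of i])
    finally show ?thesis using \<omega>_nz by (simp add: q_def z_def[symmetric] q'_def)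
  qed
  have contq': "continuous_on ?S' q'"
    unfolding q'_def
    by (intro continuous_intros continuous_on_subset[OF cf']) auto
  have pre: "{x \<in> topspace (top_of_set S). p x \<in> M - B} = ?S'"
  proof (intro equalityI subsetI)
    fix x assume "x \<in> ?S'"
    then have "x \<in> S" "fst x \<noteq> 0" by auto
    then show "x \<in> {x \<in> topspace (top_of_set S). p x \<in> M - B}" using p_punctured by simp
  next
    fix x assume "x \<in> {x \<in> topspace (top_of_set S). p x \<in> M - B}"
    then have "x \<in> S" "p x \<notin> B" by simp_all
    then show "x \<in> ?S'" using p_in_B_iff[of x] by simp
  qed
  have opB: "openin (nsphere 2) (M - B)"
  proof -
    have "open (- B)" by (intro open_Compl finite_imp_closed) simp
    then have "openin (top_of_set M) (M \<inter> - B)" by (rule openin_open_Int)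
    moreover have "M \<inter> - B = M - B" by (rule Diff_eq[symmetric])
    ultimately show ?thesis by (subst nsphere2_eq_top_of_set) simp
  qed
  \<comment> \<open>The punctured sphere is open, so \<open>p\<close> restricts to a quotient map
    over it, which makes \<open>q\<close> continuous there.\<close>
  have "quotient_map (subtopology (top_of_set S) ?S') (subtopology (nsphere 2) (M - B)) p"
    by (rule quotient_map_restriction[OF quot pre]) (rule disjI1, rule opB)
  moreover have "subtopology (top_of_set S) ?S' = top_of_set ?S'"
    by (simp add: subtopology_subtopology Int_absorb1 Collect_conj_eq)
  moreover have "subtopology (nsphere 2) (M - B) = top_of_set (M - B)"
    by (subst nsphere2_eq_top_of_set) (simp add: subtopology_subtopology Int_absorb1)
  ultimately have quot': "quotient_map (top_of_set ?S') (top_of_set (M - B)) p" by simp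
  have "continuous_on ?S' (\<lambda>x. q (p x))"
    by (rule continuous_on_eq[OF contq']) (rule qp[symmetric])
  then have "continuous_map (top_of_set ?S') euclidean (q \<circ> p)" by (simp add: o_def)
  then have "continuous_map (top_of_set (M - B)) euclidean q"
    by (rule continuous_compose_quotient_map[OF quot'])
  then have contq: "continuous_on (M - B) q" by simp
  show thesis
  proof (rule that[OF contq])
    fix y assume y: "y \<in> M - B"
    then have "y \<in> p ` S" unfolding p_image by simp
    then obtain x where x: "x \<in> S" "y = p x" by blast
    have x': "x \<in> ?S'" using x y p_in_B_iff[OF x(1)] by simp
    have "hq (f y) = fst (f' x) ^ k"
      unfolding x(2) f'(2)[OF x(1), symmetric] by (rule hq_p[OF f'S[OF x(1)]])
    moreover have "hq y ^ s * q y ^ k = (fst x ^ k) ^ s * (fst (f' x) / fst x ^ s) ^ k"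
      unfolding x(2) hq_p[OF x(1)] qp[OF x'] q'_def ..
    moreover have "\<dots> = fst (f' x) ^ k"
      using x' by (simp add: power_divide power_mult[symmetric] mult.commute)
    moreover have "q y \<noteq> 0" unfolding x(2) qp[OF x'] using x' f'nz[OF x'] by (simp add: q'_def)
    ultimately show "q y \<noteq> 0 \<and> hq (f y) = hq y ^ s * q y ^ k" by simp
  qed
qed

text \<open>A lift is determined by its horizontal coordinate, a \<open>k\<close>-th root of
  \<open>hq (f (p x))\<close>; the assumption provides the root
  \<open>fst x powi u * q (p x)\<close> off the axis. As \<open>u\<close> is \<open>1\<close> or
  \<open>-1\<close>, this root separates the points of a fibre, so the lift is injective.\<close>

lemma power_imp_lifts:
  assumes f: "homeomorphism M M f fi" and fB: "f ` B = B" and u: "u = 1 \<or> u = (-1::int)"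
    and contq: "continuous_on (M - B) q"
    and q: "\<And>y. y \<in> M - B \<Longrightarrow> q y \<noteq> 0 \<and> hq (f y) = hq y powi u * q y ^ k"
  shows "lifts S p f"
proof -
  have fM: "f ` M = M" and contf: "continuous_on M f" and fif: "\<And>y. y \<in> M \<Longrightarrow> fi (f y) = y"
    and ffi: "\<And>y. y \<in> M \<Longrightarrow> f (fi y) = y" and fiM: "fi ` M = M"
    using f unfolding homeomorphism_def by auto
  have pM: "p x \<in> M" if "x \<in> S" for x using imageI[OF that, of p] unfolding p_image .
  \<comment> \<open>The value \<open>0\<close> on the axis is forced, since \<open>f\<close> maps
    branch points to branch points.\<close>
  define t where "t x = (if fst x = 0 then 0 else fst x powi u * q (p x))" for x
  have tk: "t x ^ k = hq (f (p x))" if x: "x \<in> S" for x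
  proof (cases "fst x = 0")
    case True
    then have "p x \<in> B" using p_in_B_iff[OF x] by simp
    then have "f (p x) \<in> f ` B" by (rule imageI)
    then have "f (p x) \<in> B" unfolding fB .
    then have "hq (f (p x)) = 0"
      using hq_eq_0_iff[of "f (p x)"] pM[OF x] fM by blast
    then show ?thesis using True k by (simp add: t_def power_0_left)
  next
    case False
    have "hq (p x) powi u = (fst x powi u) ^ k"
      unfolding hq_p[OF x] by (simp add: power_int_mult[symmetric] mult.commute flip: power_int_of_nat)
    then show ?thesis
      using False q[OF p_punctured[OF x False]] by (simp add: t_def power_mult_distrib)
  qed
  have ex: "\<exists>y\<in>S. p y = f (p x) \<and> fst y = t x" if x: "x \<in> S" for x
  proof -
    have "f (p x) \<in> p ` S" unfolding p_image using imageI[OF pM[OF x], of f] unfolding fM .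
    then obtain y where y: "y \<in> S" "p y = f (p x)" by (metis imageE)
    have "fst y ^ k = t x ^ k" unfolding tk[OF x] y(2)[symmetric] hq_p[OF y(1)] ..
    then obtain i where i: "t x = \<omega> ^ i * fst y"
      by (rule power_eq_imp_rotate[OF k_ge_1])
    show ?thesis
      using y i by (intro bexI[of _ "(rot ^^ i) y"]) (simp_all add: p_funpow_rot fst_funpow_rot funpow_rot_in)
  qed
  then obtain f' where f': "\<And>x. x \<in> S \<Longrightarrow> f' x \<in> S" "\<And>x. x \<in> S \<Longrightarrow> p (f' x) = f (p x)"
      "\<And>x. x \<in> S \<Longrightarrow> fst (f' x) = t x"
    by metis
  have snd_f': "snd (f' x) = tq (f (p x))" if "x \<in> S" for x
    unfolding f'(2)[OF that, symmetric] by (rule tq_p[OF f'(1)[OF that], symmetric])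
  have contfp: "continuous_on S (\<lambda>x. f (p x))"
    by (rule continuous_on_compose2[OF contf continuous_p]) (simp add: p_image)
  have conth: "continuous_on S (\<lambda>x. hq (f (p x)))"
    by (rule continuous_on_compose2[OF continuous_hq contfp]) (use pM fM in blast)
  have contt: "continuous_on S t"
    unfolding continuous_on_def
  proof
    fix x assume x: "x \<in> S"
    show "filterlim t (nhds (t x)) (at x within S)"
    proof (cases "fst x = 0")
      case True
      have t0: "t x = 0" using True by (simp add: t_def)
      \<comment> \<open>On the axis \<open>q\<close> gives no control, but \<open>norm (t y)\<close>
        is the \<open>k\<close>-th root of a continuous function that vanishes at
        \<open>x\<close>.\<close>
      have "filterlim (\<lambda>y. root k (norm (hq (f (p y))))) (nhds (root k (norm (hq (f (p x)))))) (at x within S)"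
        using conth x unfolding continuous_on_def by (intro tendsto_real_root tendsto_norm) blast
      moreover have "root k (norm (hq (f (p x)))) = 0" unfolding tk[OF x, symmetric] t0 using k by (simp add: power_0_left)
      ultimately have lim: "filterlim (\<lambda>y. root k (norm (hq (f (p y))))) (nhds 0) (at x within S)" by simp
      have "\<forall>\<^sub>F y in at x within S. root k (norm (hq (f (p y)))) = norm (t y)"
        unfolding eventually_at_filter
      proof (intro always_eventually allI impI)
        fix y assume "y \<in> S"
        then show "root k (norm (hq (f (p y)))) = norm (t y)"
          unfolding tk[OF \<open>y \<in> S\<close>, symmetric] norm_power using k by (simp add: real_root_power_cancel)
      qed
      from Lim_transform_eventually[OF lim this] show ?thesis
        unfolding t0 by (rule tendsto_norm_zero_cancel)
    next
      case False
      let ?S' = "{x \<in> S. fst x \<noteq> 0}"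
      have "continuous_on ?S' (\<lambda>x. fst x powi u * q (p x))"
      proof (intro continuous_on_mult continuous_on_power_int continuous_on_fst continuous_on_id)
        show "continuous_on ?S' (\<lambda>x. q (p x))"
        proof (rule continuous_on_compose2[OF contq])
          show "continuous_on ?S' p" by (rule continuous_on_subset[OF continuous_p]) auto
          show "p ` ?S' \<subseteq> M - B" by (rule image_subsetI) (rule p_punctured; simp)
        qed
      qed simp
      then have "continuous_on ?S' t" by (rule continuous_on_eq) (simp add: t_def)
      then have "filterlim t (nhds (t x)) (at x within ?S')"
        using x False unfolding continuous_on_def by blast
      moreover have "open ((\<lambda>x :: complex \<times> real. fst x) -` (- {0}))"
        by (rule open_vimage) (auto intro!: continuous_intros)
      then have "at x within ?S' = at x within S"
        by (intro at_within_nhd[of _ "(\<lambda>x. fst x) -` (- {0})"]) (use False in auto)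
      ultimately show ?thesis by simp
    qed
  qed
  have contf': "continuous_on S f'"
  proof -
    have "continuous_on S (\<lambda>x. tq (f (p x)))"
      by (rule continuous_on_compose2[OF continuous_tq contfp]) (use pM fM in blast)
    then have "continuous_on S (\<lambda>x. (t x, tq (f (p x))))" by (rule continuous_on_Pair[OF contt])
    moreover have "(t x, tq (f (p x))) = f' x" if "x \<in> S" for x
      unfolding f'(3)[OF that, symmetric] snd_f'[OF that, symmetric] by simp
    ultimately show ?thesis by (rule continuous_on_eq)
  qed
  have inj: "inj_on f' S"
  proof (rule inj_onI)
    fix x y assume x: "x \<in> S" and y: "y \<in> S" and eq: "f' x = f' y"
    have "f (p x) = f (p y)" unfolding f'(2)[OF x, symmetric] f'(2)[OF y, symmetric] eq ..
    then have "fi (f (p x)) = fi (f (p y))" by (rule arg_cong)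
    then have pxy: "p x = p y" unfolding fif[OF pM[OF x]] fif[OF pM[OF y]] .
    have txy: "t x = t y" unfolding f'(3)[OF x, symmetric] f'(3)[OF y, symmetric] eq ..
    have zero: "fst x = 0 \<longleftrightarrow> fst y = 0"
      unfolding p_in_B_iff[OF x, symmetric] p_in_B_iff[OF y, symmetric] pxy ..
    have "fst x = fst y"
    proof (cases "fst x = 0")
      case False
      then have "q (p x) \<noteq> 0" using q[OF p_punctured[OF x False]] by simp
      then have "fst x powi u = fst y powi u" using txy False zero by (simp add: t_def pxy)
      then show ?thesis using u by (auto simp: power_int_minus)
    qed (use zero in simp)
    then show "x = y" by (rule cover_point_eqI[OF x y pxy])
  qed
  have surj: "f' ` S = S"
  proof (intro equalityI subsetI)
    fix y assume y: "y \<in> S"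
    have "fi (p y) \<in> p ` S" unfolding p_image using imageI[OF pM[OF y], of fi] unfolding fiM .
    then obtain x where x: "x \<in> S" "p x = fi (p y)" by (metis imageE)
    then have fpx: "f (p x) = p y" using ffi[OF pM[OF y]] by simp
    have "p (f' x) = p y" unfolding f'(2)[OF x(1)] by (rule fpx)
    then obtain i where i: "y = (rot ^^ i) (f' x)" by (rule fibre_rotate[OF f'(1)[OF x(1)] y])
    have "\<exists>x'\<in>S. p x' = p x \<and> t x' = \<omega> ^ i * t x"
    proof (cases "fst x = 0")
      case True
      then show ?thesis using x(1) by (intro bexI[of _ x]) (simp_all add: t_def)
    next
      case False
      have inv: "\<omega> ^ (i * (k - 1)) = inverse (\<omega> ^ i)"
      proof -
        have "\<omega> ^ (i * (k - 1)) * \<omega> ^ i = \<omega> ^ (i * k)"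
          using k by (simp add: power_add[symmetric] algebra_simps)
        also have "\<dots> = 1" using \<omega>_power_k[of i] by (simp add: power_mult)
        finally show ?thesis using \<omega>_nz by (simp add: field_simps)
      qed
      \<comment> \<open>For \<open>u = -1\<close> the rotation has to be inverted;
        \<open>i * (k - 1)\<close> does this with a natural exponent.\<close>
      define j where "j = (if u = 1 then i else i * (k - 1))"
      have "(\<omega> ^ j) powi u = \<omega> ^ i" using u inv by (auto simp: j_def power_int_minus)
      then have "t ((rot ^^ j) x) = \<omega> ^ i * t x"
        using False \<omega>_nz by (simp add: t_def fst_funpow_rot p_funpow_rot[OF x(1)] power_int_mult_distrib)
      then show ?thesis
        using x(1) by (intro bexI[of _ "(rot ^^ j) x"]) (simp_all add: p_funpow_rot funpow_rot_in)
    qed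
    then obtain x' where x': "x' \<in> S" "p x' = p x" "t x' = \<omega> ^ i * t x" by blast
    have "f' x' = y"
    proof (rule cover_point_eqI[OF f'(1)[OF x'(1)] y])
      show "p (f' x') = p y" unfolding f'(2)[OF x'(1)] x'(2) by (rule fpx)
      show "fst (f' x') = fst y" unfolding f'(3)[OF x'(1)] x'(3) i fst_funpow_rot f'(3)[OF x(1)] ..
    qed
    then show "y \<in> f' ` S" using x'(1) by (metis imageI)
  qed (use f'(1) in auto)
  obtain f'i where "homeomorphism S S f' f'i"
    using homeomorphism_compact[OF compact_S contf' surj inj] by blast
  then have "homeomorphic_maps (top_of_set S) (top_of_set S) f' f'i"
    unfolding homeomorphic_maps_def homeomorphism_def by (auto simp: continuous_map_in_subtopology)
  then have "homeomorphic_map (top_of_set S) (top_of_set S) f'"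
    by (rule homeomorphic_maps_imp_map)
  then show ?thesis unfolding lifts_def using f'(2) by blast
qed

text \<open>All indices of \<open>hq\<close> relative to \<open>R\<close> equal \<open>c\<close>, so
  one power of \<open>R\<close> removes them all and the quotient has a global logarithm.\<close>

lemma index_form:
  obtains c \<gamma> where "coprime c (int k)" "continuous_on (M - B) \<gamma>"
    "\<And>y. y \<in> M - B \<Longrightarrow> hq y = sc.R y powi c * exp (\<gamma> y)"
proof -
  obtain c where c: "coprime c (int k)"
    "\<And>j. j \<in> I \<Longrightarrow> germ_log (at (b j) within M) (\<lambda>y. hq y / sc.R y powi c)"
    by (rule index_constant) blast
  obtain \<gamma> where \<gamma>: "continuous_on (M - B) \<gamma>" "\<And>y. y \<in> M - B \<Longrightarrow> hq y / sc.R y powi c = exp (\<gamma> y)"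
  proof (rule sc.global_log[of "\<lambda>y. hq y / sc.R y powi c"])
    show "continuous_on (M - B) (\<lambda>y. hq y / sc.R y powi c)"
    proof (rule continuous_on_divide[OF _ continuous_R_powi])
      show "continuous_on (M - B) hq" using continuous_hq by (rule continuous_on_subset) blast
    qed (rule ballI, rule R_powi_nonzero)
    show "hq y / sc.R y powi c \<noteq> 0" if "y \<in> M - B" for y
      using hq_nonzero[OF that] sc.R_nonzero[OF that] by simp
  qed (use c(2) in blast)+
  show thesis
  proof (rule that[OF c(1) \<gamma>(1)])
    fix y assume y: "y \<in> M - B"
    show "hq y = sc.R y powi c * exp (\<gamma> y)"
      unfolding \<gamma>(2)[OF y, symmetric] using sc.R_nonzero[OF y] by simp
  qed
qed

text \<open>
  Pulling back \<open>R\<close> multiplies each index by a sign, and the existence of a lift fixes that sign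
  modulo \<open>k\<close>; as \<open>k > 2\<close>, all signs agree.
\<close>

lemma lifts_imp_R_form:
  assumes f: "homeomorphism M M f fi" and fB: "f ` B = B" and lift: "lifts S p f"
  obtains u \<gamma> where "u = 1 \<or> u = (-1::int)" "continuous_on (M - B) \<gamma>"
    "\<And>y. y \<in> M - B \<Longrightarrow> sc.R (f y) = sc.R y powi u * exp (\<gamma> y)"
proof -
  obtain c where c: "coprime c (int k)"
    "\<And>j. j \<in> I \<Longrightarrow> germ_log (at (b j) within M) (\<lambda>y. hq y / sc.R y powi c)"
    by (rule index_constant) blast
  obtain s q where sq: "continuous_on (M - B) q"
    "\<And>y. y \<in> M - B \<Longrightarrow> q y \<noteq> 0 \<and> hq (f y) = hq y ^ s * q y ^ k"
    by (rule lifts_imp_power[OF f fB lift]) blast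
  have "\<exists>u. (u = 1 \<or> u = -1) \<and> germ_log (at (b j) within M) (\<lambda>y. sc.R (f y) / sc.R y powi u)"
    if "j \<in> I" for j
    by (rule sc.R_homeo_index[OF f fB that]) blast
  then obtain u where u: "\<And>j. j \<in> I \<Longrightarrow> u j = 1 \<or> u j = (-1::int)"
     "\<And>j. j \<in> I \<Longrightarrow> germ_log (at (b j) within M) (\<lambda>y. sc.R (f y) / sc.R y powi u j)"
    by metis
  \<comment> \<open>At \<open>b j\<close> the function \<open>hq (f y)\<close> has index
    \<open>u j * c\<close>, and by the lifting equation it has index \<open>c * s + e * k\<close>,
    where \<open>e\<close> is the index of \<open>q\<close>. Coprimality cancels \<open>c\<close>
    modulo \<open>k\<close>.\<close>
  have cong: "int k dvd u j - int s" if j: "j \<in> I" for j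
  proof -
    obtain e where e: "germ_log (at (b j) within M) (\<lambda>y. q y / sc.R y powi e)"
      by (rule sc.index_exists[OF j sq(1)]) (use sq(2) in blast)+
    have "f (b j) \<in> f ` B" using j by (intro imageI)
    then have "f (b j) \<in> B" unfolding fB .
    then obtain i where i: "i \<in> I" "f (b j) = b i" by (rule imageE) 
    have "germ_log (at (f (b j)) within M) (\<lambda>y. hq y / sc.R y powi c)"
      unfolding i(2) by (rule c(2)[OF i(1)])
    then have g1: "germ_log (at (b j) within M) (\<lambda>y. hq (f y) / sc.R (f y) powi c)"
      by (rule sc.germ_log_homeo[OF f b_in[OF j]])
    have "germ_log (at (b j) within M)
       (\<lambda>y. (hq (f y) / sc.R (f y) powi c) * (sc.R (f y) / sc.R y powi u j) powi c
            / ((hq y / sc.R y powi c) powi int s * (q y / sc.R y powi e) powi int k))"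
      by (intro germ_log_mult germ_log_divide germ_log_powi g1 u(2)[OF j] c(2)[OF j] e)
    then have "germ_log (at (b j) within M) (\<lambda>y. sc.R y powi (c * int s + e * int k - u j * c))"
    proof (rule germ_log_cong)
      show "\<forall>\<^sub>F y in at (b j) within M. (hq (f y) / sc.R (f y) powi c) * (sc.R (f y) / sc.R y powi u j) powi c
            / ((hq y / sc.R y powi c) powi int s * (q y / sc.R y powi e) powi int k)
          = sc.R y powi (c * int s + e * int k - u j * c)"
        using sc.eventually_punctured[OF j]
      proof eventually_elim
        case (elim y)
        have nz: "sc.R y \<noteq> 0" "sc.R (f y) \<noteq> 0" "hq y \<noteq> 0" "q y \<noteq> 0"
          using sc.R_nonzero[OF elim] sc.R_nonzero[OF sc.homeo_punctured(1)[OF f fB elim]]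
            hq_nonzero[OF elim] sq(2)[OF elim] by simp_all
        have hf: "hq (f y) = hq y powi int s * q y powi int k" using sq(2)[OF elim] by simp
        have R1: "(sc.R (f y) / sc.R y powi u j) powi c = sc.R (f y) powi c / sc.R y powi (u j * c)"
          by (simp only: power_int_divide_distrib power_int_mult)
        have R2: "(hq y / sc.R y powi c) powi int s = hq y powi int s / sc.R y powi (c * int s)"
          by (simp only: power_int_divide_distrib power_int_mult)
        have R3: "(q y / sc.R y powi e) powi int k = q y powi int k / sc.R y powi (e * int k)"
          by (simp only: power_int_divide_distrib power_int_mult)
        have R4: "sc.R y powi (c * int s + e * int k - u j * c)
          = sc.R y powi (c * int s) * sc.R y powi (e * int k) / sc.R y powi (u j * c)"
          using nz(1) by (simp add: power_int_diff power_int_add)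
        have nz': "sc.R (f y) powi c \<noteq> 0" "hq y powi int s \<noteq> 0" "q y powi int k \<noteq> 0"
          "sc.R y powi (c * int s) \<noteq> 0" "sc.R y powi (e * int k) \<noteq> 0" "sc.R y powi (u j * c) \<noteq> 0"
          using nz by simp_all
        have alg: "(H * Q / A) * (A / X) / ((H / Y) * (Q / Z)) = Y * Z / X"
          if "A \<noteq> 0" "H \<noteq> 0" "Q \<noteq> 0" "X \<noteq> 0" "Y \<noteq> 0" "Z \<noteq> 0" for A H Q X Y Z :: complex
          using that by (simp add: field_simps)
        show ?case unfolding R1 R2 R3 R4 hf
          by (rule alg[OF nz'(1,2,3,6,4,5)])
      qed
    qed
    then have "c * int s + e * int k - u j * c = 0" by (rule sc.index_unique[OF j])
    then have "c * (u j - int s) = int k * e" by (simp add: algebra_simps)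
    then have "int k dvd c * (u j - int s)" by simp
    then show ?thesis using c(1) by (metis coprime_commute coprime_dvd_mult_right_iff)
  qed
  have const: "u j = u 1" if j: "j \<in> I" for j
  proof -
    have one: "1 \<in> I" by simp
    have "int k dvd (u j - int s) - (u 1 - int s)" by (rule dvd_diff[OF cong[OF j] cong[OF one]])
    then have "int k dvd u j - u 1" by simp
    then have "u j - u 1 = 0 \<or> int k \<le> \<bar>u j - u 1\<bar>" by (metis dvd_imp_le_int abs_of_nat)
    moreover have "\<bar>u j - u 1\<bar> \<le> 2" using u(1)[OF j] u(1)[OF one] by auto
    ultimately show ?thesis using k by linarith
  qed
  obtain \<gamma> where \<gamma>: "continuous_on (M - B) \<gamma>" "\<And>y. y \<in> M - B \<Longrightarrow> sc.R (f y) / sc.R y powi u 1 = exp (\<gamma> y)"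
  proof (rule sc.global_log[of "\<lambda>y. sc.R (f y) / sc.R y powi u 1"])
    show "continuous_on (M - B) (\<lambda>y. sc.R (f y) / sc.R y powi u 1)"
      by (rule continuous_on_divide[OF sc.continuous_R_homeo[OF f fB] continuous_R_powi])
         (rule ballI, rule R_powi_nonzero)
    show "sc.R (f y) / sc.R y powi u 1 \<noteq> 0" if "y \<in> M - B" for y
      using sc.R_nonzero[OF that] sc.R_nonzero[OF sc.homeo_punctured(1)[OF f fB that]] by simp
    show "germ_log (at (b j) within M) (\<lambda>y. sc.R (f y) / sc.R y powi u 1)" if "j \<in> I" for j
      using u(2)[OF that] unfolding const[OF that] .
  qed blast
  show thesis
  proof (rule that[OF u(1)[of 1] \<gamma>(1)])
    fix y assume y: "y \<in> M - B"
    show "sc.R (f y) = sc.R y powi u 1 * exp (\<gamma> y)"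
      unfolding \<gamma>(2)[OF y, symmetric] using sc.R_nonzero[OF y] by simp
  qed simp
qed

text \<open>Since \<open>hq\<close> is \<open>R powi c\<close> times an exponential, the assumption
  on \<open>R\<close> turns into \<open>hq (f y) = hq y powi u * exp (e y)\<close>, and the
  exponential has the \<open>k\<close>-th root \<open>exp (e y / k)\<close>.\<close>

lemma R_form_imp_lifts:
  assumes f: "homeomorphism M M f fi" and fB: "f ` B = B" and u: "u = 1 \<or> u = (-1::int)"
    and \<gamma>: "continuous_on (M - B) \<gamma>" "\<And>y. y \<in> M - B \<Longrightarrow> sc.R (f y) = sc.R y powi u * exp (\<gamma> y)"
  shows "lifts S p f"
proof -
  obtain c h where h: "continuous_on (M - B) h" "\<And>y. y \<in> M - B \<Longrightarrow> hq y = sc.R y powi c * exp (h y)"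
    by (rule index_form) blast
  define e where "e y = of_int c * \<gamma> y + h (f y) - of_int u * h y" for y
  have "continuous_on (M - B) (\<lambda>y. h (f y))"
  proof (rule continuous_on_compose2[OF h(1)])
    show "continuous_on (M - B) f"
      using f unfolding homeomorphism_def by (auto intro: continuous_on_subset)
    show "f ` (M - B) \<subseteq> M - B" by (rule image_subsetI) (rule sc.homeo_punctured(1)[OF f fB])
  qed
  then have conte: "continuous_on (M - B) e"
    unfolding e_def by (intro continuous_intros \<gamma> h)
  show ?thesis
  proof (rule power_imp_lifts[OF f fB u, of "\<lambda>y. exp (e y / of_nat k)"])
    show "continuous_on (M - B) (\<lambda>y. exp (e y / of_nat k))"
      using k by (intro continuous_on_exp continuous_on_divide conte continuous_on_const) simp_all
    fix y assume y: "y \<in> M - B"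
    have "exp (e y / of_nat k) ^ k = exp (e y)" using k by (simp flip: exp_of_nat_mult)
    moreover have "hq (f y) = hq y powi u * exp (e y)"
    proof -
      have "hq (f y) = (sc.R y powi u * exp (\<gamma> y)) powi c * exp (h (f y))"
        unfolding h(2)[OF sc.homeo_punctured(1)[OF f fB y]] \<gamma>(2)[OF y] ..
      also have "\<dots> = (sc.R y powi u) powi c * (exp (of_int c * \<gamma> y) * exp (h (f y)))"
        by (simp add: power_int_mult_distrib exp_power_int)
      also have "(sc.R y powi u) powi c = (sc.R y powi c) powi u"
        by (simp only: power_int_mult[symmetric] mult.commute)
      also have "exp (of_int c * \<gamma> y) * exp (h (f y)) = exp (of_int u * h y) * exp (e y)"
        by (simp add: e_def flip: exp_add)
      also have "exp (of_int u * h y) = exp (h y) powi u" by (simp add: exp_power_int)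
      finally show ?thesis unfolding h(2)[OF y] by (simp add: power_int_mult_distrib)
    qed
    ultimately show "exp (e y / of_nat k) \<noteq> 0 \<and> hq (f y) = hq y powi u * exp (e y / of_nat k) ^ k"
      by simp
  qed
qed

end

text \<open>The behaviour of \<open>R\<close> under \<open>f\<close> mentions no cover: it is
  deduced from the lift to \<open>S1\<close> and then produces a lift to \<open>S2\<close>.\<close>

lemma lifts_independent_of_degree:
  assumes "k1 > 2" "k2 > 2" "g1 div (k1 - 1) = n" "g2 div (k2 - 1) = n"
    and cover1: "balanced_superelliptic_cover g1 k1 S1 p1 b"
    and cover2: "balanced_superelliptic_cover g2 k2 S2 p2 b"
    and f: "f \<in> branch_homeos (b ` {1..2 * n + 2})" and lift: "lifts S1 p1 f"
  shows "lifts S2 p2 f"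
proof -
  let ?M = "topspace (nsphere 2)"
  interpret c1: superelliptic_cover g1 k1 S1 p1 b n
    by unfold_locales (use assms in simp_all)
  have "b (2 * n + 2) \<in> ?M" by (rule c1.b_in) simp
  then obtain \<tau> \<sigma> where chart: "homeomorphism (UNIV :: complex set) (?M - {b (2 * n + 2)}) \<tau> \<sigma>"
    by (rule sphere_chart_exists)
  \<comment> \<open>One chart for both covers, so that both refer to the same
    \<open>R\<close>.\<close>
  interpret sphere_chart n b \<tau> \<sigma>
    by unfold_locales (rule c1.inj_b, erule c1.b_in, rule chart)
  interpret c1: cover_chart g1 k1 S1 p1 b n \<tau> \<sigma> ..
  interpret c2: superelliptic_cover g2 k2 S2 p2 b n
    by unfold_locales (use assms in simp_all)
  interpret c2: cover_chart g2 k2 S2 p2 b n \<tau> \<sigma> ..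
  have "homeomorphic_map (nsphere 2) (nsphere 2) f" and fB: "f ` (b ` {1..2 * n + 2}) = b ` {1..2 * n + 2}"
    using f unfolding branch_homeos_def by auto
  then have "homeomorphic_map (top_of_set ?M) (top_of_set ?M) f"
    by (simp only: nsphere2_eq_top_of_set[symmetric])
  then obtain fi where fi: "homeomorphic_maps (top_of_set ?M) (top_of_set ?M) f fi"
    unfolding homeomorphic_map_maps by (rule exE)
  have hom: "homeomorphism ?M ?M f fi"
    using fi unfolding homeomorphic_maps_def
    by (intro homeomorphismI) (auto simp: continuous_map_in_subtopology)
  obtain u g where "u = 1 \<or> u = (-1::int)" "continuous_on (?M - b ` {1..2 * n + 2}) g"
    "\<And>y. y \<in> ?M - b ` {1..2 * n + 2} \<Longrightarrow> R (f y) = R y powi u * exp (g y)"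
    by (rule c1.lifts_imp_R_form[OF hom fB lift]) blast
  then show ?thesis by (rule c2.R_form_imp_lifts[OF hom fB])
qed

theorem mainTheorem6:
  fixes g1 g2 k1 k2 n :: nat
    and S1 S2 :: "(complex \<times> real) set"
    and p1 p2 :: "complex \<times> real \<Rightarrow> nat \<Rightarrow> real"
    and b :: "nat \<Rightarrow> nat \<Rightarrow> real"
  assumes "g1 \<ge> 2" and "g2 \<ge> 2" and "k1 > 2" and "k2 > 2"
    and "(k1 - 1) dvd g1" and "(k2 - 1) dvd g2"
    and "g1 div (k1 - 1) = n" and "g2 div (k2 - 1) = n"
    and "balanced_superelliptic_cover g1 k1 S1 p1 b"
    and "balanced_superelliptic_cover g2 k2 S2 p2 b"
  shows "LMod S1 p1 (b ` {1..2 * n + 2}) = LMod S2 p2 (b ` {1..2 * n + 2})"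
proof -
  have "lifts S1 p1 f \<longleftrightarrow> lifts S2 p2 f" if "f \<in> branch_homeos (b ` {1..2 * n + 2})" for f
    using lifts_independent_of_degree[OF assms(3,4,7-10) that]
      lifts_independent_of_degree[OF assms(4,3,8,7,10,9) that] by (rule iffI)
  then have "{f \<in> branch_homeos (b ` {1..2 * n + 2}). lifts S1 p1 f}
      = {f \<in> branch_homeos (b ` {1..2 * n + 2}). lifts S2 p2 f}"
    by (rule Collect_cong[OF conj_cong[OF refl]])
  then show ?thesis unfolding LMod_def by (simp only:)
qed

end
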